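(* Let $p$ be a prime, let $k=\mathbb{F}_p$ be the field with $p$ elements, and let $G$ and $H$ be finite $p$-groups. Then $kG\cong kH$ (as $k$-algebras) if and only if $k(\mathrm{NAb}(G))\cong k(\mathrm{NAb}(H))$ (as $k$-algebras) and $\mathrm{Ab}(G)\cong \mathrm{Ab}(H)$ (as groups).
   Context: For a group $\Gamma$, $k\Gamma$ denotes the group algebra of $\Gamma$ over $k$. For a finite $p$-group $G$, consider internal direct product decompositions $G=\mathrm{Ab}(G)\oplus \mathrm{NAb}(G)$ where $\mathrm{Ab}(G)$ and $\mathrm{NAb}(G)$ are subgroups of $G$ such that $\mathrm{Ab}(G)$ is abelian and maximal such that a decomposition like that exists (so $\mathrm{NAb}(G)$ has no non-trivial abelian direct factor). By the Krull–Remak–Schmidt theorem the isomorphism types of $\mathrm{Ab}(G)$ and $\mathrm{NAb}(G)$ do not depend on the chosen decomposition. Equivalently, in a decomposition of $G$ as a direct product of indecomposable groups, $\mathrm{Ab}(G)$ is the product of the abelian factors and $\mathrm{NAb}(G)$ the product of the non-abelian ones. *)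

theory Defs
  imports "HOL-Algebra.Algebra"
begin

text \<open>
  The group algebra is formed over an arbitrary commutative ring and an arbitrary group: its
  elements are the finitely supported functions from the group to the coefficients, with
  \<^term>\<open>undefined\<close> outside the carrier of the group, so that elements are equal iff their
  coefficients are. The sum in the convolution product runs over the support of the left factor
  because \<^const>\<open>finsum\<close> is only meaningful on finite sets. The library locale
  \<^locale>\<open>algebra\<close> is restricted to commutative algebras, hence only its record type
  \<^typ>\<open>('k, 'x) module\<close> is used.
\<close>

definition group_algebra ::
    "('k, 'm) ring_scheme \<Rightarrow> ('g, 'n) monoid_scheme \<Rightarrow> ('k, 'g \<Rightarrow> 'k) module" where
  "group_algebra K G =
    \<lparr>carrier = {f \<in> carrier G \<rightarrow>\<^sub>E carrier K. finite {x \<in> carrier G. f x \<noteq> \<zero>\<^bsub>K\<^esub>}},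
     monoid.mult = (\<lambda>f h. \<lambda>x\<in>carrier G.
       \<Oplus>\<^bsub>K\<^esub>y\<in>{y \<in> carrier G. f y \<noteq> \<zero>\<^bsub>K\<^esub>}. f y \<otimes>\<^bsub>K\<^esub> h (inv\<^bsub>G\<^esub> y \<otimes>\<^bsub>G\<^esub> x)),
     one = (\<lambda>x\<in>carrier G. if x = \<one>\<^bsub>G\<^esub> then \<one>\<^bsub>K\<^esub> else \<zero>\<^bsub>K\<^esub>),
     ring.zero = (\<lambda>x\<in>carrier G. \<zero>\<^bsub>K\<^esub>),
     ring.add = (\<lambda>f h. \<lambda>x\<in>carrier G. f x \<oplus>\<^bsub>K\<^esub> h x),
     smult = (\<lambda>c f. \<lambda>x\<in>carrier G. c \<otimes>\<^bsub>K\<^esub> f x)\<rparr>"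

definition algebra_iso ::
    "('k, 'm) ring_scheme \<Rightarrow> ('k, 'a, 'c) module_scheme \<Rightarrow> ('k, 'b, 'd) module_scheme
      \<Rightarrow> ('a \<Rightarrow> 'b) set" where
  "algebra_iso K A B =
    {\<phi> \<in> ring_iso A B. \<forall>c\<in>carrier K. \<forall>x\<in>carrier A. \<phi> (c \<odot>\<^bsub>A\<^esub> x) = c \<odot>\<^bsub>B\<^esub> \<phi> x}"

definition algebra_isomorphic ::
    "('k, 'm) ring_scheme \<Rightarrow> ('k, 'a, 'c) module_scheme \<Rightarrow> ('k, 'b, 'd) module_scheme \<Rightarrow> bool" where
  "algebra_isomorphic K A B \<longleftrightarrow> algebra_iso K A B \<noteq> {}"

definition finite_p_group :: "nat \<Rightarrow> ('g, 'n) monoid_scheme \<Rightarrow> bool" where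
  "finite_p_group p G \<longleftrightarrow> group G \<and> finite (carrier G) \<and> (\<exists>n. order G = p ^ n)"

definition internal_direct_product :: "('g, 'n) monoid_scheme \<Rightarrow> 'g set \<Rightarrow> 'g set \<Rightarrow> bool" where
  "internal_direct_product G A N \<longleftrightarrow>
    A \<lhd> G \<and> N \<lhd> G \<and> A \<inter> N = {\<one>\<^bsub>G\<^esub>} \<and> A <#>\<^bsub>G\<^esub> N = carrier G"

definition abelian_decomposition :: "('g, 'n) monoid_scheme \<Rightarrow> 'g set \<Rightarrow> 'g set \<Rightarrow> bool" where
  "abelian_decomposition G A N \<longleftrightarrow>
    internal_direct_product G A N \<and> comm_group (G\<lparr>carrier := A\<rparr>)"

text \<open>
  \<^term>\<open>Ab_NAb_decomposition G A N\<close> says that \<^term>\<open>A\<close> and \<^term>\<open>N\<close> are a possible choice of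
  $\mathrm{Ab}(G)$ and $\mathrm{NAb}(G)$. These subgroups are unique only up to isomorphism, hence
  a predicate rather than two functions. Maximality refers to inclusion of subgroups.
\<close>

definition Ab_NAb_decomposition :: "('g, 'n) monoid_scheme \<Rightarrow> 'g set \<Rightarrow> 'g set \<Rightarrow> bool" where
  "Ab_NAb_decomposition G A N \<longleftrightarrow>
    abelian_decomposition G A N \<and>
    (\<forall>A' N'. abelian_decomposition G A' N' \<longrightarrow> A \<subseteq> A' \<longrightarrow> A' = A)"

lemma Ab_NAb_decomposition_exists:
  assumes "group G" "finite (carrier G)"
  shows "\<exists>A N. Ab_NAb_decomposition G A N"
proof -
  interpret group G by fact
  let ?S = "{A. \<exists>N. abelian_decomposition G A N}"
  have "?S \<subseteq> Pow (carrier G)"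
    by (auto simp: abelian_decomposition_def internal_direct_product_def
        dest!: normal_imp_subgroup subgroup.subset)
  then have fin: "finite ?S"
    using assms(2) by (simp add: finite_subset)
  have "carrier G \<lhd> G"
    by (simp add: normal_inv_iff subgroup_self)
  moreover have "{\<one>\<^bsub>G\<^esub>} <#>\<^bsub>G\<^esub> carrier G = carrier G"
    by (auto simp: set_mult_def)
  moreover have "comm_group (G\<lparr>carrier := {\<one>\<^bsub>G\<^esub>}\<rparr>)"
    by (intro group.group_comm_groupI subgroup_imp_group triv_subgroup) auto
  ultimately have "abelian_decomposition G {\<one>\<^bsub>G\<^esub>} (carrier G)"
    by (simp add: abelian_decomposition_def internal_direct_product_def one_is_normal)
  then have "?S \<noteq> {}" by blast
  then obtain A where "A \<in> ?S" "\<forall>A'\<in>?S. A \<subseteq> A' \<longrightarrow> A = A'"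
    using finite_has_maximal[OF fin] by blast
  then show ?thesis
    unfolding Ab_NAb_decomposition_def by blast
qed

end

theory Submission
  imports Defs
begin

text \<open>
  Write \<open>k\<close> for the field with \<open>p\<close> elements and \<open>kG\<close> for the group algebra. From right to left the
  theorem holds because \<open>kG\<close> is the tensor product of \<open>k(Ab(G))\<close> and \<open>k(NAb(G))\<close>: isomorphisms of the
  two factors combine to an isomorphism of the group algebras (\<open>factor_ring_iso\<close>).

  From left to right, cyclic factors of the abelian parts are split off one at a time. Let
  \<open>\<phi> : kG \<rightarrow> kH\<close> be an isomorphism, let \<open>h\<close> of order \<open>q = p ^ Suc m\<close> generate a direct factor of
  \<open>Ab(H)\<close>, and let \<open>u\<close> be the preimage of \<open>h\<close>, a central unit of \<open>kG\<close> with \<open>u\<^sup>q = 1\<close>. The main point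
  (\<open>central_unit_linear\<close>) is that homomorphisms \<open>\<delta> : G \<rightarrow> (k, +)\<close>, extended linearly to \<open>kG\<close>, do
  not distinguish \<open>u\<close> from a suitable group element \<open>y \<in> Z(G)\<close> with \<open>y\<^sup>q = 1\<close>. Indeed a class
  function on a \<open>p\<close>-group has the same sum over the group as over its centre, so restriction of
  functions to \<open>Z(G)\<close> is a ring homomorphism from the centre of \<open>kG\<close> to \<open>kZ(G)\<close>; there the
  \<open>q\<close>-th power map is induced by \<open>z \<mapsto> z\<^sup>q\<close>, and \<open>u\<^sup>q = 1\<close> says that the coefficients of \<open>u\<close> sum to
  0 over every fibre of this map, except for the fibre over 1, where the sum is 1.

  Projecting \<open>kH\<close> to the group algebra of \<open>\<langle>h\<rangle>\<close> and reading off the linear coefficient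
  \<open>h\<^sup>i \<mapsto> i\<close> yields such a \<open>\<delta>\<close> with \<open>\<delta>(u) = 1\<close>, hence \<open>\<delta>(y) = 1\<close>. Now write \<open>y = ab\<close> along
  \<open>G = Ab(G) \<times> NAb(G)\<close>. A central \<open>x\<close> with \<open>x\<^sup>q = 1\<close> and \<open>\<delta>(x) \<noteq> 0\<close> has an image of order \<open>q\<close> in a
  group of units which is abelian of exponent \<open>q\<close>, and therefore generates a direct factor
  (\<open>direct_factor_criterion\<close>). As \<open>NAb(G)\<close> has no abelian factor, \<open>\<delta>(b) = 0\<close>; thus \<open>\<delta>(a) \<noteq> 0\<close> and
  \<open>a\<close> generates a direct factor of order \<open>q\<close> of \<open>Ab(G)\<close>.

  With \<open>G = \<langle>a\<rangle> \<times> N\<close> and \<open>H = \<langle>h\<rangle> \<times> M\<close>, the composite \<open>kN \<rightarrow> kG \<rightarrow> kH \<rightarrow> kM\<close> is an isomorphism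
  (\<open>cancel_cyclic_factor\<close>). Otherwise its kernel would contain a non-zero vector fixed by the
  \<open>p\<close>-group \<open>N\<close>, and this forces \<open>(u - 1) ^ (q - 1)\<close> to vanish in the group algebra of \<open>\<langle>a\<rangle>\<close>;
  but there \<open>u - 1\<close> generates the augmentation ideal, whose power of exponent \<open>q - 1\<close> is not 0.
  Induction on the abelian part finishes the proof.

  Since \<open>k\<close> is a prime field, \<open>kG\<close> is generated by \<open>G\<close> as an additive group. Hence identities
  between additive maps are checked on group elements, and ring isomorphisms are automatically
  algebra isomorphisms.
\<close>

section \<open>Group algebras over a prime field\<close>

abbreviation restrict_group :: "('g, 'n) monoid_scheme \<Rightarrow> 'g set \<Rightarrow> ('g, 'n) monoid_scheme"
    (infixl "\<restriction>" 90) where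
  "G \<restriction> S \<equiv> G\<lparr>carrier := S\<rparr>"

lemma group_algebra_carrier_iff:
  assumes "finite (carrier G)"
  shows "f \<in> carrier (group_algebra K G) \<longleftrightarrow> f \<in> carrier G \<rightarrow>\<^sub>E carrier K"
  using assms by (simp add: group_algebra_def)

locale finite_group = group +
  assumes finite_carrier [simp]: "finite (carrier G)"

locale prime_field = field K for K (structure) +
  fixes p :: nat
  assumes prime: "Factorial_Ring.prime p" and card_K: "card (carrier K) = p"
begin

abbreviation ga where "ga \<equiv> group_algebra K"

definition basis :: "('g, 'n) monoid_scheme \<Rightarrow> 'g \<Rightarrow> 'g \<Rightarrow> 'a" where
  "basis G x = (\<lambda>y\<in>carrier G. if y = x then \<one> else \<zero>)"

text \<open>
  The \<open>k\<close>-linear extension of a function \<open>F : G \<rightarrow> k\<close> to the group algebra; the augmentation is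
  the case where \<open>F\<close> is constantly 1.
\<close>

definition lin :: "('g, 'n) monoid_scheme \<Rightarrow> ('g \<Rightarrow> 'a) \<Rightarrow> ('g \<Rightarrow> 'a) \<Rightarrow> 'a" where
  "lin G F f = (\<Oplus>x\<in>carrier G. f x \<otimes> F x)"

text \<open>
  The \<open>k\<close>-linear extension of a function \<open>u : G \<rightarrow> kH\<close> to the group algebra.
\<close>

definition ext :: "('g, 'n) monoid_scheme \<Rightarrow> ('h, 'l) monoid_scheme \<Rightarrow> ('g \<Rightarrow> 'h \<Rightarrow> 'a) \<Rightarrow>
    ('g \<Rightarrow> 'a) \<Rightarrow> 'h \<Rightarrow> 'a" where
  "ext G H u f = (\<lambda>y\<in>carrier H. lin G (\<lambda>x. u x y) f)"

lemma finite_K: "finite (carrier K)"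
  using card_K prime prime_gt_0_nat card_gt_0_iff by metis

text \<open>
  The additive group has prime order, so every element other than 0 generates it.
\<close>

lemma field_elem_multiple_of_one:
  assumes "c \<in> carrier K"
  shows "\<exists>n::nat. c = [n] \<cdot> \<one>"
proof -
  have 1: "\<one> \<in> carrier K" by simp
  note fin = finite_K
  have "add.ord \<one> dvd p"
    using add.ord_dvd_group_order[OF 1] card_K by (simp add: order_def)
  moreover have "add.ord \<one> \<noteq> 1"
    using add.ord_eq_1[OF 1] by simp
  ultimately have "add.ord \<one> = p" using prime by (auto simp: prime_nat_iff)
  then have "card (generate (add_monoid K) {\<one>}) = card (carrier K)"
    using add.generate_pow_card[OF 1] card_K by simp
  moreover have "generate (add_monoid K) {\<one>} \<subseteq> carrier K"
    using add.generate_incl[of "{\<one>}"] by simp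
  ultimately have "generate (add_monoid K) {\<one>} = carrier K"
    using finite_K card_subset_eq by blast
  then have "c \<in> generate (add_monoid K) {\<one>}" using assms by simp
  then show ?thesis
    unfolding add.generate_pow_on_finite_carrier[OF fin 1] by (auto simp: add_pow_def)
qed

lemma char_p:
  assumes "c \<in> carrier K" and "p dvd n"
  shows "[(n::nat)] \<cdot> c = \<zero>"
proof -
  have "add.ord c dvd p"
    using add.ord_dvd_group_order[of c] card_K assms by (simp add: order_def)
  then show ?thesis using add.pow_eq_id[of c n] assms by (auto simp: add_pow_def)
qed

lemma finsum_const: "c \<in> carrier K \<Longrightarrow> finite A \<Longrightarrow> (\<Oplus>x\<in>A. c) = [card A] \<cdot> c"
  using add.finprod_const[of c A] by (simp add: add_pow_def finsum_def)

context
  fixes G :: "('g, 'n) monoid_scheme"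
  assumes G: "finite_group G"
begin

interpretation G: finite_group G by (rule G)
lemmas fin = G.finite_carrier

lemma ga_mem: "f \<in> carrier (ga G) \<longleftrightarrow> f \<in> carrier G \<rightarrow>\<^sub>E carrier K"
  by (rule group_algebra_carrier_iff[OF fin])

lemma ga_mem_closed: "f \<in> carrier (ga G) \<Longrightarrow> x \<in> carrier G \<Longrightarrow> f x \<in> carrier K"
  using ga_mem by blast

lemma ga_eqI:
  assumes "f \<in> carrier (ga G)" "h \<in> carrier (ga G)" "\<And>x. x \<in> carrier G \<Longrightarrow> f x = h x"
  shows "f = h"
  using assms unfolding ga_mem by (rule PiE_ext)

lemma ga_add: "f \<oplus>\<^bsub>ga G\<^esub> h = (\<lambda>x\<in>carrier G. f x \<oplus> h x)"
  by (simp add: group_algebra_def)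

lemma ga_add_apply: "x \<in> carrier G \<Longrightarrow> (f \<oplus>\<^bsub>ga G\<^esub> h) x = f x \<oplus> h x"
  by (simp add: ga_add)

lemma ga_zero: "\<zero>\<^bsub>ga G\<^esub> = (\<lambda>x\<in>carrier G. \<zero>)"
  by (simp add: group_algebra_def)

lemma ga_one: "\<one>\<^bsub>ga G\<^esub> = basis G \<one>\<^bsub>G\<^esub>"
  by (simp add: group_algebra_def basis_def)

lemma ga_smult: "c \<odot>\<^bsub>ga G\<^esub> f = (\<lambda>x\<in>carrier G. c \<otimes> f x)"
  by (simp add: group_algebra_def)

lemma ga_mult:
  assumes "f \<in> carrier (ga G)" "h \<in> carrier (ga G)"
  shows "f \<otimes>\<^bsub>ga G\<^esub> h =
    (\<lambda>x\<in>carrier G. \<Oplus>y\<in>carrier G. f y \<otimes> h (inv\<^bsub>G\<^esub> y \<otimes>\<^bsub>G\<^esub> x))"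
proof -
  have "(\<Oplus>y\<in>{y \<in> carrier G. f y \<noteq> \<zero>}. f y \<otimes> h (inv\<^bsub>G\<^esub> y \<otimes>\<^bsub>G\<^esub> x)) =
      (\<Oplus>y\<in>carrier G. f y \<otimes> h (inv\<^bsub>G\<^esub> y \<otimes>\<^bsub>G\<^esub> x))" if "x \<in> carrier G" for x
    using assms that
    by (intro add.finprod_mono_neutral_cong_left fin) (auto simp: ga_mem_closed)
  then show ?thesis by (auto simp: group_algebra_def)
qed

lemma ga_mult_apply:
  assumes "f \<in> carrier (ga G)" "h \<in> carrier (ga G)" "x \<in> carrier G"
  shows "(f \<otimes>\<^bsub>ga G\<^esub> h) x = (\<Oplus>y\<in>carrier G. f y \<otimes> h (inv\<^bsub>G\<^esub> y \<otimes>\<^bsub>G\<^esub> x))"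
  using assms by (simp add: ga_mult)

lemma ga_card: "card (carrier (ga G)) = p ^ order G"
proof -
  have "carrier (ga G) = carrier G \<rightarrow>\<^sub>E carrier K" using ga_mem by blast
  then show ?thesis using card_K by (simp add: card_PiE fin order_def)
qed

lemma ga_finite: "finite (carrier (ga G))"
  using ga_card prime by (metis card.infinite prime_gt_0_nat power_not_zero not_gr_zero)

lemma ga_abelian_group: "abelian_group (ga G)"
proof (rule abelian_groupI)
  fix x assume x: "x \<in> carrier (ga G)"
  show "\<exists>y\<in>carrier (ga G). y \<oplus>\<^bsub>ga G\<^esub> x = \<zero>\<^bsub>ga G\<^esub>"
    by (rule bexI[of _ "\<lambda>z\<in>carrier G. \<ominus> (x z)"])
      (use x in \<open>auto simp: ga_add ga_zero ga_mem PiE_iff l_neg intro!: restrict_ext\<close>)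
qed (auto simp: ga_mem ga_add ga_zero PiE_iff a_assoc intro!: restrict_ext a_comm
      intro: extensionalityI)

lemma basis_mem [simp]: "basis G x \<in> carrier (ga G)"
  by (auto simp: ga_mem basis_def)

lemma basis_apply: "y \<in> carrier G \<Longrightarrow> basis G x y = (if y = x then \<one> else \<zero>)"
  by (simp add: basis_def)

interpretation A: abelian_group "ga G" by (rule ga_abelian_group)

lemma finsum_delta:
  assumes "a \<in> carrier G" "f \<in> carrier G \<rightarrow> carrier K"
  shows "(\<Oplus>y\<in>carrier G. if y = a then f y else \<zero>) = f a"
  using add.finprod_singleton_swap[OF assms(1) fin assms(2)] by simp

lemma ga_mult_closed:
  assumes "f \<in> carrier (ga G)" "h \<in> carrier (ga G)"
  shows "f \<otimes>\<^bsub>ga G\<^esub> h \<in> carrier (ga G)"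
  using assms by (auto simp: ga_mult ga_mem PiE_iff intro!: finsum_closed)

lemma basis_mult:
  assumes "x \<in> carrier G" "y \<in> carrier G"
  shows "basis G x \<otimes>\<^bsub>ga G\<^esub> basis G y = basis G (x \<otimes>\<^bsub>G\<^esub> y)"
proof (rule ga_eqI)
  fix z assume z: "z \<in> carrier G"
  have "(\<Oplus>w\<in>carrier G. basis G x w \<otimes> basis G y (inv\<^bsub>G\<^esub> w \<otimes>\<^bsub>G\<^esub> z)) =
      (\<Oplus>w\<in>carrier G. if w = x then (if z = x \<otimes>\<^bsub>G\<^esub> y then \<one> else \<zero>) else \<zero>)"
  proof (rule add.finprod_cong')
    fix w assume w: "w \<in> carrier G"
    have "inv\<^bsub>G\<^esub> w \<otimes>\<^bsub>G\<^esub> z = y \<longleftrightarrow> z = w \<otimes>\<^bsub>G\<^esub> y"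
      using w z assms G.inv_solve_left' by metis
    then show "basis G x w \<otimes> basis G y (inv\<^bsub>G\<^esub> w \<otimes>\<^bsub>G\<^esub> z) =
        (if w = x then (if z = x \<otimes>\<^bsub>G\<^esub> y then \<one> else \<zero>) else \<zero>)"
      using w z by (auto simp: basis_def)
  qed auto
  also have "\<dots> = (if z = x \<otimes>\<^bsub>G\<^esub> y then \<one> else \<zero>)"
    by (rule finsum_delta) (use assms in auto)
  finally show "(basis G x \<otimes>\<^bsub>ga G\<^esub> basis G y) z = basis G (x \<otimes>\<^bsub>G\<^esub> y) z"
    using z by (simp add: ga_mult basis_def[of G "x \<otimes>\<^bsub>G\<^esub> y"])
qed (auto intro: ga_mult_closed)

lemma ga_distribl:
  assumes "f \<in> carrier (ga G)" "g \<in> carrier (ga G)" "h \<in> carrier (ga G)"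
  shows "(f \<oplus>\<^bsub>ga G\<^esub> g) \<otimes>\<^bsub>ga G\<^esub> h = f \<otimes>\<^bsub>ga G\<^esub> h \<oplus>\<^bsub>ga G\<^esub> g \<otimes>\<^bsub>ga G\<^esub> h"
proof -
  have "(\<Oplus>y\<in>carrier G. (f \<oplus>\<^bsub>ga G\<^esub> g) y \<otimes> h (inv\<^bsub>G\<^esub> y \<otimes>\<^bsub>G\<^esub> x)) =
    (\<Oplus>y\<in>carrier G. f y \<otimes> h (inv\<^bsub>G\<^esub> y \<otimes>\<^bsub>G\<^esub> x) \<oplus> g y \<otimes> h (inv\<^bsub>G\<^esub> y \<otimes>\<^bsub>G\<^esub> x))"
    if "x \<in> carrier G" for x
    using that assms by (intro add.finprod_cong') (auto simp: ga_add ga_mem_closed l_distr)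
  then show ?thesis
    using assms by (intro ga_eqI)
      (simp_all add: ga_mult_apply ga_add_apply ga_mem_closed finsum_addf Pi_def ga_mult_closed)
qed

lemma ga_distribr:
  assumes "f \<in> carrier (ga G)" "g \<in> carrier (ga G)" "h \<in> carrier (ga G)"
  shows "h \<otimes>\<^bsub>ga G\<^esub> (f \<oplus>\<^bsub>ga G\<^esub> g) = h \<otimes>\<^bsub>ga G\<^esub> f \<oplus>\<^bsub>ga G\<^esub> h \<otimes>\<^bsub>ga G\<^esub> g"
proof -
  have "(\<Oplus>y\<in>carrier G. h y \<otimes> (f \<oplus>\<^bsub>ga G\<^esub> g) (inv\<^bsub>G\<^esub> y \<otimes>\<^bsub>G\<^esub> x)) =
    (\<Oplus>y\<in>carrier G. h y \<otimes> f (inv\<^bsub>G\<^esub> y \<otimes>\<^bsub>G\<^esub> x) \<oplus> h y \<otimes> g (inv\<^bsub>G\<^esub> y \<otimes>\<^bsub>G\<^esub> x))"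
    if "x \<in> carrier G" for x
    using that assms by (intro add.finprod_cong') (auto simp: ga_add ga_mem_closed r_distr)
  then show ?thesis
    using assms by (intro ga_eqI)
      (simp_all add: ga_mult_apply ga_add_apply ga_mem_closed finsum_addf Pi_def ga_mult_closed)
qed

lemma ga_mult_zero:
  assumes "f \<in> carrier (ga G)"
  shows "f \<otimes>\<^bsub>ga G\<^esub> \<zero>\<^bsub>ga G\<^esub> = \<zero>\<^bsub>ga G\<^esub>" "\<zero>\<^bsub>ga G\<^esub> \<otimes>\<^bsub>ga G\<^esub> f = \<zero>\<^bsub>ga G\<^esub>"
  using ga_distribr[OF A.zero_closed A.zero_closed assms]
    ga_distribl[OF A.zero_closed A.zero_closed assms] assms
  by (auto simp: ga_mult_closed A.add.r_cancel_one A.add.l_cancel_one)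

lemma ga_add_pow:
  assumes "f \<in> carrier (ga G)"
  shows "[(n::nat)] \<cdot>\<^bsub>ga G\<^esub> f = (\<lambda>x\<in>carrier G. [n] \<cdot> f x)"
  using assms
  by (induction n) (auto simp: ga_zero ga_add A.add.nat_pow_Suc add.nat_pow_Suc intro!: restrict_ext)

lemma ga_smult_add_pow:
  assumes "f \<in> carrier (ga G)"
  shows "([(n::nat)] \<cdot> \<one>) \<odot>\<^bsub>ga G\<^esub> f = [n] \<cdot>\<^bsub>ga G\<^esub> f"
  using assms by (auto simp: ga_add_pow ga_smult add_pow_ldistr ga_mem_closed intro!: restrict_ext)

text \<open>
  Over a prime field a scalar multiple of a group element is a repeated sum. Hence the group
  algebra is generated by the group elements as an additive group, and statements that are stable
  under addition need to be checked for group elements only.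
\<close>

lemma ga_additive_induct [consumes 1, case_names zero add single]:
  assumes f: "f \<in> carrier (ga G)"
    and zero: "P \<zero>\<^bsub>ga G\<^esub>"
    and add: "\<And>f h. f \<in> carrier (ga G) \<Longrightarrow> h \<in> carrier (ga G) \<Longrightarrow> P f \<Longrightarrow> P h \<Longrightarrow> P (f \<oplus>\<^bsub>ga G\<^esub> h)"
    and single: "\<And>x. x \<in> carrier G \<Longrightarrow> P (basis G x)"
  shows "P f"
proof -
  have mult: "P ([(n::nat)] \<cdot>\<^bsub>ga G\<^esub> basis G x)" if "x \<in> carrier G" for x n
    by (induction n) (auto simp: A.add.nat_pow_Suc zero intro!: add single that)
  have "finite S \<Longrightarrow> S \<subseteq> carrier G \<Longrightarrow>
      \<forall>f\<in>carrier (ga G). (\<forall>x\<in>carrier G - S. f x = \<zero>) \<longrightarrow> P f" for S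
  proof (induction S rule: finite_induct)
    case empty
    have "f = \<zero>\<^bsub>ga G\<^esub>" if "f \<in> carrier (ga G)" "\<forall>x\<in>carrier G. f x = \<zero>" for f
      using that by (intro ga_eqI A.zero_closed) (auto simp: ga_zero)
    then show ?case using zero by auto
  next
    case (insert a S)
    show ?case
    proof (intro ballI impI)
      fix f assume f: "f \<in> carrier (ga G)" and f0: "\<forall>x\<in>carrier G - insert a S. f x = \<zero>"
      have a: "a \<in> carrier G" using insert by simp
      obtain n :: nat where n: "f a = [n] \<cdot> \<one>"
        using field_elem_multiple_of_one[OF ga_mem_closed[OF f a]] by blast
      let ?h = "\<lambda>x\<in>carrier G. if x = a then \<zero> else f x"
      have h: "?h \<in> carrier (ga G)" using f by (auto simp: ga_mem PiE_iff)
      have "f = [n] \<cdot>\<^bsub>ga G\<^esub> basis G a \<oplus>\<^bsub>ga G\<^esub> ?h"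
        by (intro ga_eqI A.a_closed A.add.nat_pow_closed f h basis_mem)
          (use f n a in \<open>auto simp: ga_add_apply ga_add_pow basis_apply ga_mem_closed\<close>)
      moreover have "P ?h" using insert.IH h f0 insert.prems insert.hyps by auto
      ultimately show "P f" using mult[OF a] add h by (metis A.add.nat_pow_closed basis_mem)
    qed
  qed
  from this[OF fin subset_refl] f show ?thesis by auto
qed

text \<open>
  Both sides are additive in each of the three factors, and on group elements this is the
  associativity of the group.
\<close>

lemma ga_assoc:
  assumes "f \<in> carrier (ga G)" "g \<in> carrier (ga G)" "h \<in> carrier (ga G)"
  shows "(f \<otimes>\<^bsub>ga G\<^esub> g) \<otimes>\<^bsub>ga G\<^esub> h = f \<otimes>\<^bsub>ga G\<^esub> (g \<otimes>\<^bsub>ga G\<^esub> h)"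
  using assms(1)
proof (induction f rule: ga_additive_induct)
  case zero then show ?case by (simp add: ga_mult_zero ga_mult_closed assms)
next
  case (add f f') then show ?case by (simp add: ga_distribl ga_mult_closed assms)
next
  case (single x)
  note x = single
  show ?case using assms(2)
  proof (induction g rule: ga_additive_induct)
    case zero then show ?case by (simp add: ga_mult_zero ga_mult_closed assms)
  next
    case (add f f') then show ?case by (simp add: ga_distribl ga_distribr ga_mult_closed assms)
  next
    case (single y)
    note y = single
    show ?case using assms(3)
    proof (induction h rule: ga_additive_induct)
      case zero then show ?case by (simp add: ga_mult_zero ga_mult_closed)
    next
      case (add f f') then show ?case by (simp add: ga_distribr ga_mult_closed)
    next
      case (single z)
      then show ?case using x y by (simp add: basis_mult G.m_assoc)
    qed
  qed
qed

lemma ga_one_mult: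
  assumes "f \<in> carrier (ga G)"
  shows "basis G \<one>\<^bsub>G\<^esub> \<otimes>\<^bsub>ga G\<^esub> f = f \<and> f \<otimes>\<^bsub>ga G\<^esub> basis G \<one>\<^bsub>G\<^esub> = f"
  using assms
  by (induction f rule: ga_additive_induct)
     (auto simp: ga_mult_zero ga_distribl ga_distribr basis_mult)

lemma ga_ring: "ring (ga G)"
  by (rule ringI[OF ga_abelian_group])
     (auto intro!: monoidI simp: ga_mult_closed ga_assoc ga_one_mult ga_distribl ga_distribr ga_one)

end

lemmas ga_induct = ga_additive_induct [consumes 2, case_names zero add single]

lemma ga_cring:
  assumes "comm_group C" "finite (carrier C)"
  shows "cring (ga C)"
proof -
  interpret C: comm_group C by fact
  have G: "finite_group C" using assms(2) by unfold_locales
  interpret A: ring "ga C" by (rule ga_ring[OF G])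
  have "f \<otimes>\<^bsub>ga C\<^esub> h = h \<otimes>\<^bsub>ga C\<^esub> f" if f: "f \<in> carrier (ga C)" and h: "h \<in> carrier (ga C)" for f h
    using G f
  proof (induction f rule: ga_induct)
    case (single x)
    show ?case using G h
      by (induction h rule: ga_induct)
         (use single in \<open>auto simp: h basis_mem[OF G] A.l_distr A.r_distr basis_mult[OF G] C.m_comm\<close>)
  qed (auto simp: h A.l_distr A.r_distr)
  then show ?thesis by unfold_locales
qed

end

section \<open>The Frobenius endomorphism\<close>

lemma (in cring) binomial:
  assumes x: "x \<in> carrier R" and y: "y \<in> carrier R"
  shows "(x \<oplus> y) [^] (n::nat) = (\<Oplus>k\<in>{..n}. [(n choose k)] \<cdot> (x [^] k \<otimes> y [^] (n - k)))"
proof (induction n)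
  case 0
  then show ?case using assms by simp
next
  case (Suc n)
  define t where "t n k = [(n choose k)] \<cdot> (x [^] k \<otimes> y [^] (n - k))" for n k :: nat
  have tc [simp]: "t n k \<in> carrier R" for n k using assms by (simp add: t_def)
  have pascal: "t (Suc n) (Suc i) = x \<otimes> t n i \<oplus> y \<otimes> t n (Suc i)" for i
  proof (cases "i < n")
    case True
    then have "n - i = Suc (n - Suc i)" by simp
    then have "y [^] (n - i) = y \<otimes> y [^] (n - Suc i)"
      using y by (simp add: m_comm)
    then show ?thesis using x y
      by (simp add: t_def add.nat_pow_mult[symmetric] add_pow_rdistr m_ac nat_pow_closed)
  next
    case False
    then have "t n (Suc i) = \<zero>" by (simp add: t_def binomial_eq_0)
    moreover have "t (Suc n) (Suc i) = x \<otimes> t n i"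
    proof (cases "i = n")
      case True
      then show ?thesis using x by (simp add: t_def m_comm)
    next
      case ne: False
      then have "n choose i = 0" "Suc n choose Suc i = 0" using False by (auto simp: binomial_eq_0)
      then show ?thesis using x by (simp only: t_def add.nat_pow_0 r_null)
    qed
    ultimately show ?thesis using x y by simp
  qed
  have "t n (Suc n) = \<zero>" by (simp add: t_def binomial_eq_0)
  then have S: "(\<Oplus>k\<in>{..n}. t n k) = (\<Oplus>k\<in>{..Suc n}. t n k)" by simp
  have "(x \<oplus> y) [^] Suc n = (x \<oplus> y) \<otimes> (\<Oplus>k\<in>{..n}. t n k)"
    using Suc assms by (simp add: t_def m_comm)
  also have "\<dots> = x \<otimes> (\<Oplus>k\<in>{..n}. t n k) \<oplus> y \<otimes> (\<Oplus>k\<in>{..Suc n}. t n k)"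
    using S assms by (simp add: l_distr del: finsum_Suc)
  also have "\<dots> = (\<Oplus>k\<in>{..n}. x \<otimes> t n k) \<oplus> ((\<Oplus>k\<in>{..n}. y \<otimes> t n (Suc k)) \<oplus> y \<otimes> t n 0)"
    using assms by (simp add: finsum_rdistr finsum_Suc2 r_distr Pi_def del: finsum_Suc)
  also have "\<dots> = (\<Oplus>k\<in>{..n}. t (Suc n) (Suc k)) \<oplus> t (Suc n) 0"
  proof -
    have "y \<otimes> t n 0 = t (Suc n) 0" using assms by (simp add: t_def m_comm)
    then show ?thesis using assms by (simp add: pascal finsum_addf a_assoc Pi_def)
  qed
  also have "\<dots> = (\<Oplus>k\<in>{..Suc n}. t (Suc n) k)"
    by (simp add: finsum_Suc2 Pi_def del: finsum_Suc)
  finally show ?case unfolding t_def .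
qed

text \<open>
  In characteristic \<open>p\<close> all mixed terms of the binomial expansion with exponent \<open>p\<close> vanish;
  iteration gives the powers of \<open>p\<close>.
\<close>

lemma (in cring) frobenius_add:
  fixes p :: nat
  assumes p: "Factorial_Ring.prime p" and char: "\<And>r. r \<in> carrier R \<Longrightarrow> [p] \<cdot> r = \<zero>"
    and x: "x \<in> carrier R" and y: "y \<in> carrier R"
  shows "(x \<oplus> y) [^] (p ^ m) = x [^] (p ^ m) \<oplus> y [^] (p ^ m)"
proof (induction m)
  case 0
  then show ?case using assms by simp
next
  case (Suc m)
  have prime_step: "(x \<oplus> y) [^] p = x [^] p \<oplus> y [^] p"
    if x: "x \<in> carrier R" and y: "y \<in> carrier R" for x y
  proof -
    let ?t = "\<lambda>k. [(p choose k)] \<cdot> (x [^] k \<otimes> y [^] (p - k))"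
    have p0: "p > 0" using p prime_gt_0_nat by blast
    have "?t k = \<zero>" if k: "k \<noteq> 0" "k \<noteq> p" "k \<le> p" for k
    proof -
      have "p dvd p choose k" using k p by (intro dvd_choose_prime) auto
      then obtain j where "p choose k = p * j" by blast
      then show ?thesis
        using x y char by (simp add: add.nat_pow_pow[symmetric])
    qed
    then have "(\<Oplus>k\<in>{..p}. ?t k) = (\<Oplus>k\<in>{0, p}. ?t k)"
      using x y by (intro add.finprod_mono_neutral_cong_right) auto
    also have "\<dots> = x [^] p \<oplus> y [^] p" using x y p0 by (simp add: a_comm)
    finally show ?thesis using binomial[OF x y] by simp
  qed
  show ?case using Suc x y by (simp add: prime_step power_Suc2 nat_pow_pow[symmetric] del: power_Suc)
qed

context prime_field
begin

section \<open>Additive maps on group algebras\<close>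

abbreviation additive where
  "additive G B \<phi> \<equiv> \<phi> \<in> hom (add_monoid (ga G)) (add_monoid B)"

lemma additive_add:
  assumes "additive G B \<phi>" "f \<in> carrier (ga G)" "h \<in> carrier (ga G)"
  shows "\<phi> (f \<oplus>\<^bsub>ga G\<^esub> h) = \<phi> f \<oplus>\<^bsub>B\<^esub> \<phi> h"
  using assms by (simp add: hom_def)

lemma additive_closed:
  assumes "additive G B \<phi>" "f \<in> carrier (ga G)"
  shows "\<phi> f \<in> carrier B"
  using assms by (auto simp: hom_def)

lemma additive_zero:
  assumes G: "finite_group G" and B: "abelian_group B" and \<phi>: "additive G B \<phi>"
  shows "\<phi> \<zero>\<^bsub>ga G\<^esub> = \<zero>\<^bsub>B\<^esub>"
  using hom_one[OF \<phi>] abelian_group.a_group[OF ga_abelian_group[OF G]] abelian_group.a_group[OF B]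
  by simp

lemma additiveI:
  assumes "\<And>f. f \<in> carrier (ga G) \<Longrightarrow> \<phi> f \<in> carrier B"
    "\<And>f h. f \<in> carrier (ga G) \<Longrightarrow> h \<in> carrier (ga G) \<Longrightarrow> \<phi> (f \<oplus>\<^bsub>ga G\<^esub> h) = \<phi> f \<oplus>\<^bsub>B\<^esub> \<phi> h"
  shows "additive G B \<phi>"
  using assms by (simp add: hom_def)

text \<open>
  The principle by which almost all identities between maps on group algebras are established.
\<close>

lemma additive_eqI:
  assumes G: "finite_group G" and B: "abelian_group B"
    and \<phi>: "additive G B \<phi>" and \<psi>: "additive G B \<psi>"
    and eq: "\<And>x. x \<in> carrier G \<Longrightarrow> \<phi> (basis G x) = \<psi> (basis G x)"
    and f: "f \<in> carrier (ga G)"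
  shows "\<phi> f = \<psi> f"
  using G f
  by (induction f rule: ga_induct)
    (auto simp: eq additive_add[OF \<phi>] additive_add[OF \<psi>] additive_zero[OF G B \<phi>] additive_zero[OF G B \<psi>])

lemma ring_hom_additive: "\<phi> \<in> ring_hom (ga G) B \<Longrightarrow> additive G B \<phi>"
  by (auto simp: ring_hom_def hom_def)

lemma additive_comp:
  assumes "additive G (ga H) \<phi>" "additive H B \<psi>"
  shows "additive G B (\<lambda>f. \<psi> (\<phi> f))"
  using assms by (auto simp: hom_def Pi_iff)

lemma ring_hom_comp:
  assumes "\<phi> \<in> ring_hom A B" "\<psi> \<in> ring_hom B C"
  shows "(\<lambda>f. \<psi> (\<phi> f)) \<in> ring_hom A C"
  using ring_hom_trans[OF assms] by (simp add: comp_def)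

text \<open>
  Both sides of the multiplicativity are biadditive, so an additive map that is multiplicative on
  group elements is a ring homomorphism.
\<close>

lemma ring_hom_multI:
  assumes G: "finite_group G" and B: "ring B" and \<phi>: "additive G B \<phi>"
    and one: "\<phi> (basis G \<one>\<^bsub>G\<^esub>) = \<one>\<^bsub>B\<^esub>"
    and mult: "\<And>x y. x \<in> carrier G \<Longrightarrow> y \<in> carrier G \<Longrightarrow>
      \<phi> (basis G (x \<otimes>\<^bsub>G\<^esub> y)) = \<phi> (basis G x) \<otimes>\<^bsub>B\<^esub> \<phi> (basis G y)"
  shows "\<phi> \<in> ring_hom (ga G) B"
proof -
  interpret B: ring B by fact
  interpret A: ring "ga G" by (rule ga_ring[OF G])
  have z: "\<phi> \<zero>\<^bsub>ga G\<^esub> = \<zero>\<^bsub>B\<^esub>" by (rule additive_zero[OF G B.abelian_group_axioms \<phi>])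
  note [simp] = additive_closed[OF \<phi>] additive_add[OF \<phi>] basis_mem[OF G] basis_mult[OF G] z
  have "\<phi> (f \<otimes>\<^bsub>ga G\<^esub> h) = \<phi> f \<otimes>\<^bsub>B\<^esub> \<phi> h" if f: "f \<in> carrier (ga G)" and h: "h \<in> carrier (ga G)" for f h
    using G f
  proof (induction f rule: ga_induct)
    case (single x)
    show ?case using G h
      by (induction h rule: ga_induct) (use single in \<open>auto simp: A.r_distr B.r_distr mult\<close>)
  qed (auto simp: h A.l_distr B.l_distr)
  then show ?thesis using one by (intro ring_hom_memI) (auto simp: ga_one[OF G])
qed

lemma lin_additive:
  assumes G: "finite_group G" and F: "F \<in> carrier G \<rightarrow> carrier K"
  shows "additive G K (lin G F)"
proof (rule additiveI)
  fix f assume f: "f \<in> carrier (ga G)"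
  show "lin G F f \<in> carrier K"
    unfolding lin_def using F f by (auto intro!: finsum_closed simp: ga_mem_closed[OF G])
  fix h assume h: "h \<in> carrier (ga G)"
  have "lin G F (f \<oplus>\<^bsub>ga G\<^esub> h) = (\<Oplus>x\<in>carrier G. f x \<otimes> F x \<oplus> h x \<otimes> F x)"
    unfolding lin_def using F f h
    by (intro add.finprod_cong') (auto simp: ga_add_apply[OF G] ga_mem_closed[OF G] l_distr Pi_iff)
  then show "lin G F (f \<oplus>\<^bsub>ga G\<^esub> h) = lin G F f \<oplus> lin G F h"
    unfolding lin_def using F f h by (simp add: finsum_addf ga_mem_closed[OF G] Pi_iff)
qed

lemma lin_basis:
  assumes G: "finite_group G" and F: "F \<in> carrier G \<rightarrow> carrier K" and x: "x \<in> carrier G"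
  shows "lin G F (basis G x) = F x"
proof -
  have "lin G F (basis G x) = (\<Oplus>y\<in>carrier G. if y = x then F y else \<zero>)"
    unfolding lin_def using F by (intro add.finprod_cong') (auto simp: basis_apply[OF G] Pi_iff)
  then show ?thesis using finsum_delta[OF G x F] by simp
qed

lemma ext_additive:
  assumes G: "finite_group G" and H: "finite_group H" and u: "u \<in> carrier G \<rightarrow> carrier (ga H)"
  shows "additive G (ga H) (ext G H u)"
proof -
  have F: "(\<lambda>x. u x y) \<in> carrier G \<rightarrow> carrier K" if "y \<in> carrier H" for y
    using u that by (auto simp: ga_mem_closed[OF H] Pi_iff)
  note A = lin_additive[OF G F]
  show ?thesis
  proof (rule additiveI)
    fix f assume f: "f \<in> carrier (ga G)"
    show c: "ext G H u f \<in> carrier (ga H)"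
      using additive_closed[OF A f] by (auto simp: ga_mem[OF H] ext_def)
    fix h assume h: "h \<in> carrier (ga G)"
    show "ext G H u (f \<oplus>\<^bsub>ga G\<^esub> h) = ext G H u f \<oplus>\<^bsub>ga H\<^esub> ext G H u h"
      by (auto simp: ext_def ga_add[OF H] additive_add[OF A f h])
  qed
qed

lemma ext_basis:
  assumes G: "finite_group G" and H: "finite_group H" and u: "u \<in> carrier G \<rightarrow> carrier (ga H)"
    and x: "x \<in> carrier G"
  shows "ext G H u (basis G x) = u x"
proof -
  have F: "(\<lambda>x. u x y) \<in> carrier G \<rightarrow> carrier K" if "y \<in> carrier H" for y
    using u that by (auto simp: ga_mem_closed[OF H] Pi_iff)
  show ?thesis
    by (rule ga_eqI[OF H additive_closed[OF ext_additive[OF G H u] basis_mem[OF G]]])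
      (use u x F in \<open>auto simp: ext_def lin_basis[OF G]\<close>)
qed

lemma ext_ring_hom:
  assumes G: "finite_group G" and H: "finite_group H" and u: "u \<in> carrier G \<rightarrow> carrier (ga H)"
    and one: "u \<one>\<^bsub>G\<^esub> = \<one>\<^bsub>ga H\<^esub>"
    and mult: "\<And>x y. x \<in> carrier G \<Longrightarrow> y \<in> carrier G \<Longrightarrow> u (x \<otimes>\<^bsub>G\<^esub> y) = u x \<otimes>\<^bsub>ga H\<^esub> u y"
  shows "ext G H u \<in> ring_hom (ga G) (ga H)"
proof -
  interpret G: finite_group G by fact
  show ?thesis
    by (rule ring_hom_multI[OF G ga_ring[OF H] ext_additive[OF G H u]])
       (auto simp: ext_basis[OF G H u] one mult)
qed

text \<open>
  The map of group algebras that is induced by a map of groups.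
\<close>

abbreviation push where "push G H \<chi> \<equiv> ext G H (\<lambda>x. basis H (\<chi> x))"

lemma push_additive:
  assumes "finite_group G" "finite_group H" 
  shows "additive G (ga H) (push G H \<chi>)"
  using assms by (intro ext_additive) (auto simp: basis_mem)

lemma push_basis:
  assumes "finite_group G" "finite_group H" "x \<in> carrier G"
  shows "push G H \<chi> (basis G x) = basis H (\<chi> x)"
  using assms by (intro ext_basis) (auto simp: basis_mem)

lemma push_ring_hom:
  assumes G: "finite_group G" and H: "finite_group H" and \<chi>: "\<chi> \<in> hom G H"
  shows "push G H \<chi> \<in> ring_hom (ga G) (ga H)"
proof -
  interpret G: finite_group G by fact
  interpret H: finite_group H by fact
  have "\<chi> \<one>\<^bsub>G\<^esub> = \<one>\<^bsub>H\<^esub>" using hom_one[OF \<chi>] G.is_group H.is_group by simp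
  then show ?thesis
    by (intro ext_ring_hom[OF G H])
      (use \<chi> in \<open>auto simp: basis_mem[OF H] ga_one[OF H] basis_mult[OF H] hom_mult hom_in_carrier\<close>)
qed

text \<open>
  Change of variables along \<open>\<chi>\<close>.
\<close>

lemma lin_push:
  assumes G: "finite_group G" and H: "finite_group H" and \<chi>: "\<chi> \<in> carrier G \<rightarrow> carrier H"
    and F: "F \<in> carrier H \<rightarrow> carrier K" and f: "f \<in> carrier (ga G)"
  shows "lin H F (push G H \<chi> f) = lin G (\<lambda>x. F (\<chi> x)) f"
proof -
  have F': "(\<lambda>x. F (\<chi> x)) \<in> carrier G \<rightarrow> carrier K" using F \<chi> by auto
  show ?thesis
    by (rule additive_eqI[OF G abelian_group_axioms
          additive_comp[OF push_additive[OF G H] lin_additive[OF H F]] lin_additive[OF G F'] _ f])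
       (use \<chi> in \<open>auto simp: push_basis[OF G H] lin_basis[OF H F] lin_basis[OF G F'] Pi_iff\<close>)
qed

lemma ga_char_p:
  assumes "finite_group G" "f \<in> carrier (ga G)"
  shows "[p] \<cdot>\<^bsub>ga G\<^esub> f = \<zero>\<^bsub>ga G\<^esub>"
  using assms by (auto simp: ga_add_pow ga_zero char_p ga_mem_closed intro!: restrict_ext)

text \<open>
  Multiplication by a scalar is repeated addition, so additivity already implies linearity.
\<close>

lemma ga_additive_smult:
  assumes G: "finite_group G" and H: "finite_group H" and \<phi>: "additive G (ga H) \<phi>"
    and c: "c \<in> carrier K" and f: "f \<in> carrier (ga G)"
  shows "\<phi> (c \<odot>\<^bsub>ga G\<^esub> f) = c \<odot>\<^bsub>ga H\<^esub> \<phi> f"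
proof -
  obtain n :: nat where n: "c = [n] \<cdot> \<one>" using field_elem_multiple_of_one[OF c] by blast
  interpret A: ring "ga G" by (rule ga_ring[OF G])
  interpret B: ring "ga H" by (rule ga_ring[OF H])
  have "\<phi> ([m] \<cdot>\<^bsub>ga G\<^esub> f) = [m] \<cdot>\<^bsub>ga H\<^esub> \<phi> f" for m :: nat
    by (induction m) (use f in \<open>auto simp: A.add.nat_pow_Suc B.add.nat_pow_Suc
      additive_zero[OF G B.abelian_group_axioms \<phi>] additive_add[OF \<phi>]\<close>)
  then show ?thesis
    using f additive_closed[OF \<phi> f] by (simp add: n ga_smult_add_pow[OF G] ga_smult_add_pow[OF H])
qed

lemma algebra_isomorphic_iff_ring_iso:
  assumes G: "finite_group G" and H: "finite_group H"
  shows "algebra_isomorphic K (ga G) (ga H) \<longleftrightarrow> ring_iso (ga G) (ga H) \<noteq> {}"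
proof -
  have "algebra_iso K (ga G) (ga H) = ring_iso (ga G) (ga H)"
    using ga_additive_smult[OF G H ring_hom_additive]
    by (auto simp: algebra_iso_def ring_iso_def)
  then show ?thesis by (simp add: algebra_isomorphic_def)
qed

text \<open>
  For an abelian group both sides are additive in \<open>f\<close>, the left one by the Frobenius identity, and
  they agree on group elements.
\<close>

lemma ga_frobenius:
  assumes C: "comm_group C" "finite (carrier C)" and f: "f \<in> carrier (ga C)"
  shows "f [^]\<^bsub>ga C\<^esub> (p ^ m) = push C C (\<lambda>x. x [^]\<^bsub>C\<^esub> (p ^ m)) f"
proof -
  interpret C: comm_group C by (rule C)
  have G: "finite_group C" using C(2) by unfold_locales
  interpret A: cring "ga C" by (rule ga_cring[OF C])
  note [simp] = basis_mem[OF G] basis_mult[OF G]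
  have "additive C (ga C) (\<lambda>f. f [^]\<^bsub>ga C\<^esub> (p ^ m))"
    by (rule additiveI) (auto simp: A.frobenius_add[OF prime] ga_char_p[OF G])
  moreover have "basis C x [^]\<^bsub>ga C\<^esub> n = basis C (x [^]\<^bsub>C\<^esub> n)" if "x \<in> carrier C" for x and n :: nat
    using that by (induction n) (auto simp: ga_one[OF G])
  ultimately show ?thesis
    by (intro additive_eqI[OF G A.abelian_group_axioms _ push_additive[OF G G] _ f])
       (auto simp: push_basis[OF G G])
qed

lemma mult_single_apply:
  assumes G: "finite_group G" and f: "f \<in> carrier (ga G)" and x: "x \<in> carrier G" and z: "z \<in> carrier G"
  shows "(f \<otimes>\<^bsub>ga G\<^esub> basis G x) z = f (z \<otimes>\<^bsub>G\<^esub> inv\<^bsub>G\<^esub> x)"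
    and "(basis G x \<otimes>\<^bsub>ga G\<^esub> f) z = f (inv\<^bsub>G\<^esub> x \<otimes>\<^bsub>G\<^esub> z)"
proof -
  interpret G: finite_group G by fact
  have "(\<Oplus>y\<in>carrier G. f y \<otimes> basis G x (inv\<^bsub>G\<^esub> y \<otimes>\<^bsub>G\<^esub> z)) =
      (\<Oplus>y\<in>carrier G. if y = z \<otimes>\<^bsub>G\<^esub> inv\<^bsub>G\<^esub> x then f y else \<zero>)"
  proof (rule add.finprod_cong')
    fix y assume y: "y \<in> carrier G"
    have "inv\<^bsub>G\<^esub> y \<otimes>\<^bsub>G\<^esub> z = x \<longleftrightarrow> y = z \<otimes>\<^bsub>G\<^esub> inv\<^bsub>G\<^esub> x"
      using x y z G.inv_solve_left' G.inv_solve_right by metis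
    then show "f y \<otimes> basis G x (inv\<^bsub>G\<^esub> y \<otimes>\<^bsub>G\<^esub> z) = (if y = z \<otimes>\<^bsub>G\<^esub> inv\<^bsub>G\<^esub> x then f y else \<zero>)"
      using f y z ga_mem_closed[OF G f] by (auto simp: basis_apply[OF G])
  qed (use ga_mem_closed[OF G f] in auto)
  then show "(f \<otimes>\<^bsub>ga G\<^esub> basis G x) z = f (z \<otimes>\<^bsub>G\<^esub> inv\<^bsub>G\<^esub> x)"
    using f x z ga_mem_closed[OF G f]
    by (simp add: ga_mult_apply[OF G] basis_mem[OF G] finsum_delta[OF G] Pi_iff)
  have "(\<Oplus>y\<in>carrier G. basis G x y \<otimes> f (inv\<^bsub>G\<^esub> y \<otimes>\<^bsub>G\<^esub> z)) =
      (\<Oplus>y\<in>carrier G. if y = x then f (inv\<^bsub>G\<^esub> y \<otimes>\<^bsub>G\<^esub> z) else \<zero>)"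
    using z ga_mem_closed[OF G f] by (intro add.finprod_cong') (auto simp: basis_apply[OF G])
  then show "(basis G x \<otimes>\<^bsub>ga G\<^esub> f) z = f (inv\<^bsub>G\<^esub> x \<otimes>\<^bsub>G\<^esub> z)"
    using f x z ga_mem_closed[OF G f]
    by (simp add: ga_mult_apply[OF G] basis_mem[OF G] finsum_delta[OF G] Pi_iff)
qed

end

section \<open>Actions of p-groups and the centre of the group algebra\<close>

lemma finite_p_groupD:
  assumes "finite_p_group p G"
  shows "finite_group G" "\<exists>n. order G = p ^ n"
  using assms by (auto simp: finite_p_group_def finite_group_def finite_group_axioms_def)

lemma finite_group_subgroup:
  assumes "finite_group G" "subgroup H G"
  shows "finite_group (G \<restriction> H)"
proof -
  interpret G: finite_group G by fact
  have "finite H" using subgroup.subset[OF assms(2)] G.finite_carrier by (rule finite_subset)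
  then show ?thesis
    using G.subgroup_imp_group[OF assms(2)] by (simp add: finite_group_def finite_group_axioms_def)
qed

text \<open>
  An action in the sense of \<^locale>\<open>group_action\<close> takes values in the extensional bijections
  of \<open>E\<close>, which accounts for the restriction.
\<close>

lemma group_actionI:
  assumes G: "group G"
    and closed: "\<And>g x. g \<in> carrier G \<Longrightarrow> x \<in> E \<Longrightarrow> act g x \<in> E"
    and one: "\<And>x. x \<in> E \<Longrightarrow> act \<one>\<^bsub>G\<^esub> x = x"
    and mult: "\<And>g h x. g \<in> carrier G \<Longrightarrow> h \<in> carrier G \<Longrightarrow> x \<in> E \<Longrightarrow>
      act (g \<otimes>\<^bsub>G\<^esub> h) x = act g (act h x)"
  shows "group_action G E (\<lambda>g. \<lambda>x\<in>E. act g x)"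
proof -
  interpret G: group G by fact
  have bij: "(\<lambda>x\<in>E. act g x) \<in> Bij E" if g: "g \<in> carrier G" for g
  proof -
    have "bij_betw (\<lambda>x\<in>E. act g x) E E"
      by (rule bij_betwI[of _ _ _ "\<lambda>x. act (inv\<^bsub>G\<^esub> g) x"])
        (use g in \<open>auto simp: closed mult[symmetric] one\<close>)
    then show ?thesis by (simp add: Bij_def)
  qed
  have "(\<lambda>g. \<lambda>x\<in>E. act g x) \<in> hom G (BijGroup E)"
    using bij by (auto simp: hom_def BijGroup_def compose_def closed mult intro!: restrict_ext)
  then show ?thesis
    unfolding group_action_def group_hom_def group_hom_axioms_def
    using group_BijGroup G by blast
qed

definition center :: "('g, 'n) monoid_scheme \<Rightarrow> 'g set" where
  "center G = {z \<in> carrier G. \<forall>g\<in>carrier G. z \<otimes>\<^bsub>G\<^esub> g = g \<otimes>\<^bsub>G\<^esub> z}"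

lemma centerI:
  "z \<in> carrier G \<Longrightarrow> (\<And>g. g \<in> carrier G \<Longrightarrow> z \<otimes>\<^bsub>G\<^esub> g = g \<otimes>\<^bsub>G\<^esub> z) \<Longrightarrow> z \<in> center G"
  unfolding center_def by blast

lemma center_closed: "z \<in> center G \<Longrightarrow> z \<in> carrier G"
  unfolding center_def by blast

lemma center_commutes: "z \<in> center G \<Longrightarrow> g \<in> carrier G \<Longrightarrow> z \<otimes>\<^bsub>G\<^esub> g = g \<otimes>\<^bsub>G\<^esub> z"
  unfolding center_def by blast

lemma (in group) center_subgroup: "subgroup (center G) G"
proof (rule subgroupI)
  fix a assume a: "a \<in> center G"
  have "inv a \<otimes> g = g \<otimes> inv a" if "g \<in> carrier G" for g
  proof -
    have c: "a \<in> carrier G" "a \<otimes> g = g \<otimes> a" using a that center_closed center_commutes by metis+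
    have "a \<otimes> (g \<otimes> inv a) = g \<otimes> a \<otimes> inv a" using c that by (simp add: m_assoc[symmetric])
    then have "a \<otimes> (g \<otimes> inv a) = g" using c that by (simp add: m_assoc)
    then show ?thesis using c that inv_solve_left[of "g \<otimes> inv a" a g] by simp
  qed
  then show "inv a \<in> center G" using a by (blast intro: centerI center_closed)
  fix b assume b: "b \<in> center G"
  have "(a \<otimes> b) \<otimes> g = g \<otimes> (a \<otimes> b)" if g: "g \<in> carrier G" for g
  proof -
    have c: "a \<in> carrier G" "b \<in> carrier G" "a \<otimes> g = g \<otimes> a" "b \<otimes> g = g \<otimes> b"
      using a b g center_closed center_commutes by metis+
    have "(a \<otimes> b) \<otimes> g = a \<otimes> (g \<otimes> b)" using c g by (simp add: m_assoc)
    also have "\<dots> = (g \<otimes> a) \<otimes> b" using c g by (simp add: m_assoc[symmetric])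
    finally show ?thesis using c g by (simp add: m_assoc)
  qed
  then show "a \<otimes> b \<in> center G" using a b by (blast intro: centerI center_closed)
next
  have "\<one> \<in> center G" by (rule centerI) auto
  then show "center G \<noteq> {}" by blast
qed (auto dest: center_closed)

lemma (in group) center_comm_group: "comm_group (G \<restriction> center G)"
  by (rule group.group_comm_groupI[OF subgroup_imp_group[OF center_subgroup]])
    (auto intro: center_commutes center_closed)

context prime_field
begin

text \<open>
  An orbit of a \<open>p\<close>-group that is not a fixed point has a number of elements divisible by \<open>p\<close>. An
  invariant function is constant on it, so its values there sum to 0 in characteristic \<open>p\<close>.
\<close>

lemma invariant_finsum:
  assumes act: "group_action G E \<phi>" and ord: "order G = p ^ n" and E: "finite E"
    and F: "F \<in> E \<rightarrow> carrier K"
    and inv: "\<And>g x. g \<in> carrier G \<Longrightarrow> x \<in> E \<Longrightarrow> F (\<phi> g x) = F x"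
  shows "(\<Oplus>x\<in>E. F x) = (\<Oplus>x\<in>{x \<in> E. \<forall>g\<in>carrier G. \<phi> g x = x}. F x)"
proof -
  interpret group_action G E \<phi> by fact
  let ?Fix = "{x \<in> E. \<forall>g\<in>carrier G. \<phi> g x = x}"
  let ?O = "orbit G \<phi> ` (E - ?Fix)"
  have G: "group G" using group_hom by (simp add: group_hom_def)
  have sub: "orbit G \<phi> x \<subseteq> E" if "x \<in> E" for x
    using that element_image by (auto simp: orbit_def)
  have self: "x \<in> orbit G \<phi> x" if "x \<in> E" for x
    using orbit_refl[OF that] .
  have orb: "orbit G \<phi> x \<inter> ?Fix = {}" if x: "x \<in> E - ?Fix" for x
  proof (rule ccontr)
    assume "orbit G \<phi> x \<inter> ?Fix \<noteq> {}"
    then obtain y where y: "y \<in> orbit G \<phi> x" "y \<in> ?Fix" by blast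
    then have "x \<in> orbit G \<phi> y" using orbit_sym x by auto
    then have "x = y" using y by (auto simp: orbit_def)
    then show False using y x by blast
  qed
  have U: "\<Union> ?O = E - ?Fix" using sub self orb by blast
  have zero: "(\<Oplus>y\<in>b. F y) = \<zero>" if bO: "b \<in> ?O" for b
  proof -
    obtain x where x: "x \<in> E - ?Fix" and b_def: "b = orbit G \<phi> x" using bO by blast
    have xE: "x \<in> E" using x by blast
    have fin: "finite b" using finite_subset[OF sub[OF xE] E] b_def by simp
    have Fx: "F x \<in> carrier K" using F x by blast
    have "(\<Oplus>y\<in>b. F y) = (\<Oplus>y\<in>b. F x)"
      using Fx x by (intro add.finprod_cong') (auto simp: b_def orbit_def inv)
    also have "\<dots> = [card b] \<cdot> F x" using finsum_const[OF Fx fin] .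
    also have "\<dots> = \<zero>"
    proof (rule char_p[OF Fx])
      have "card b dvd p ^ n"
        unfolding b_def using orbit_stabilizer_theorem[OF xE] ord dvd_triv_left by metis
      then obtain j where j: "card b = p ^ j" using prime divides_primepow_nat by blast
      have "card b \<noteq> 1"
      proof
        assume "card b = 1"
        then have "b = {x}" using self[OF xE] b_def by (metis card_1_singletonE singletonD)
        then have "\<phi> g x = x" if "g \<in> carrier G" for g using that b_def by (auto simp: orbit_def)
        then show False using x by blast
      qed
      then show "p dvd card b" using j by (cases j) auto
    qed
    finally show ?thesis .
  qed
  have "(\<Oplus>x\<in>E - ?Fix. F x) = (\<Oplus>x\<in>\<Union> ?O. F x)" using U by simp
  also have "\<dots> = (\<Oplus>b\<in>?O. (\<Oplus>y\<in>b. F y))"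
  proof (rule add.finprod_Union_disjoint)
    show "pairwise disjnt ?O"
    proof (rule pairwiseI)
      fix a b assume "a \<in> ?O" "b \<in> ?O" "a \<noteq> b"
      moreover have "?O \<subseteq> orbits G E \<phi>" by (auto simp: orbits_def)
      ultimately show "disjnt a b" using disjoint_union unfolding disjnt_def by blast
    qed
  next
    have "finite (orbit G \<phi> x)" if "x \<in> E" for x by (rule finite_subset[OF sub[OF that] E])
    then show "finite b \<and> (\<forall>x\<in>b. F x \<in> carrier K)" if "b \<in> ?O" for b
      using that sub F by blast
    show "finite ?O" using E by blast
  qed
  also have "\<dots> = \<zero>" using zero by (simp add: add.finprod_one_eqI)
  finally have 0: "(\<Oplus>x\<in>E - ?Fix. F x) = \<zero>" .
  have "(\<Oplus>x\<in>E. F x) = (\<Oplus>x\<in>(E - ?Fix) \<union> ?Fix. F x)"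
    by (rule arg_cong[where f = "finsum K F"]) blast
  also have "\<dots> = (\<Oplus>x\<in>E - ?Fix. F x) \<oplus> (\<Oplus>x\<in>?Fix. F x)"
    using E F by (intro add.finprod_Un_disjoint) auto
  also have "\<dots> = (\<Oplus>x\<in>?Fix. F x)" using 0 F by (simp add: finsum_closed Pi_iff)
  finally show ?thesis .
qed

text \<open>
  The sum of the constant function 1 shows that the number of fixed points is divisible by \<open>p\<close>
  if the number of all points is. So there cannot be exactly one.
\<close>

lemma second_fixed_point:
  assumes act: "group_action G E \<phi>" and ord: "order G = p ^ n" and E: "finite E"
    and pE: "p dvd card E" and x: "x \<in> E" "\<And>g. g \<in> carrier G \<Longrightarrow> \<phi> g x = x"
  shows "\<exists>y\<in>E. y \<noteq> x \<and> (\<forall>g\<in>carrier G. \<phi> g y = y)"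
proof (rule ccontr)
  assume "\<not> ?thesis"
  then have Fix: "{x \<in> E. \<forall>g\<in>carrier G. \<phi> g x = x} = {x}" using x by blast
  have "(\<Oplus>x\<in>E. \<one>) = (\<Oplus>x\<in>{x}. \<one>)"
    unfolding Fix[symmetric] by (rule invariant_finsum[OF act ord E]) auto
  moreover have "(\<Oplus>x\<in>E. \<one>) = \<zero>" using finsum_const[OF one_closed E] char_p[OF one_closed pE] by simp
  ultimately show False by simp
qed

text \<open>
  The fixed points of the conjugation action are the central elements.
\<close>

lemma class_function_sum:
  assumes G: "finite_p_group p G" and F: "F \<in> carrier G \<rightarrow> carrier K"
    and inv: "\<And>g x. g \<in> carrier G \<Longrightarrow> x \<in> carrier G \<Longrightarrow> F (g \<otimes>\<^bsub>G\<^esub> x \<otimes>\<^bsub>G\<^esub> inv\<^bsub>G\<^esub> g) = F x"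
  shows "(\<Oplus>x\<in>carrier G. F x) = (\<Oplus>x\<in>center G. F x)"
proof -
  interpret G: finite_group G by (rule finite_p_groupD[OF G])
  obtain n where n: "order G = p ^ n" using finite_p_groupD[OF G] by blast
  have "{x \<in> carrier G. \<forall>g\<in>carrier G. (\<lambda>h\<in>carrier G. g \<otimes>\<^bsub>G\<^esub> h \<otimes>\<^bsub>G\<^esub> inv\<^bsub>G\<^esub> g) x = x} = center G"
    by (auto simp: center_def) (metis G.inv_solve_right G.m_closed)+
  then show ?thesis
    using invariant_finsum[OF G.action_by_conjugation n G.finite_carrier F] inv by simp
qed

abbreviation ctr where "ctr G \<equiv> G \<restriction> center G"

text \<open>
  Membership in the centre of the group algebra; commuting with the group elements suffices, as
  they generate it additively.
\<close>

definition central :: "('g, 'n) monoid_scheme \<Rightarrow> ('g \<Rightarrow> 'a) \<Rightarrow> bool" where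
  "central G f \<longleftrightarrow> f \<in> carrier (ga G) \<and>
    (\<forall>x\<in>carrier G. basis G x \<otimes>\<^bsub>ga G\<^esub> f = f \<otimes>\<^bsub>ga G\<^esub> basis G x)"

lemma central_conj:
  assumes G: "finite_group G" and f: "central G f" and g: "g \<in> carrier G" and x: "x \<in> carrier G"
  shows "f (g \<otimes>\<^bsub>G\<^esub> x \<otimes>\<^bsub>G\<^esub> inv\<^bsub>G\<^esub> g) = f x"
proof -
  interpret G: finite_group G by fact
  have f': "f \<in> carrier (ga G)" using f by (simp add: central_def)
  have "(f \<otimes>\<^bsub>ga G\<^esub> basis G g) (g \<otimes>\<^bsub>G\<^esub> x) = (basis G g \<otimes>\<^bsub>ga G\<^esub> f) (g \<otimes>\<^bsub>G\<^esub> x)"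
    using f g by (simp add: central_def)
  then show ?thesis using g x f' by (simp add: mult_single_apply[OF G] G.m_assoc[symmetric])
qed

text \<open>
  The coefficient of \<open>fh\<close> at a central element \<open>z\<close> is the sum of \<open>f(y) h(y\<inverse>z)\<close> over all \<open>y\<close>. For
  central \<open>f\<close> and \<open>h\<close> the summand is a class function of \<open>y\<close>, so only central \<open>y\<close> contribute: the
  restriction to \<open>Z(G)\<close> is multiplicative on the centre of \<open>kG\<close>.
\<close>

lemma restrict_center_mult:
  assumes G: "finite_p_group p G" and f: "central G f" and h: "central G h"
  shows "restrict (f \<otimes>\<^bsub>ga G\<^esub> h) (center G) =
    restrict f (center G) \<otimes>\<^bsub>ga (ctr G)\<^esub> restrict h (center G)"
proof -
  have fG: "finite_group G" by (rule finite_p_groupD[OF G])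
  interpret G: finite_group G by (rule fG)
  interpret Z: subgroup "center G" G by (rule G.center_subgroup)
  have sub: "center G \<subseteq> carrier G" by (rule Z.subset)
  have fZ: "finite_group (ctr G)" by (rule finite_group_subgroup[OF fG G.center_subgroup])
  have fc: "f \<in> carrier (ga G)" "h \<in> carrier (ga G)" using f h by (auto simp: central_def)
  have rc: "restrict f (center G) \<in> carrier (ga (ctr G))" "restrict h (center G) \<in> carrier (ga (ctr G))"
    using fc sub by (auto simp: ga_mem[OF fZ] ga_mem_closed[OF fG] subset_iff)
  show ?thesis
  proof (rule ga_eqI[OF fZ])
    show "restrict (f \<otimes>\<^bsub>ga G\<^esub> h) (center G) \<in> carrier (ga (ctr G))"
      using ga_mult_closed[OF fG fc] sub by (auto simp: ga_mem[OF fZ] ga_mem_closed[OF fG] subset_iff)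
    show "restrict f (center G) \<otimes>\<^bsub>ga (ctr G)\<^esub> restrict h (center G) \<in> carrier (ga (ctr G))"
      by (rule ga_mult_closed[OF fZ rc])
    fix z assume "z \<in> carrier (ctr G)"
    then have z: "z \<in> center G" by simp
    then have zG: "z \<in> carrier G" using sub by blast
    let ?F = "\<lambda>y. f y \<otimes> h (inv\<^bsub>G\<^esub> y \<otimes>\<^bsub>G\<^esub> z)"
    have FK: "?F \<in> carrier G \<rightarrow> carrier K" using fc zG by (auto simp: ga_mem_closed[OF fG])
    have F: "?F (g \<otimes>\<^bsub>G\<^esub> x \<otimes>\<^bsub>G\<^esub> inv\<^bsub>G\<^esub> g) = ?F x" if "g \<in> carrier G" "x \<in> carrier G" for g x
    proof -
      have "inv\<^bsub>G\<^esub> (g \<otimes>\<^bsub>G\<^esub> x \<otimes>\<^bsub>G\<^esub> inv\<^bsub>G\<^esub> g) \<otimes>\<^bsub>G\<^esub> z = g \<otimes>\<^bsub>G\<^esub> inv\<^bsub>G\<^esub> x \<otimes>\<^bsub>G\<^esub> (inv\<^bsub>G\<^esub> g \<otimes>\<^bsub>G\<^esub> z)"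
        using that zG by (simp add: G.inv_mult_group G.m_assoc)
      also have "inv\<^bsub>G\<^esub> g \<otimes>\<^bsub>G\<^esub> z = z \<otimes>\<^bsub>G\<^esub> inv\<^bsub>G\<^esub> g" using z that center_commutes by (metis G.inv_closed)
      finally have "inv\<^bsub>G\<^esub> (g \<otimes>\<^bsub>G\<^esub> x \<otimes>\<^bsub>G\<^esub> inv\<^bsub>G\<^esub> g) \<otimes>\<^bsub>G\<^esub> z = g \<otimes>\<^bsub>G\<^esub> (inv\<^bsub>G\<^esub> x \<otimes>\<^bsub>G\<^esub> z) \<otimes>\<^bsub>G\<^esub> inv\<^bsub>G\<^esub> g"
        using that zG by (simp add: G.m_assoc)
      then show ?thesis using that zG by (simp add: central_conj[OF fG f] central_conj[OF fG h])
    qed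
    have "restrict (f \<otimes>\<^bsub>ga G\<^esub> h) (center G) z = (\<Oplus>y\<in>carrier G. ?F y)"
      using z zG by (simp add: ga_mult_apply[OF fG fc])
    also have "\<dots> = (\<Oplus>y\<in>center G. ?F y)" by (rule class_function_sum[OF G FK F])
    also have "\<dots> = (\<Oplus>y\<in>center G. restrict f (center G) y \<otimes>
        restrict h (center G) (inv\<^bsub>ctr G\<^esub> y \<otimes>\<^bsub>ctr G\<^esub> z))"
      using FK sub z by (intro add.finprod_cong')
        (auto simp: G.m_inv_consistent[OF G.center_subgroup] Z.m_inv_closed Z.m_closed)
    also have "\<dots> = (restrict f (center G) \<otimes>\<^bsub>ga (ctr G)\<^esub> restrict h (center G)) z"
      using z by (simp add: ga_mult_apply[OF fZ rc])
    finally show "restrict (f \<otimes>\<^bsub>ga G\<^esub> h) (center G) z =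
      (restrict f (center G) \<otimes>\<^bsub>ga (ctr G)\<^esub> restrict h (center G)) z" .
  qed
qed

lemma restrict_center_pow:
  assumes G: "finite_p_group p G" and u: "central G u"
  shows "restrict (u [^]\<^bsub>ga G\<^esub> (n::nat)) (center G) = restrict u (center G) [^]\<^bsub>ga (ctr G)\<^esub> n"
proof -
  have fG: "finite_group G" by (rule finite_p_groupD[OF G])
  interpret G: finite_group G by (rule fG)
  interpret Z: subgroup "center G" G by (rule G.center_subgroup)
  have fZ: "finite_group (ctr G)" by (rule finite_group_subgroup[OF fG G.center_subgroup])
  interpret A: ring "ga G" by (rule ga_ring[OF fG])
  interpret B: ring "ga (ctr G)" by (rule ga_ring[OF fZ])
  have uc: "u \<in> carrier (ga G)" using u by (simp add: central_def)
  have cen: "central G (u [^]\<^bsub>ga G\<^esub> n)" for n :: nat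
  proof (induction n)
    case 0
    then show ?case using basis_mem[OF fG] by (simp add: central_def)
  next
    case (Suc n)
    have "basis G x \<otimes>\<^bsub>ga G\<^esub> (u [^]\<^bsub>ga G\<^esub> n \<otimes>\<^bsub>ga G\<^esub> u) = u [^]\<^bsub>ga G\<^esub> n \<otimes>\<^bsub>ga G\<^esub> u \<otimes>\<^bsub>ga G\<^esub> basis G x"
      if x: "x \<in> carrier G" for x
      using Suc u x uc basis_mem[OF fG] unfolding central_def
      by (metis A.m_assoc)
    then show ?case using Suc uc by (simp add: central_def)
  qed
  show ?thesis
  proof (induction n)
    case 0
    show ?case using Z.one_closed Z.subset
      by (auto simp: ga_one[OF fG] ga_one[OF fZ] basis_def intro!: restrict_ext)
  next
    case (Suc n)
    then show ?case using restrict_center_mult[OF G cen[of n] u]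
      by (simp only: A.nat_pow_Suc B.nat_pow_Suc)
  qed
qed

text \<open>
  A homomorphism into an abelian group is a class function, so its product with the
  coefficients of a central element is one, too.
\<close>

lemma lin_restrict_center:
  assumes G: "finite_p_group p G" and u: "central G u" and \<delta>: "\<delta> \<in> hom G (add_monoid K)"
  shows "lin G \<delta> u = lin (ctr G) \<delta> (restrict u (center G))"
proof -
  have fG: "finite_group G" by (rule finite_p_groupD[OF G])
  interpret G: finite_group G by (rule fG)
  interpret \<delta>: group_hom G "add_monoid K" \<delta>
    using \<delta> a_group by (simp add: group_hom_def group_hom_axioms_def G.is_group)
  note [simp del] = \<delta>.hom_inv \<delta>.hom_mult
  have uc: "u \<in> carrier (ga G)" using u by (simp add: central_def)
  have \<delta>c: "\<delta> x \<in> carrier K" if "x \<in> carrier G" for x using \<delta>.hom_closed[OF that] by simp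
  have \<delta>i: "\<delta> (g \<otimes>\<^bsub>G\<^esub> x \<otimes>\<^bsub>G\<^esub> inv\<^bsub>G\<^esub> g) = \<delta> x" if "g \<in> carrier G" "x \<in> carrier G" for g x
  proof -
    have hm: "\<delta> (a \<otimes>\<^bsub>G\<^esub> b) = \<delta> a \<oplus> \<delta> b" if "a \<in> carrier G" "b \<in> carrier G" for a b
      using \<delta>.hom_mult[OF that] by simp
    have "\<delta> g \<oplus> \<delta> (inv\<^bsub>G\<^esub> g) = \<zero>"
      using hm[of g "inv\<^bsub>G\<^esub> g"] \<delta>.hom_one that by simp
    moreover have "\<delta> (g \<otimes>\<^bsub>G\<^esub> x \<otimes>\<^bsub>G\<^esub> inv\<^bsub>G\<^esub> g) = \<delta> x \<oplus> (\<delta> g \<oplus> \<delta> (inv\<^bsub>G\<^esub> g))"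
      using that \<delta>c by (simp add: hm a_ac)
    ultimately show ?thesis using that \<delta>c by simp
  qed
  have "lin G \<delta> u = (\<Oplus>x\<in>center G. u x \<otimes> \<delta> x)"
    unfolding lin_def
    by (rule class_function_sum[OF G]) (use uc \<delta>c in \<open>auto simp: ga_mem_closed[OF fG] central_conj[OF fG u] \<delta>i\<close>)
  also have "\<dots> = lin (ctr G) \<delta> (restrict u (center G))"
    unfolding lin_def using uc \<delta>c
    by (intro add.finprod_cong') (auto simp: ga_mem_closed[OF fG] center_def)
  finally show ?thesis .
qed

end

section \<open>Internal direct products and central cyclic factors\<close>

lemma (in group) subgroup_nat_pow:
  assumes "subgroup H G" "y \<in> H"
  shows "y [^] (n::nat) \<in> H"
  using assms by (induction n) (auto simp: subgroup.one_closed subgroup.m_closed)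

text \<open>
  By the identity of Bezout, \<open>y ^ gcd i j\<close> is a quotient of powers of \<open>y ^ i\<close> and \<open>y ^ j\<close>.
\<close>

lemma (in group) subgroup_pow_gcd:
  assumes H: "subgroup H G" and y: "y \<in> carrier G"
    and i: "y [^] (i::nat) \<in> H" and j: "y [^] (j::nat) \<in> H"
  shows "y [^] gcd i j \<in> H"
proof (cases "i = 0")
  case True
  then show ?thesis using j by simp
next
  case False
  obtain a b where ab: "i * a = j * b + gcd i j" using bezout_nat[OF False] by blast
  have "y [^] (j * b) \<otimes> y [^] gcd i j = y [^] (i * a)"
    using y by (simp add: nat_pow_mult ab)
  then have "y [^] gcd i j = inv (y [^] (j * b)) \<otimes> y [^] (i * a)"
    using y by (metis inv_solve_left nat_pow_closed)
  moreover have "y [^] (j * b) \<in> H" "y [^] (i * a) \<in> H"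
    using subgroup_nat_pow[OF H i] subgroup_nat_pow[OF H j] y by (simp_all add: nat_pow_pow)
  ultimately show ?thesis using H by (simp add: subgroup.m_closed subgroup.m_inv_closed)
qed

lemma (in group) ord_eq_prime_power:
  fixes p :: nat
  assumes p: "Factorial_Ring.prime p" and x: "x \<in> carrier G"
    and xq: "x [^] (p ^ Suc m) = \<one>" and xr: "x [^] (p ^ m) \<noteq> \<one>"
  shows "ord x = p ^ Suc m"
proof -
  have "ord x dvd p ^ Suc m" using xq pow_eq_id[OF x] by blast
  then obtain j where j: "j \<le> Suc m" "ord x = p ^ j" using p divides_primepow_nat by blast
  have "\<not> j \<le> m" using xr pow_eq_id[OF x, of "p ^ m"] j(2) le_imp_power_dvd by metis
  then have "j = Suc m" using j(1) by simp
  then show ?thesis using j by simp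
qed

lemma (in group) generate_central:
  assumes "x \<in> center G" "c \<in> generate G {x}"
  shows "c \<in> center G"
  using generate_subgroup_incl[OF _ center_subgroup, of "{x}"] assms by blast

text \<open>
  Two normal subgroups that meet trivially commute elementwise, and conversely commuting factors
  that generate the group are normal.
\<close>

lemma (in group) internal_direct_product_iff:
  "internal_direct_product G A N \<longleftrightarrow>
    subgroup A G \<and> subgroup N G \<and> (\<forall>a\<in>A. \<forall>n\<in>N. a \<otimes> n = n \<otimes> a) \<and> A \<inter> N = {\<one>} \<and>
    (\<forall>g\<in>carrier G. \<exists>a\<in>A. \<exists>n\<in>N. g = a \<otimes> n)" (is "_ \<longleftrightarrow> ?rhs")
proof
  assume "internal_direct_product G A N"
  then have idp: "A \<lhd> G" "N \<lhd> G" "A \<inter> N = {\<one>}" "A <#> N = carrier G"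
    by (auto simp: internal_direct_product_def)
  have "\<exists>a\<in>A. \<exists>n\<in>N. g = a \<otimes> n" if "g \<in> carrier G" for g
    using that unfolding idp(4)[symmetric] set_mult_def by blast
  moreover have "a \<otimes> n = n \<otimes> a" if "a \<in> A" "n \<in> N" for a n
    using normal_imp_commuting[OF idp(1,2)] idp(3) that by blast
  ultimately show ?rhs using idp normal_imp_subgroup by auto
next
  assume R: ?rhs
  then have sub: "subgroup A G" "subgroup N G" by auto
  interpret group_disjoint_sum G A N by (intro group_disjoint_sum.intro is_group sub)
  have prod: "A <#> N = carrier G"
    using R AG.mem_carrier BG.mem_carrier by (auto simp: set_mult_def)
  then have "A \<lhd> G \<and> N \<lhd> G" using R normal_eq_commuting by blast
  then show "internal_direct_product G A N"
    using R prod by (simp add: internal_direct_product_def)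
qed

lemma (in group) subset_set_mult:
  assumes "subgroup A G" "subgroup B G"
  shows "A \<subseteq> A <#> B" "B \<subseteq> A <#> B"
proof -
  interpret A: subgroup A G by fact
  interpret B: subgroup B G by fact
  have "\<exists>b\<in>B. a = a \<otimes> b" if "a \<in> A" for a
    using that by (intro bexI[of _ "\<one>"]) auto
  then show "A \<subseteq> A <#> B" unfolding set_mult_def by blast
  have "\<exists>a\<in>A. b = a \<otimes> b" if "b \<in> B" for b
    using that by (intro bexI[of _ "\<one>"]) auto
  then show "B \<subseteq> A <#> B" unfolding set_mult_def by blast
qed

text \<open>
  A central element \<open>x\<close> splits off if its order \<open>q = p ^ Suc m\<close> survives in an abelian quotient \<open>G/D\<close>
  whose exponent divides \<open>q\<close>. A complement is any subgroup \<open>B \<supseteq> D\<close> that is maximal with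
  \<open>x ^ (p ^ m) \<notin> B\<close>. It meets \<open>\<langle>x\<rangle>\<close> trivially, because every non-trivial subgroup of \<open>\<langle>x\<rangle>\<close>
  contains \<open>x ^ (p ^ m)\<close>. If \<open>B\<langle>x\<rangle>\<close> were proper, some \<open>y\<close> outside would have its \<open>p\<close>-th power
  in \<open>B\<langle>x\<rangle>\<close>; the bound on the exponent allows \<open>y\<close> to be modified by a power of \<open>x\<close> so that
  its \<open>p\<close>-th power lies in \<open>B\<close>, and then \<open>B\<langle>y\<rangle>\<close> still avoids \<open>x ^ (p ^ m)\<close>, against
  the maximality of \<open>B\<close>.
\<close>

lemma central_cyclic_complement:
  fixes p :: nat
  assumes p: "Factorial_Ring.prime p" and G: "finite_p_group p G"
    and x: "x \<in> center G" and xq: "x [^]\<^bsub>G\<^esub> (p ^ Suc m) = \<one>\<^bsub>G\<^esub>"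
    and D: "subgroup D G"
    and comm: "\<And>y z. y \<in> carrier G \<Longrightarrow> z \<in> carrier G \<Longrightarrow>
      \<exists>d\<in>D. y \<otimes>\<^bsub>G\<^esub> z = d \<otimes>\<^bsub>G\<^esub> (z \<otimes>\<^bsub>G\<^esub> y)"
    and pow: "\<And>y. y \<in> carrier G \<Longrightarrow> y [^]\<^bsub>G\<^esub> (p ^ Suc m) \<in> D"
    and xr: "x [^]\<^bsub>G\<^esub> (p ^ m) \<notin> D"
  shows "\<exists>B. internal_direct_product G (generate G {x}) B"
proof -
  interpret finite_group G by (rule finite_p_groupD[OF G])
  let ?r = "p ^ m"
  let ?X = "generate G {x}"
  have xG: "x \<in> carrier G" using x by (rule center_closed)
  have sX: "subgroup ?X G" using xG by (intro generate_is_subgroup) simp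
  have X: "?X = {x [^]\<^bsub>G\<^esub> k | k. k \<in> (UNIV::nat set)}"
    by (rule generate_pow_on_finite_carrier[OF finite_carrier xG])
  have Xc: "c \<otimes>\<^bsub>G\<^esub> g = g \<otimes>\<^bsub>G\<^esub> c" if "c \<in> ?X" "g \<in> carrier G" for c g
    using center_commutes[OF generate_central[OF x that(1)] that(2)] .
  (* The complement: a subgroup that is maximal with respect to avoiding x ^ (p ^ m). *)
  let ?S = "{B. subgroup B G \<and> D \<subseteq> B \<and> x [^]\<^bsub>G\<^esub> ?r \<notin> B}"
  have "?S \<subseteq> Pow (carrier G)" by (auto dest: subgroup.subset)
  then have "finite ?S" by (simp add: finite_subset)
  moreover have "?S \<noteq> {}" using D xr by blast
  ultimately obtain B where B: "B \<in> ?S" and max: "\<And>B'. B' \<in> ?S \<Longrightarrow> B \<subseteq> B' \<Longrightarrow> B = B'"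
    using finite_has_maximal[of ?S] by (metis (no_types, lifting))
  have sB: "subgroup B G" and DB: "D \<subseteq> B" and xrB: "x [^]\<^bsub>G\<^esub> ?r \<notin> B" using B by auto
  interpret B: subgroup B G by (rule sB)
  have nB: "B \<lhd> G"
    unfolding normal_inv_iff
  proof (intro conjI ballI sB)
    fix g h assume g: "g \<in> carrier G" and h: "h \<in> B"
    obtain d where d: "d \<in> D" "g \<otimes>\<^bsub>G\<^esub> h = d \<otimes>\<^bsub>G\<^esub> (h \<otimes>\<^bsub>G\<^esub> g)"
      using comm[OF g, of h] h by auto
    have "d \<in> B" using d DB by blast
    then have "g \<otimes>\<^bsub>G\<^esub> h \<otimes>\<^bsub>G\<^esub> inv\<^bsub>G\<^esub> g = d \<otimes>\<^bsub>G\<^esub> h"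
      using d(2) g h by (simp add: m_assoc)
    then show "g \<otimes>\<^bsub>G\<^esub> h \<otimes>\<^bsub>G\<^esub> inv\<^bsub>G\<^esub> g \<in> B" using \<open>d \<in> B\<close> h by simp
  qed
  (* A non-trivial power of x in B would have x ^ (p ^ m) among its powers. *)
  have int: "?X \<inter> B = {\<one>\<^bsub>G\<^esub>}"
  proof (intro equalityI subsetI; (elim IntE)?)
    fix c assume c: "c \<in> ?X" "c \<in> B"
    then obtain i :: nat where i: "c = x [^]\<^bsub>G\<^esub> i" using X by blast
    have gB: "x [^]\<^bsub>G\<^esub> gcd i (p ^ Suc m) \<in> B"
      using subgroup_pow_gcd[OF sB xG, of i "p ^ Suc m"] c i xq by simp
    obtain j where j: "j \<le> Suc m" "gcd i (p ^ Suc m) = p ^ j"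
      using divides_primepow_nat[OF p, of "gcd i (p ^ Suc m)" "Suc m"] by auto
    show "c \<in> {\<one>\<^bsub>G\<^esub>}"
    proof (cases "j = Suc m")
      case True
      then have "p ^ Suc m dvd i" using j by (metis gcd_dvd1)
      then obtain l where "i = p ^ Suc m * l" by blast
      then show ?thesis using i xG xq by (simp add: nat_pow_pow[symmetric])
    next
      case False
      then have "?r = p ^ j * p ^ (m - j)" using j by (simp add: power_add[symmetric])
      then have "x [^]\<^bsub>G\<^esub> ?r = (x [^]\<^bsub>G\<^esub> (p ^ j)) [^]\<^bsub>G\<^esub> (p ^ (m - j))"
        using xG by (simp add: nat_pow_pow)
      then have "x [^]\<^bsub>G\<^esub> ?r \<in> B" using gB j subgroup_nat_pow[OF sB] by simp
      then show ?thesis using xrB by blast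
    qed
  qed (auto simp: generate.one)
  let ?BX = "B <#>\<^bsub>G\<^esub> ?X"
  have sBX: "subgroup ?BX G" by (rule mult_norm_subgroup[OF nB sX])
  have BX: "B \<subseteq> ?BX" "?X \<subseteq> ?BX"
    using subset_set_mult[OF sB sX] by auto
  have all: "carrier G \<subseteq> ?BX"
  proof (rule ccontr)
    assume "\<not> carrier G \<subseteq> ?BX"
    then obtain y0 where y0: "y0 \<in> carrier G" "y0 \<notin> ?BX" by blast
    obtain k where "order G = p ^ k" using finite_p_groupD[OF G] by blast
    then have "y0 [^]\<^bsub>G\<^esub> (p ^ k) \<in> ?BX"
      using pow_order_eq_1[OF y0(1)] subgroup.one_closed[OF sBX] by simp
    moreover have "y0 [^]\<^bsub>G\<^esub> (p ^ 0) \<notin> ?BX" using y0 by simp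
    ultimately obtain j where "y0 [^]\<^bsub>G\<^esub> (p ^ j) \<notin> ?BX" "y0 [^]\<^bsub>G\<^esub> (p ^ Suc j) \<in> ?BX"
      using ex_least_nat_less[of "\<lambda>j. y0 [^]\<^bsub>G\<^esub> (p ^ j) \<in> ?BX" k]
      by (metis lessI order_refl)
    moreover define y where "y = y0 [^]\<^bsub>G\<^esub> (p ^ j)"
    ultimately have y: "y \<in> carrier G" "y \<notin> ?BX" "y [^]\<^bsub>G\<^esub> p \<in> ?BX"
      using y0 by (simp_all add: nat_pow_pow mult.commute)
    then obtain b j where b: "b \<in> B" and ypb: "y [^]\<^bsub>G\<^esub> p = b \<otimes>\<^bsub>G\<^esub> x [^]\<^bsub>G\<^esub> (j::nat)"
      unfolding set_mult_def X by blast
    have cx: "g \<otimes>\<^bsub>G\<^esub> x [^]\<^bsub>G\<^esub> i = x [^]\<^bsub>G\<^esub> i \<otimes>\<^bsub>G\<^esub> g" if "g \<in> carrier G" for g and i :: nat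
    proof -
      have "x [^]\<^bsub>G\<^esub> i \<in> ?X" using X by blast
      then show ?thesis using Xc that by simp
    qed
    have "y [^]\<^bsub>G\<^esub> (p ^ Suc m) = (b \<otimes>\<^bsub>G\<^esub> x [^]\<^bsub>G\<^esub> j) [^]\<^bsub>G\<^esub> ?r"
      using y ypb by (simp add: nat_pow_pow[symmetric])
    also have "\<dots> = b [^]\<^bsub>G\<^esub> ?r \<otimes>\<^bsub>G\<^esub> (x [^]\<^bsub>G\<^esub> j) [^]\<^bsub>G\<^esub> ?r"
      using b xG cx by (intro pow_mult_distrib) auto
    finally have "(x [^]\<^bsub>G\<^esub> j) [^]\<^bsub>G\<^esub> ?r = inv\<^bsub>G\<^esub> (b [^]\<^bsub>G\<^esub> ?r) \<otimes>\<^bsub>G\<^esub> y [^]\<^bsub>G\<^esub> (p ^ Suc m)"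
      using b xG y by (metis B.mem_carrier inv_solve_left nat_pow_closed)
    moreover have "y [^]\<^bsub>G\<^esub> (p ^ Suc m) \<in> B" using pow[OF y(1)] DB by blast
    ultimately have "(x [^]\<^bsub>G\<^esub> j) [^]\<^bsub>G\<^esub> ?r \<in> B"
      using subgroup_nat_pow[OF sB b] by simp
    then have 1: "(x [^]\<^bsub>G\<^esub> ?r) [^]\<^bsub>G\<^esub> j \<in> B"
      using xG by (simp add: nat_pow_pow mult.commute)
    have 2: "(x [^]\<^bsub>G\<^esub> ?r) [^]\<^bsub>G\<^esub> p \<in> B"
      using xG xq by (simp add: nat_pow_pow mult.commute)
    (* The q-th power of y lies in D, hence x ^ (j * p ^ m) lies in B. *)
    have "p dvd j"
    proof (rule ccontr)
      assume "\<not> p dvd j"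
      then have "gcd j p = 1" using prime_imp_coprime[OF p, of j] by (simp add: gcd.commute coprime_iff_gcd_eq_1)
      then show False
        using subgroup_pow_gcd[OF sB nat_pow_closed[OF xG] 1 2] xrB xG by simp
    qed
    then obtain l where l: "j = l * p" by (metis dvd_div_mult_self)
    (* Dividing y by x ^ l moves its p-th power into B. *)
    define z where "z = inv\<^bsub>G\<^esub> (x [^]\<^bsub>G\<^esub> l)"
    have zX: "z \<in> ?X" unfolding z_def using X sX by (intro subgroup.m_inv_closed[OF sX]) auto
    have zG: "z \<in> carrier G" using subgroup.mem_carrier[OF sX zX] .
    have zp: "z [^]\<^bsub>G\<^esub> p = inv\<^bsub>G\<^esub> (x [^]\<^bsub>G\<^esub> j)"
      using xG by (simp add: z_def nat_pow_inv[symmetric] nat_pow_pow l)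
    define y' where "y' = y \<otimes>\<^bsub>G\<^esub> z"
    have y'G: "y' \<in> carrier G" using y zG by (simp add: y'_def)
    have "y' [^]\<^bsub>G\<^esub> p = y [^]\<^bsub>G\<^esub> p \<otimes>\<^bsub>G\<^esub> z [^]\<^bsub>G\<^esub> p"
      unfolding y'_def using y zG Xc[OF zX y(1)] by (intro pow_mult_distrib) auto
    then have y'p: "y' [^]\<^bsub>G\<^esub> p = b"
      using b xG by (simp add: ypb zp m_assoc)
    have y'BX: "y' \<notin> ?BX"
    proof
      assume "y' \<in> ?BX"
      then have "y' \<otimes>\<^bsub>G\<^esub> inv\<^bsub>G\<^esub> z \<in> ?BX"
        using zX BX sBX by (meson subgroup.m_closed subgroup.m_inv_closed subsetD)
      then show False using y zG by (simp add: y'_def m_assoc)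
    qed
    (* The larger subgroup contains x ^ (p ^ m) by maximality, so a power of y' lies in B<x>. *)
    let ?B' = "B <#>\<^bsub>G\<^esub> generate G {y'}"
    have sY: "subgroup (generate G {y'}) G" using y'G by (intro generate_is_subgroup) simp
    have sB': "subgroup ?B' G" by (rule mult_norm_subgroup[OF nB sY])
    have BB': "B \<subseteq> ?B'" "generate G {y'} \<subseteq> ?B'"
      using subset_set_mult[OF sB sY] by auto
    have "y' \<in> ?B'" using BB'(2) generate.incl[of y' "{y'}" G] by blast
    moreover have "y' \<notin> B" using y'BX BX by blast
    ultimately have "x [^]\<^bsub>G\<^esub> ?r \<in> ?B'" using max[of ?B'] sB' BB' DB by blast
    then obtain c i where c: "c \<in> B" "x [^]\<^bsub>G\<^esub> ?r = c \<otimes>\<^bsub>G\<^esub> y' [^]\<^bsub>G\<^esub> (i::nat)"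
      unfolding set_mult_def generate_pow_on_finite_carrier[OF finite_carrier y'G] by blast
    have "y' [^]\<^bsub>G\<^esub> i = inv\<^bsub>G\<^esub> c \<otimes>\<^bsub>G\<^esub> x [^]\<^bsub>G\<^esub> ?r"
      using c xG y'G by (metis B.mem_carrier inv_solve_left nat_pow_closed)
    then have 3: "y' [^]\<^bsub>G\<^esub> i \<in> ?BX" using c X unfolding set_mult_def by blast
    have 4: "y' [^]\<^bsub>G\<^esub> p \<in> ?BX" using y'p b BX by blast
    show False
    proof (cases "p dvd i")
      case True
      then obtain s where "i = p * s" by blast
      then have "y' [^]\<^bsub>G\<^esub> i = b [^]\<^bsub>G\<^esub> s" using y'G y'p by (simp add: nat_pow_pow[symmetric])
      then have "x [^]\<^bsub>G\<^esub> ?r \<in> B" using c b subgroup_nat_pow[OF sB b] by simp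
      then show False using xrB by blast
    next
      case False
      then have "gcd i p = 1" using prime_imp_coprime[OF p, of i] by (simp add: gcd.commute coprime_iff_gcd_eq_1)
      then show False using subgroup_pow_gcd[OF sBX y'G 3 4] y'BX y'G by simp
    qed
  qed
  have "internal_direct_product G ?X B"
    unfolding internal_direct_product_iff
  proof (intro conjI ballI sX sB int)
    show "c \<otimes>\<^bsub>G\<^esub> n = n \<otimes>\<^bsub>G\<^esub> c" if "c \<in> ?X" "n \<in> B" for c n
      using Xc[OF that(1) B.mem_carrier[OF that(2)]] .
    fix g assume "g \<in> carrier G"
    then obtain b c where "b \<in> B" "c \<in> ?X" "g = b \<otimes>\<^bsub>G\<^esub> c" using all unfolding set_mult_def by blast
    then show "\<exists>a\<in>?X. \<exists>n\<in>B. g = a \<otimes>\<^bsub>G\<^esub> n" using Xc by (metis B.mem_carrier)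
  qed
  then show ?thesis by blast
qed

section \<open>Central units and direct factors\<close>

lemma finite_p_group_subgroup:
  assumes p: "Factorial_Ring.prime p" and G: "finite_p_group p G" and H: "subgroup H G"
  shows "finite_p_group p (G \<restriction> H)"
proof -
  interpret G: finite_group G by (rule finite_p_groupD[OF G])
  have H': "finite_group (G \<restriction> H)"
    by (rule finite_group_subgroup[OF G.finite_group_axioms H])
  obtain n where "order G = p ^ n" using finite_p_groupD[OF G] by blast
  moreover have "card H dvd order G"
    using G.lagrange[OF H] by (metis dvd_triv_right)
  ultimately obtain k where "card H = p ^ k" using p divides_primepow_nat by metis
  then show ?thesis
    using H' by (auto simp: finite_p_group_def finite_group_def finite_group_axioms_def order_def)
qed

context prime_field
begin

lemma hom_KD:
  assumes G: "group G" and \<delta>: "\<delta> \<in> hom G (add_monoid K)"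
  shows "x \<in> carrier G \<Longrightarrow> \<delta> x \<in> carrier K"
    and "x \<in> carrier G \<Longrightarrow> y \<in> carrier G \<Longrightarrow> \<delta> (x \<otimes>\<^bsub>G\<^esub> y) = \<delta> x \<oplus> \<delta> y"
    and "\<delta> \<one>\<^bsub>G\<^esub> = \<zero>"
    and "x \<in> carrier G \<Longrightarrow> \<delta> (inv\<^bsub>G\<^esub> x) = \<ominus> \<delta> x"
proof -
  interpret \<delta>: group_hom G "add_monoid K" \<delta>
    using \<delta> a_group G by (simp add: group_hom_def group_hom_axioms_def)
  show c: "\<delta> x \<in> carrier K" if "x \<in> carrier G" for x using \<delta>.hom_closed[OF that] by simp
  show m: "\<delta> (x \<otimes>\<^bsub>G\<^esub> y) = \<delta> x \<oplus> \<delta> y" if "x \<in> carrier G" "y \<in> carrier G" for x y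
    using \<delta>.hom_mult[OF that] by simp
  show o: "\<delta> \<one>\<^bsub>G\<^esub> = \<zero>" using \<delta>.hom_one by simp
  show "\<delta> (inv\<^bsub>G\<^esub> x) = \<ominus> \<delta> x" if "x \<in> carrier G"
    using \<delta>.hom_inv[OF that] by (simp add: a_inv_def)
qed

text \<open>
  Homomorphisms \<open>G \<rightarrow> (k, +)\<close> cannot tell a central unit of order dividing \<open>q = p ^ n\<close> from a central
  group element of order dividing \<open>q\<close>. After restriction to \<open>Z = Z(G)\<close> the assumption on \<open>u\<close> says
  that \<open>u\<close> is mapped to 1 by the map that \<open>z \<mapsto> z\<^sup>q\<close> induces on \<open>kZ\<close>. For a group element \<open>z\<close>, dividing
  by a fixed element \<open>t(z\<^sup>q)\<close> with the same \<open>q\<close>-th power gives an element of order dividing \<open>q\<close>, and the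
  error \<open>\<delta>(t(z\<^sup>q))\<close> depends on \<open>z\<^sup>q\<close> only. Summing up, the total error for \<open>u\<close> is \<open>\<delta>(t(1)) = 0\<close>.
\<close>

lemma central_unit_linear:
  assumes G: "finite_p_group p G" and u: "central G u"
    and uq: "u [^]\<^bsub>ga G\<^esub> (p ^ n) = \<one>\<^bsub>ga G\<^esub>"
  shows "\<exists>y\<in>center G. y [^]\<^bsub>G\<^esub> (p ^ n) = \<one>\<^bsub>G\<^esub> \<and>
    (\<forall>\<delta>\<in>hom G (add_monoid K). lin G \<delta> u = \<delta> y)"
proof -
  have fG: "finite_group G" by (rule finite_p_groupD[OF G])
  interpret G: finite_group G by (rule fG)
  let ?Z = "ctr G"
  interpret Z: comm_group ?Z by (rule G.center_comm_group)
  have fZ: "finite_group ?Z" by (rule finite_group_subgroup[OF fG G.center_subgroup])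
  have finZ: "finite (carrier ?Z)" using fZ finite_group.finite_carrier by blast
  let ?q = "p ^ n"
  let ?pw = "\<lambda>z. z [^]\<^bsub>?Z\<^esub> ?q"
  have pw: "?pw \<in> carrier ?Z \<rightarrow> carrier ?Z" using Z.nat_pow_closed by blast
  have pwG: "?pw z = z [^]\<^bsub>G\<^esub> ?q" if "z \<in> center G" for z
    using G.nat_pow_consistent by simp
  have homZ: "\<delta> \<in> hom ?Z (add_monoid K)" if "\<delta> \<in> hom G (add_monoid K)" for \<delta>
    using that center_closed by (fastforce simp: hom_def)
  (* A section of the q-th power map on its image, normalised by t 1 = 1. *)
  define t where "t w = (if w = \<one>\<^bsub>G\<^esub> then \<one>\<^bsub>G\<^esub> else
    if w \<in> ?pw ` center G then inv_into (center G) ?pw w else \<one>\<^bsub>G\<^esub>)" for w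
  have tZ: "t w \<in> center G" for w
    using Z.one_closed inv_into_into[of w ?pw "center G"] by (simp add: t_def)
  have tpw: "?pw (t (?pw z)) = ?pw z" if "z \<in> center G" for z
    using Z.nat_pow_one[of ?q] f_inv_into_f[of "?pw z" ?pw "center G"] that by (auto simp: t_def)
  let ?T = "\<lambda>\<delta> f. lin ?Z (\<lambda>w. \<delta> (t w)) (push ?Z ?Z ?pw f)"
  (* The claim is stable under addition of f: the elements y multiply. *)
  have main: "\<exists>y\<in>center G. ?pw y = \<one>\<^bsub>G\<^esub> \<and> (\<forall>\<delta>\<in>hom G (add_monoid K).
      lin ?Z \<delta> f = \<delta> y \<oplus> ?T \<delta> f)" if f: "f \<in> carrier (ga ?Z)" for f
    using fZ f
  proof (induction f rule: ga_induct)
    case zero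
    show ?case
    proof (intro bexI[of _ "\<one>\<^bsub>G\<^esub>"] conjI ballI)
      fix \<delta> assume \<delta>: "\<delta> \<in> hom G (add_monoid K)"
      note d = hom_KD[OF Z.is_group homZ[OF \<delta>]]
      have 1: "(\<lambda>w. \<delta> (t w)) \<in> carrier ?Z \<rightarrow> carrier K" using d(1) tZ by simp
      have 2: "\<delta> \<in> carrier ?Z \<rightarrow> carrier K" using d(1) by simp
      show "lin ?Z \<delta> \<zero>\<^bsub>ga ?Z\<^esub> = \<delta> \<one>\<^bsub>G\<^esub> \<oplus> ?T \<delta> \<zero>\<^bsub>ga ?Z\<^esub>"
        using d(3) additive_zero[OF fZ abelian_group_axioms lin_additive[OF fZ 1]]
          additive_zero[OF fZ abelian_group_axioms lin_additive[OF fZ 2]]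
          additive_zero[OF fZ ga_abelian_group[OF fZ] push_additive[OF fZ fZ]]
        by simp
    qed (use Z.one_closed Z.nat_pow_one[of ?q] in auto)
  next
    case (add f h)
    then obtain y z where y: "y \<in> center G" "?pw y = \<one>\<^bsub>G\<^esub>"
        "\<And>\<delta>. \<delta>\<in>hom G (add_monoid K) \<Longrightarrow> lin ?Z \<delta> f = \<delta> y \<oplus> ?T \<delta> f"
      and z: "z \<in> center G" "?pw z = \<one>\<^bsub>G\<^esub>"
        "\<And>\<delta>. \<delta>\<in>hom G (add_monoid K) \<Longrightarrow> lin ?Z \<delta> h = \<delta> z \<oplus> ?T \<delta> h" by blast
    show ?case
    proof (intro bexI[of _ "y \<otimes>\<^bsub>?Z\<^esub> z"] conjI ballI)
      show "?pw (y \<otimes>\<^bsub>?Z\<^esub> z) = \<one>\<^bsub>G\<^esub>"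
        using Z.nat_pow_distrib[of y z ?q] y z Z.r_one[of "\<one>\<^bsub>?Z\<^esub>"] by simp
      show "y \<otimes>\<^bsub>?Z\<^esub> z \<in> center G" using Z.m_closed y z by simp
      fix \<delta> assume \<delta>: "\<delta> \<in> hom G (add_monoid K)"
      note d = hom_KD[OF Z.is_group homZ[OF \<delta>]]
      have 1: "(\<lambda>w. \<delta> (t w)) \<in> carrier ?Z \<rightarrow> carrier K" using d(1) tZ by simp
      have 2: "\<delta> \<in> carrier ?Z \<rightarrow> carrier K" using d(1) by simp
      note lins = lin_additive[OF fZ 2] additive_comp[OF push_additive[OF fZ fZ, of ?pw] lin_additive[OF fZ 1]]
      show "lin ?Z \<delta> (f \<oplus>\<^bsub>ga ?Z\<^esub> h) = \<delta> (y \<otimes>\<^bsub>?Z\<^esub> z) \<oplus> ?T \<delta> (f \<oplus>\<^bsub>ga ?Z\<^esub> h)"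
        unfolding additive_add[OF lins(1) add(1,2)] additive_add[OF lins(2) add(1,2)]
        using d(1,2) y z \<delta> additive_closed[OF lins(2) add(1)] additive_closed[OF lins(2) add(2)]
        by (simp add: a_ac)
    qed
  next
    case (single z)
    let ?y = "z \<otimes>\<^bsub>?Z\<^esub> inv\<^bsub>?Z\<^esub> (t (?pw z))"
    have z: "z \<in> carrier ?Z" and tz: "t (?pw z) \<in> carrier ?Z" using single tZ by auto
    show ?case
    proof (intro bexI[of _ ?y] conjI ballI)
      show "?y \<in> center G" using Z.m_closed[OF z Z.inv_closed[OF tz]] by simp
      have "?pw ?y = ?pw z \<otimes>\<^bsub>?Z\<^esub> inv\<^bsub>?Z\<^esub> (?pw (t (?pw z)))"
        using z tz by (simp only: Z.nat_pow_distrib Z.inv_closed Z.nat_pow_inv)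
      then show "?pw ?y = \<one>\<^bsub>G\<^esub>" using tpw z Z.r_inv[OF Z.nat_pow_closed[OF z]] by simp
      fix \<delta> assume \<delta>: "\<delta> \<in> hom G (add_monoid K)"
      note d = hom_KD[OF Z.is_group homZ[OF \<delta>]]
      have 1: "(\<lambda>w. \<delta> (t w)) \<in> carrier ?Z \<rightarrow> carrier K" using d(1) tZ by simp
      have 2: "\<delta> \<in> carrier ?Z \<rightarrow> carrier K" using d(1) by simp
      have "?T \<delta> (basis ?Z z) = \<delta> (t (?pw z))"
        unfolding push_basis[OF fZ fZ z] using lin_basis[OF fZ 1] pw z by (simp add: Pi_iff)
      then show "lin ?Z \<delta> (basis ?Z z) = \<delta> ?y \<oplus> ?T \<delta> (basis ?Z z)"
        using d(1)[OF z] d(1)[OF tz] d(2)[OF z Z.inv_closed[OF tz]] d(4)[OF tz] lin_basis[OF fZ 2 z]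
        by (simp add: a_assoc l_neg)
    qed
  qed
  let ?r = "restrict u (center G)"
  have uc: "u \<in> carrier (ga G)" using u by (simp add: central_def)
  have rc: "?r \<in> carrier (ga ?Z)"
    using uc center_closed by (force simp: ga_mem[OF fZ] ga_mem_closed[OF fG])
  have "push ?Z ?Z ?pw ?r = ?r [^]\<^bsub>ga ?Z\<^esub> ?q"
    using ga_frobenius[OF G.center_comm_group finZ rc] by simp
  also have "\<dots> = restrict (\<one>\<^bsub>ga G\<^esub>) (center G)"
    using restrict_center_pow[OF G u, of ?q] uq by simp
  also have "\<dots> = basis ?Z \<one>\<^bsub>G\<^esub>"
    using Int_absorb1[OF subgroup.subset[OF G.center_subgroup]]
    by (simp add: ga_one[OF fG] basis_def)
  finally have P: "push ?Z ?Z ?pw ?r = basis ?Z \<one>\<^bsub>G\<^esub>" .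
  obtain y where y: "y \<in> center G" "?pw y = \<one>\<^bsub>G\<^esub>"
    "\<And>\<delta>. \<delta>\<in>hom G (add_monoid K) \<Longrightarrow> lin ?Z \<delta> ?r = \<delta> y \<oplus> ?T \<delta> ?r"
    using main[OF rc] by blast
  have "lin G \<delta> u = \<delta> y" if \<delta>: "\<delta> \<in> hom G (add_monoid K)" for \<delta>
  proof -
    note d = hom_KD[OF Z.is_group homZ[OF \<delta>]]
    have 1: "(\<lambda>w. \<delta> (t w)) \<in> carrier ?Z \<rightarrow> carrier K" using d(1) tZ by simp
    have "?T \<delta> ?r = \<delta> (t \<one>\<^bsub>G\<^esub>)"
      unfolding P using lin_basis[OF fZ 1 Z.one_closed] by simp
    then have "?T \<delta> ?r = \<zero>" using d(3) by (simp add: t_def)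
    then show ?thesis using y(3)[OF \<delta>] lin_restrict_center[OF G u \<delta>] d(1) y(1) by simp
  qed
  then show ?thesis using y pwG by metis
qed

text \<open>
  The functional \<open>h\<^sup>i \<mapsto> i\<close> is well defined because \<open>p\<close> divides the order of \<open>h\<close>. Extended linearly it
  gives the coefficient of \<open>h - 1\<close> in the expansion of an element by powers of \<open>h - 1\<close>. The power
  \<open>(h\<^sup>i) ^ (p ^ m)\<close> determines \<open>i\<close> modulo \<open>p\<close> and thereby the value.
\<close>

lemma linear_functional_cyclic:
  assumes G: "finite_group G" and h: "h \<in> carrier G" and ord: "group.ord G h = p ^ Suc m"
  shows "\<exists>\<tau>. \<tau> \<in> hom (G \<restriction> generate G {h}) (add_monoid K) \<and> \<tau> h = \<one> \<and>
    (\<forall>c\<in>generate G {h}. \<forall>c'\<in>generate G {h}. c [^]\<^bsub>G\<^esub> (p ^ m) = c' [^]\<^bsub>G\<^esub> (p ^ m) \<longrightarrow> \<tau> c = \<tau> c')"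
proof -
  interpret G: finite_group G by fact
  have C: "generate G {h} = {h [^]\<^bsub>G\<^esub> k | k. k \<in> (UNIV::nat set)}"
    by (rule G.generate_pow_on_finite_carrier[OF G.finite_carrier h])
  have p0: "p > 0" using prime prime_gt_0_nat by blast
  have cong: "[i] \<cdot> \<one> = [j] \<cdot> \<one>" if "i mod p = j mod p" for i j :: nat
  proof -
    have "[i] \<cdot> \<one> = [(i mod p)] \<cdot> \<one>" for i :: nat
    proof -
      have "[i] \<cdot> \<one> = [(i div p * p + i mod p)] \<cdot> \<one>" by simp
      also have "\<dots> = [(i div p * p)] \<cdot> \<one> \<oplus> [(i mod p)] \<cdot> \<one>"
        by (simp only: add.nat_pow_mult[OF one_closed])
      also have "[(i div p * p)] \<cdot> \<one> = \<zero>" by (rule char_p) auto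
      finally show ?thesis by simp
    qed
    then show ?thesis using that by metis
  qed
  have pow_eq: "i mod p = j mod p"
    if "(h [^]\<^bsub>G\<^esub> i) [^]\<^bsub>G\<^esub> (p ^ m) = (h [^]\<^bsub>G\<^esub> j) [^]\<^bsub>G\<^esub> (p ^ m)" for i j :: nat
  proof -
    have "h [^]\<^bsub>G\<^esub> (i * p ^ m) = h [^]\<^bsub>G\<^esub> (j * p ^ m)" using that h by (simp add: G.nat_pow_pow)
    then have "int (p ^ Suc m) dvd int (j * p ^ m) - int (i * p ^ m)"
      using G.int_pow_eq[OF h, of "int (i * p ^ m)" "int (j * p ^ m)"] ord by (metis int_pow_int)
    then have "int p * int (p ^ m) dvd (int j - int i) * int (p ^ m)"
      by (simp add: left_diff_distrib)
    then have "int p dvd int j - int i"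
      using p0 by (subst (asm) dvd_mult_cancel_right) simp
    then have "int j mod int p = int i mod int p" by (simp add: mod_eq_dvd_iff)
    then show ?thesis by (metis of_nat_eq_iff of_nat_mod)
  qed
  define \<tau> where "\<tau> c = [(SOME k::nat. c = h [^]\<^bsub>G\<^esub> k)] \<cdot> \<one>" for c
  have \<tau>: "\<tau> (h [^]\<^bsub>G\<^esub> i) = [i] \<cdot> \<one>" for i :: nat
    unfolding \<tau>_def
  proof (rule someI2[of _ i])
    fix k assume "h [^]\<^bsub>G\<^esub> i = h [^]\<^bsub>G\<^esub> (k::nat)"
    then have "k mod p = i mod p" using pow_eq[of k i] by simp
    then show "[k] \<cdot> \<one> = [i] \<cdot> \<one>" by (rule cong)
  qed simp
  show ?thesis
  proof (intro exI[of _ \<tau>] conjI ballI impI)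
    show "\<tau> \<in> hom (G \<restriction> generate G {h}) (add_monoid K)"
    proof (rule homI)
      fix c d assume "c \<in> carrier (G \<restriction> generate G {h})"
        "d \<in> carrier (G \<restriction> generate G {h})"
      then obtain i j :: nat where ij: "c = h [^]\<^bsub>G\<^esub> i" "d = h [^]\<^bsub>G\<^esub> j" using C by auto
      show "\<tau> c \<in> carrier (add_monoid K)" using \<tau> ij by simp
      show "\<tau> (c \<otimes>\<^bsub>G \<restriction> generate G {h}\<^esub> d) = \<tau> c \<otimes>\<^bsub>add_monoid K\<^esub> \<tau> d"
        using h \<tau>[of "i + j"] add.nat_pow_mult[OF one_closed, of i j] by (simp add: ij \<tau> G.nat_pow_mult)
    qed
    show "\<tau> h = \<one>" using \<tau>[of 1] h by simp
    fix c c' assume "c \<in> generate G {h}" "c' \<in> generate G {h}"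
      and eq: "c [^]\<^bsub>G\<^esub> (p ^ m) = c' [^]\<^bsub>G\<^esub> (p ^ m)"
    then obtain i j :: nat where ij: "c = h [^]\<^bsub>G\<^esub> i" "c' = h [^]\<^bsub>G\<^esub> j" using C by auto
    show "\<tau> c = \<tau> c'" using cong[OF pow_eq[of i j]] eq unfolding ij \<tau> by simp
  qed
qed

text \<open>
  Fermat's little theorem.
\<close>

lemma frobenius_K:
  assumes "c \<in> carrier K"
  shows "c [^] (p ^ k) = c"
proof -
  obtain n :: nat where n: "c = [n] \<cdot> \<one>" using field_elem_multiple_of_one[OF assms] by blast
  have "([n] \<cdot> \<one>) [^] (p ^ k) = [n] \<cdot> \<one>"
    by (induction n) (use prime prime_gt_0_nat in \<open>auto simp: frobenius_add[OF prime char_p] nat_pow_zero\<close>)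
  then show ?thesis using n by simp
qed

lemma aug_ring_hom:
  assumes G: "finite_group G"
  shows "lin G (\<lambda>_. \<one>) \<in> ring_hom (ga G) K"
proof -
  interpret G: finite_group G by fact
  have F: "(\<lambda>_. \<one>) \<in> carrier G \<rightarrow> carrier K" by simp
  show ?thesis
    by (rule ring_hom_multI[OF G ring_axioms lin_additive[OF G F]]) (auto simp: lin_basis[OF G F])
qed

lemma ring_hom_pow:
  assumes A: "ring A" and B: "ring B" and f: "f \<in> ring_hom A B" and x: "x \<in> carrier A"
  shows "f (x [^]\<^bsub>A\<^esub> (n::nat)) = f x [^]\<^bsub>B\<^esub> n"
proof -
  interpret A: ring A by fact
  interpret B: ring B by fact
  show ?thesis by (induction n) (use x in \<open>auto simp: ring_hom_one[OF f] ring_hom_mult[OF f]\<close>)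
qed

text \<open>
  The augmentation lies in \<open>k\<close>, where taking the \<open>p\<close>-th power is the identity.
\<close>

lemma aug_of_unit:
  assumes C: "finite_group C" and w: "w \<in> carrier (ga C)" "w [^]\<^bsub>ga C\<^esub> (p ^ k) = \<one>\<^bsub>ga C\<^esub>"
  shows "lin C (\<lambda>_. \<one>) w = \<one>"
proof -
  note A = aug_ring_hom[OF C]
  have "lin C (\<lambda>_. \<one>) w = lin C (\<lambda>_. \<one>) w [^] (p ^ k)"
    using frobenius_K[OF ring_hom_closed[OF A w(1)]] by simp
  also have "\<dots> = \<one>"
    using ring_hom_pow[OF ga_ring[OF C] ring_axioms A w(1), of "p ^ k"] w(2) ring_hom_one[OF A] by simp
  finally show ?thesis .
qed

lemma aug_eq_one:
  assumes Q: "finite_p_group p Q" and C: "finite_group C"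
    and \<theta>: "\<And>y. y \<in> carrier Q \<Longrightarrow> \<theta> y \<in> carrier (ga C)" "\<theta> \<one>\<^bsub>Q\<^esub> = \<one>\<^bsub>ga C\<^esub>"
      "\<And>y z. y \<in> carrier Q \<Longrightarrow> z \<in> carrier Q \<Longrightarrow> \<theta> (y \<otimes>\<^bsub>Q\<^esub> z) = \<theta> y \<otimes>\<^bsub>ga C\<^esub> \<theta> z"
    and y: "y \<in> carrier Q"
  shows "lin C (\<lambda>_. \<one>) (\<theta> y) = \<one>"
proof -
  interpret Q: finite_group Q by (rule finite_p_groupD[OF Q])
  interpret A: ring "ga C" by (rule ga_ring[OF C])
  obtain k where k: "order Q = p ^ k" using finite_p_groupD[OF Q] by blast
  have "\<theta> (y [^]\<^bsub>Q\<^esub> n) = \<theta> y [^]\<^bsub>ga C\<^esub> n" for n :: nat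
    by (induction n) (use y \<theta> in auto)
  then have "\<theta> y [^]\<^bsub>ga C\<^esub> (p ^ k) = \<one>\<^bsub>ga C\<^esub>"
    using Q.pow_order_eq_1[OF y] k \<theta>(2) by metis
  then show ?thesis by (rule aug_of_unit[OF C \<theta>(1)[OF y]])
qed

lemma ga_eq_linI:
  assumes G: "finite_group G" and f: "f \<in> carrier (ga G)" and h: "h \<in> carrier (ga G)"
    and eq: "\<And>F. F \<in> carrier G \<rightarrow> carrier K \<Longrightarrow> lin G F f = lin G F h"
  shows "f = h"
proof (rule ga_eqI[OF G f h])
  fix x assume x: "x \<in> carrier G"
  have "lin G (\<lambda>y. if y = x then \<one> else \<zero>) f = f x" if "f \<in> carrier (ga G)" for f
  proof -
    have "lin G (\<lambda>y. if y = x then \<one> else \<zero>) f = (\<Oplus>y\<in>carrier G. if y = x then f y else \<zero>)"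
      unfolding lin_def using ga_mem_closed[OF G that] by (intro add.finprod_cong') auto
    then show ?thesis using finsum_delta[OF G x] ga_mem_closed[OF G that] by simp
  qed
  then show "f x = h x" using eq[of "\<lambda>y. if y = x then \<one> else \<zero>"] f h by simp
qed

text \<open>
  The trivial homomorphism induces the augmentation.
\<close>

lemma push_trivial:
  assumes G: "finite_group G" and H: "finite_group H"
    and \<chi>: "\<And>x. x \<in> carrier G \<Longrightarrow> \<chi> x = \<one>\<^bsub>H\<^esub>"
    and f: "f \<in> carrier (ga G)" and aug: "lin G (\<lambda>_. \<one>) f = \<one>"
  shows "push G H \<chi> f = \<one>\<^bsub>ga H\<^esub>"
proof -
  interpret G: finite_group G by fact
  interpret H: finite_group H by fact
  interpret B: ring "ga H" by (rule ga_ring[OF H])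
  have c: "push G H \<chi> f \<in> carrier (ga H)"
    by (rule additive_closed[OF push_additive[OF G H] f])
  show ?thesis
  proof (rule ga_eq_linI[OF H c B.one_closed])
    fix F assume F: "F \<in> carrier H \<rightarrow> carrier K"
    have "lin H F (push G H \<chi> f) = lin G (\<lambda>x. F (\<chi> x)) f"
      by (rule lin_push[OF G H _ F f]) (auto simp: \<chi>)
    also have "\<dots> = (\<Oplus>x\<in>carrier G. f x \<otimes> F \<one>\<^bsub>H\<^esub>)"
      unfolding lin_def using F ga_mem_closed[OF G f] \<chi>
      by (intro add.finprod_cong') (auto simp: Pi_iff)
    also have "\<dots> = (\<Oplus>x\<in>carrier G. f x) \<otimes> F \<one>\<^bsub>H\<^esub>"
      using F ga_mem_closed[OF G f] by (simp add: finsum_ldistr Pi_iff)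
    also have "(\<Oplus>x\<in>carrier G. f x) = lin G (\<lambda>_. \<one>) f"
      unfolding lin_def using ga_mem_closed[OF G f] by (intro add.finprod_cong') auto
    also have "\<dots> \<otimes> F \<one>\<^bsub>H\<^esub> = lin H F \<one>\<^bsub>ga H\<^esub>"
      using aug F lin_basis[OF H F H.one_closed] by (simp add: Pi_iff ga_one[OF H])
    finally show "lin H F (push G H \<chi> f) = lin H F \<one>\<^bsub>ga H\<^esub>" .
  qed
qed

text \<open>
  Let \<open>D\<close> be the kernel of \<open>\<theta>\<close>. The values of \<open>\<theta>\<close> are units of augmentation 1 in the group
  algebra of an abelian group of exponent dividing \<open>q = p ^ Suc m\<close>; by the Frobenius identity their
  \<open>q\<close>-th powers are 1, so the quotient by \<open>D\<close> is abelian of exponent dividing \<open>q\<close>. If \<open>\<theta>(x) ^ (p ^ m)\<close> were 1,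
  then the coefficients of \<open>\<theta>(x)\<close> would sum to 0 over every fibre of \<open>c \<mapsto> c ^ (p ^ m)\<close> except the one over 1.
  The functional \<open>\<tau>\<close> is constant on every fibre and 0 on the fibre over 1, so it would vanish on
  \<open>\<theta>(x)\<close>. Hence \<open>x\<close> keeps its order modulo \<open>D\<close> and splits off.
\<close>

lemma direct_factor_criterion:
  assumes Q: "finite_p_group p Q"
    and C: "comm_group C" "finite (carrier C)" "\<And>c. c \<in> carrier C \<Longrightarrow> c [^]\<^bsub>C\<^esub> (p ^ Suc m) = \<one>\<^bsub>C\<^esub>"
    and \<tau>: "\<tau> \<in> hom C (add_monoid K)"
      "\<And>c c'. c \<in> carrier C \<Longrightarrow> c' \<in> carrier C \<Longrightarrow> c [^]\<^bsub>C\<^esub> (p ^ m) = c' [^]\<^bsub>C\<^esub> (p ^ m) \<Longrightarrow> \<tau> c = \<tau> c'"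
    and \<theta>: "\<And>y. y \<in> carrier Q \<Longrightarrow> \<theta> y \<in> carrier (ga C)" "\<theta> \<one>\<^bsub>Q\<^esub> = \<one>\<^bsub>ga C\<^esub>"
      "\<And>y z. y \<in> carrier Q \<Longrightarrow> z \<in> carrier Q \<Longrightarrow> \<theta> (y \<otimes>\<^bsub>Q\<^esub> z) = \<theta> y \<otimes>\<^bsub>ga C\<^esub> \<theta> z"
    and x: "x \<in> center Q" "x [^]\<^bsub>Q\<^esub> (p ^ Suc m) = \<one>\<^bsub>Q\<^esub>" "lin C \<tau> (\<theta> x) \<noteq> \<zero>"
  shows "x [^]\<^bsub>Q\<^esub> (p ^ m) \<noteq> \<one>\<^bsub>Q\<^esub> \<and> (\<exists>B. internal_direct_product Q (generate Q {x}) B)"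
proof -
  interpret Q: finite_group Q by (rule finite_p_groupD[OF Q])
  interpret C: comm_group C by (rule C)
  have fC: "finite_group C" using C(2) by unfold_locales
  interpret A: cring "ga C" by (rule ga_cring[OF C(1,2)])
  have xX: "x \<in> carrier Q" using x center_closed by metis
  note t = hom_KD[OF C.is_group \<tau>(1)]
  have pow: "\<theta> (y [^]\<^bsub>Q\<^esub> n) = \<theta> y [^]\<^bsub>ga C\<^esub> n" if "y \<in> carrier Q" for y and n :: nat
    by (induction n) (use that \<theta> in auto)
  let ?D = "{y \<in> carrier Q. \<theta> y = \<one>\<^bsub>ga C\<^esub>}"
  have \<theta>inv: "\<theta> (inv\<^bsub>Q\<^esub> y) \<otimes>\<^bsub>ga C\<^esub> \<theta> y = \<one>\<^bsub>ga C\<^esub>" if "y \<in> carrier Q" for y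
    using \<theta>(3)[of "inv\<^bsub>Q\<^esub> y" y] \<theta>(2) that by simp
  have sD: "subgroup ?D Q"
  proof (rule Q.subgroupI)
    show "?D \<noteq> {}" using \<theta>(2) Q.one_closed by blast
    show "inv\<^bsub>Q\<^esub> a \<in> ?D" if "a \<in> ?D" for a
      using \<theta>inv[of a] \<theta>(1)[of "inv\<^bsub>Q\<^esub> a"] that by simp
  qed (auto simp: \<theta>)
  have comm: "\<exists>d\<in>?D. y \<otimes>\<^bsub>Q\<^esub> z = d \<otimes>\<^bsub>Q\<^esub> (z \<otimes>\<^bsub>Q\<^esub> y)" if yz: "y \<in> carrier Q" "z \<in> carrier Q" for y z
  proof (rule bexI[of _ "(y \<otimes>\<^bsub>Q\<^esub> z) \<otimes>\<^bsub>Q\<^esub> inv\<^bsub>Q\<^esub> (z \<otimes>\<^bsub>Q\<^esub> y)"])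
    have "\<theta> (y \<otimes>\<^bsub>Q\<^esub> z) = \<theta> (z \<otimes>\<^bsub>Q\<^esub> y)" using yz \<theta> A.m_comm by simp
    then have "\<theta> ((y \<otimes>\<^bsub>Q\<^esub> z) \<otimes>\<^bsub>Q\<^esub> inv\<^bsub>Q\<^esub> (z \<otimes>\<^bsub>Q\<^esub> y)) = \<theta> ((z \<otimes>\<^bsub>Q\<^esub> y) \<otimes>\<^bsub>Q\<^esub> inv\<^bsub>Q\<^esub> (z \<otimes>\<^bsub>Q\<^esub> y))"
      using yz by (simp only: \<theta>(3) Q.m_closed Q.inv_closed)
    then show "(y \<otimes>\<^bsub>Q\<^esub> z) \<otimes>\<^bsub>Q\<^esub> inv\<^bsub>Q\<^esub> (z \<otimes>\<^bsub>Q\<^esub> y) \<in> ?D" using yz \<theta>(2) by simp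
    show "y \<otimes>\<^bsub>Q\<^esub> z = (y \<otimes>\<^bsub>Q\<^esub> z) \<otimes>\<^bsub>Q\<^esub> inv\<^bsub>Q\<^esub> (z \<otimes>\<^bsub>Q\<^esub> y) \<otimes>\<^bsub>Q\<^esub> (z \<otimes>\<^bsub>Q\<^esub> y)"
      using yz by (simp add: Q.m_assoc del: Q.inv_mult_group)
  qed
  have qD: "y [^]\<^bsub>Q\<^esub> (p ^ Suc m) \<in> ?D" if y: "y \<in> carrier Q" for y
  proof -
    have "push C C (\<lambda>c. c [^]\<^bsub>C\<^esub> (p ^ Suc m)) (\<theta> y) = \<one>\<^bsub>ga C\<^esub>"
      by (rule push_trivial[OF fC fC C(3) \<theta>(1)[OF y] aug_eq_one[OF Q fC \<theta> y]])
    then show ?thesis using ga_frobenius[OF C(1,2) \<theta>(1)[OF y]] y by (simp add: pow del: power_Suc)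
  qed
  have rD: "x [^]\<^bsub>Q\<^esub> (p ^ m) \<notin> ?D"
  proof
    assume "x [^]\<^bsub>Q\<^esub> (p ^ m) \<in> ?D"
    then have P: "push C C (\<lambda>c. c [^]\<^bsub>C\<^esub> (p ^ m)) (\<theta> x) = basis C \<one>\<^bsub>C\<^esub>"
      using ga_frobenius[OF C(1,2) \<theta>(1)[OF xX], of m] xX by (simp add: pow ga_one[OF fC])
    let ?pw = "\<lambda>c. c [^]\<^bsub>C\<^esub> (p ^ m)"
    (* The functional tau factors through the power map c |-> c ^ (p ^ m) as sigma. *)
    define \<sigma> where "\<sigma> w = (if w \<in> ?pw ` carrier C then \<tau> (inv_into (carrier C) ?pw w) else \<zero>)" for w
    have \<sigma>: "\<sigma> (?pw c) = \<tau> c" if "c \<in> carrier C" for c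
      using that \<tau>(2)[of "inv_into (carrier C) ?pw (?pw c)" c]
      by (simp add: \<sigma>_def inv_into_into f_inv_into_f[of _ ?pw])
    have \<sigma>K: "\<sigma> \<in> carrier C \<rightarrow> carrier K"
      using t(1) by (auto simp: \<sigma>_def inv_into_into)
    have "lin C \<tau> (\<theta> x) = lin C (\<lambda>c. \<sigma> (?pw c)) (\<theta> x)"
      unfolding lin_def using ga_mem_closed[OF fC \<theta>(1)[OF xX]] t(1)
      by (intro add.finprod_cong') (auto simp: \<sigma>)
    also have "\<dots> = lin C \<sigma> (push C C ?pw (\<theta> x))"
      by (rule lin_push[OF fC fC _ \<sigma>K \<theta>(1)[OF xX], symmetric]) (auto simp: C.nat_pow_closed)
    also have "\<dots> = \<sigma> (?pw \<one>\<^bsub>C\<^esub>)" unfolding P using lin_basis[OF fC \<sigma>K] by simp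
    also have "\<dots> = \<zero>" using \<sigma>[OF C.one_closed] t(3) by simp
    finally show False using x(3) by simp
  qed
  have "x [^]\<^bsub>Q\<^esub> (p ^ m) \<noteq> \<one>\<^bsub>Q\<^esub>" using rD \<theta>(2) by auto
  then show ?thesis
    using central_cyclic_complement[OF prime Q x(1,2) sD comm qD rD] by blast
qed

end

section \<open>Projections of internal direct products\<close>

lemma (in group) internal_direct_product_DirProd_iso:
  assumes "internal_direct_product G A N"
  shows "(\<lambda>(a, n). a \<otimes> n) \<in> iso (G \<restriction> A \<times>\<times> G \<restriction> N) G"
proof -
  have sub: "subgroup A G" "subgroup N G" using assms unfolding internal_direct_product_iff by auto
  interpret group_disjoint_sum G A N by (intro group_disjoint_sum.intro is_group sub)
  have "G \<restriction> A = subgroup_generated G A" "G \<restriction> N = subgroup_generated G N"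
    using AG.carrier_subgroup_generated_subgroup BG.carrier_subgroup_generated_subgroup
    by (simp_all add: subgroup_generated_def)
  then show ?thesis using assms iso_group_mul_eq by (simp add: internal_direct_product_def)
qed

lemma (in group) internal_direct_product_projections:
  assumes "internal_direct_product G A N"
  obtains \<alpha> \<nu> where
    "\<alpha> \<in> hom G (G \<restriction> A)" "\<nu> \<in> hom G (G \<restriction> N)"
    "\<And>g. g \<in> carrier G \<Longrightarrow> g = \<alpha> g \<otimes> \<nu> g"
    "\<And>a. a \<in> A \<Longrightarrow> \<alpha> a = a" "\<And>a. a \<in> A \<Longrightarrow> \<nu> a = \<one>"
    "\<And>n. n \<in> N \<Longrightarrow> \<alpha> n = \<one>" "\<And>n. n \<in> N \<Longrightarrow> \<nu> n = n"
proof -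
  have sub: "subgroup A G" "subgroup N G" using assms unfolding internal_direct_product_iff by auto
  let ?P = "G \<restriction> A \<times>\<times> G \<restriction> N" and ?m = "\<lambda>(a, n). a \<otimes> n"
  define \<gamma> where "\<gamma> = inv_into (carrier ?P) ?m"
  note iso = internal_direct_product_DirProd_iso[OF assms]
  have bij: "bij_betw ?m (carrier ?P) (carrier G)" using iso by (simp add: iso_def)
  have "group ?P" using DirProd_group subgroup_imp_group sub by blast
  then have "\<gamma> \<in> iso G ?P" unfolding \<gamma>_def by (rule group.iso_set_sym[OF _ iso])
  then have \<gamma>: "\<gamma> \<in> hom G ?P" by (simp add: iso_def)
  have \<gamma>m: "\<gamma> (a \<otimes> n) = (a, n)" if "a \<in> A" "n \<in> N" for a n
    using bij_betw_inv_into_left[OF bij, of "(a, n)"] that by (simp add: \<gamma>_def)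
  note one = subgroup.one_closed[OF sub(1)] subgroup.one_closed[OF sub(2)]
  note mem = subgroup.mem_carrier[OF sub(1)] subgroup.mem_carrier[OF sub(2)]
  show ?thesis
  proof (rule that[of "fst \<circ> \<gamma>" "snd \<circ> \<gamma>"])
    show "fst \<circ> \<gamma> \<in> hom G (G \<restriction> A)" "snd \<circ> \<gamma> \<in> hom G (G \<restriction> N)"
      using \<gamma> by (simp_all only: hom_pairwise)
    show "g = (fst \<circ> \<gamma>) g \<otimes> (snd \<circ> \<gamma>) g" if "g \<in> carrier G" for g
      using bij_betw_inv_into_right[OF bij that] by (simp add: \<gamma>_def case_prod_unfold)
    show "(fst \<circ> \<gamma>) a = a" "(snd \<circ> \<gamma>) a = \<one>" if "a \<in> A" for a
      using \<gamma>m[OF that one(2)] mem(1)[OF that] by simp_all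
    show "(fst \<circ> \<gamma>) n = \<one>" "(snd \<circ> \<gamma>) n = n" if "n \<in> N" for n
      using \<gamma>m[OF one(1) that] mem(2)[OF that] by simp_all
  qed
qed

lemma (in group) internal_direct_product_commute:
  assumes "internal_direct_product G A N"
  shows "internal_direct_product G N A"
proof -
  note r = assms[unfolded internal_direct_product_iff]
  have "\<exists>n\<in>N. \<exists>a\<in>A. g = n \<otimes> a" if "g \<in> carrier G" for g using r that by metis
  then show ?thesis unfolding internal_direct_product_iff using r by (simp add: Int_commute)
qed

lemma (in group) internal_direct_product_card:
  assumes "internal_direct_product G A N"
  shows "card (carrier G) = card A * card N"
  using bij_betw_same_card[of _ "A \<times> N" "carrier G"] internal_direct_product_DirProd_iso[OF assms]
  by (auto simp: iso_def card_cartesian_product)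

context prime_field
begin

lemma incl_hom: "subgroup S G \<Longrightarrow> (\<lambda>x. x) \<in> hom (G \<restriction> S) G"
  by (auto simp: hom_def subgroup.mem_carrier)

abbreviation incl where "incl S G \<equiv> push (G \<restriction> S) G (\<lambda>x. x)"

lemma incl_ring_hom:
  assumes "finite_group G" "subgroup S G"
  shows "incl S G \<in> ring_hom (ga (G \<restriction> S)) (ga G)"
  using assms by (intro push_ring_hom finite_group_subgroup incl_hom)

lemma incl_basis:
  assumes "finite_group G" "subgroup S G" "x \<in> S"
  shows "incl S G (basis (G \<restriction> S) x) = basis G x"
  using assms by (subst push_basis) (auto intro: finite_group_subgroup)

section \<open>The augmentation ideal of a cyclic group algebra\<close>

lemma basis_pow:
  assumes G: "finite_group G" and x: "x \<in> carrier G"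
  shows "basis G x [^]\<^bsub>ga G\<^esub> (n::nat) = basis G (x [^]\<^bsub>G\<^esub> n)"
proof -
  interpret G: finite_group G by fact
  interpret A: ring "ga G" by (rule ga_ring[OF G])
  show ?thesis by (induction n) (use x in \<open>auto simp: ga_one[OF G] basis_mult[OF G]\<close>)
qed

lemma ring_hom_diff:
  assumes A: "ring A" and B: "ring B" and f: "f \<in> ring_hom A B" and x: "x \<in> carrier A" "y \<in> carrier A"
  shows "f (x \<ominus>\<^bsub>A\<^esub> y) = f x \<ominus>\<^bsub>B\<^esub> f y"
proof -
  interpret A: ring A by fact
  interpret B: ring B by fact
  interpret f: ring_hom_ring A B f using A B f by (rule ring_hom_ringI2)
  show ?thesis using x by (simp add: A.minus_eq B.minus_eq)
qed

text \<open>
  Multiplying \<open>(h - 1) ^ (q - 1)\<close> by \<open>h - 1\<close> gives \<open>h\<^sup>q - 1 = 0\<close>, where \<open>q = p ^ n\<close>.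
\<close>

lemma augmentation_power_invariant:
  assumes C: "comm_group C" "finite (carrier C)" and h: "h \<in> carrier C"
    and hq: "h [^]\<^bsub>C\<^esub> (p ^ n) = \<one>\<^bsub>C\<^esub>"
  shows "basis C h \<otimes>\<^bsub>ga C\<^esub> (basis C h \<ominus>\<^bsub>ga C\<^esub> \<one>\<^bsub>ga C\<^esub>) [^]\<^bsub>ga C\<^esub> (p ^ n - 1) =
    (basis C h \<ominus>\<^bsub>ga C\<^esub> \<one>\<^bsub>ga C\<^esub>) [^]\<^bsub>ga C\<^esub> (p ^ n - 1)"
proof -
  interpret C: comm_group C by fact
  have fC: "finite_group C" using C(2) by unfold_locales
  interpret A: cring "ga C" by (rule ga_cring[OF C])
  let ?x = "basis C h \<ominus>\<^bsub>ga C\<^esub> \<one>\<^bsub>ga C\<^esub>"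
  let ?y = "?x [^]\<^bsub>ga C\<^esub> (p ^ n - 1)"
  have e: "basis C h \<in> carrier (ga C)" by (rule basis_mem[OF fC])
  then have x: "?x \<in> carrier (ga C)" by simp
  let ?P = "push C C (\<lambda>x. x [^]\<^bsub>C\<^esub> (p ^ n))"
  have P: "?P \<in> ring_hom (ga C) (ga C)"
    by (rule push_ring_hom[OF fC fC]) (auto simp: hom_def C.nat_pow_distrib)
  have "p ^ n > 0" using prime prime_gt_0_nat by simp
  then have "?x \<otimes>\<^bsub>ga C\<^esub> ?y = ?x [^]\<^bsub>ga C\<^esub> (p ^ n)"
    using x by (metis A.nat_pow_Suc2 Suc_diff_1)
  also have "\<dots> = ?P ?x" by (rule ga_frobenius[OF C x])
  also have "\<dots> = ?P (basis C h) \<ominus>\<^bsub>ga C\<^esub> ?P \<one>\<^bsub>ga C\<^esub>"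
    by (rule ring_hom_diff[OF A.ring_axioms A.ring_axioms P e A.one_closed])
  also have "\<dots> = \<zero>\<^bsub>ga C\<^esub>"
    using e hq by (simp add: push_basis[OF fC fC h] ring_hom_one[OF P] ga_one[OF fC, symmetric] A.r_neg A.minus_eq)
  finally have "basis C h \<otimes>\<^bsub>ga C\<^esub> ?y \<ominus>\<^bsub>ga C\<^esub> ?y = \<zero>\<^bsub>ga C\<^esub>"
    using e x by (simp add: A.minus_eq A.l_distr A.l_minus)
  then show ?thesis using e x by (simp add: A.r_right_minus_eq)
qed

text \<open>
  As a polynomial in \<open>h\<close>, the power \<open>(h - 1)\<^sup>j\<close> is monic of degree \<open>j\<close>; below the order of \<open>h\<close> no
  two powers of \<open>h\<close> coincide.
\<close>

lemma augmentation_power_coeffs: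
  assumes C: "finite_group C" and h: "h \<in> carrier C" and j: "j < group.ord C h"
  shows "(\<forall>i<group.ord C h. j < i \<longrightarrow>
      ((basis C h \<ominus>\<^bsub>ga C\<^esub> \<one>\<^bsub>ga C\<^esub>) [^]\<^bsub>ga C\<^esub> j) (h [^]\<^bsub>C\<^esub> i) = \<zero>) \<and>
    ((basis C h \<ominus>\<^bsub>ga C\<^esub> \<one>\<^bsub>ga C\<^esub>) [^]\<^bsub>ga C\<^esub> j) (h [^]\<^bsub>C\<^esub> j) = \<one>"
  using j
proof (induction j)
  interpret C: finite_group C by fact
  interpret A: ring "ga C" by (rule ga_ring[OF C])
  let ?x = "basis C h \<ominus>\<^bsub>ga C\<^esub> \<one>\<^bsub>ga C\<^esub>"
  case 0
  have "h [^]\<^bsub>C\<^esub> i \<noteq> \<one>\<^bsub>C\<^esub>" if "0 < i" "i < C.ord h" for i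
    using that C.pow_eq_id[OF h] by (auto dest: dvd_imp_le)
  then show ?case using h by (simp add: ga_one[OF C] basis_apply[OF C])
next
  interpret C: finite_group C by fact
  interpret A: ring "ga C" by (rule ga_ring[OF C])
  let ?x = "basis C h \<ominus>\<^bsub>ga C\<^esub> \<one>\<^bsub>ga C\<^esub>"
  case (Suc j)
  let ?f = "?x [^]\<^bsub>ga C\<^esub> j"
  have e: "basis C h \<in> carrier (ga C)" by (rule basis_mem[OF C])
  then have f: "?f \<in> carrier (ga C)" by simp
  have step: "(?x [^]\<^bsub>ga C\<^esub> Suc j) (h [^]\<^bsub>C\<^esub> Suc i) = ?f (h [^]\<^bsub>C\<^esub> i) \<ominus> ?f (h [^]\<^bsub>C\<^esub> Suc i)" for i
  proof -
    have "?x [^]\<^bsub>ga C\<^esub> Suc j \<oplus>\<^bsub>ga C\<^esub> ?f = basis C h \<otimes>\<^bsub>ga C\<^esub> ?f"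
      using e f by (simp only: A.nat_pow_Suc2 A.minus_closed A.one_closed)
        (simp add: A.minus_eq A.l_distr A.l_minus A.a_assoc A.l_neg)
    then have "(?x [^]\<^bsub>ga C\<^esub> Suc j) (h [^]\<^bsub>C\<^esub> Suc i) \<oplus> ?f (h [^]\<^bsub>C\<^esub> Suc i) =
        (basis C h \<otimes>\<^bsub>ga C\<^esub> ?f) (h [^]\<^bsub>C\<^esub> Suc i)"
      using h by (metis ga_add_apply[OF C] C.nat_pow_closed)
    also have "\<dots> = ?f (inv\<^bsub>C\<^esub> h \<otimes>\<^bsub>C\<^esub> h [^]\<^bsub>C\<^esub> Suc i)"
      using h f by (intro mult_single_apply(2)[OF C]) auto
    also have "inv\<^bsub>C\<^esub> h \<otimes>\<^bsub>C\<^esub> h [^]\<^bsub>C\<^esub> Suc i = h [^]\<^bsub>C\<^esub> i"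
      using h by (simp only: C.nat_pow_Suc2) (simp add: C.m_assoc[symmetric])
    finally have *: "(?x [^]\<^bsub>ga C\<^esub> Suc j) (h [^]\<^bsub>C\<^esub> Suc i) \<oplus> ?f (h [^]\<^bsub>C\<^esub> Suc i) = ?f (h [^]\<^bsub>C\<^esub> i)" .
    have c: "(?x [^]\<^bsub>ga C\<^esub> Suc j) (h [^]\<^bsub>C\<^esub> Suc i) \<in> carrier K" "?f (h [^]\<^bsub>C\<^esub> Suc i) \<in> carrier K"
      using e h by (intro ga_mem_closed[OF C]; simp)+
    then show ?thesis unfolding *[symmetric] by (simp add: minus_eq a_assoc r_neg del: A.nat_pow_Suc C.nat_pow_Suc)
  qed
  have IH: "\<And>i. i < C.ord h \<Longrightarrow> j < i \<Longrightarrow> ?f (h [^]\<^bsub>C\<^esub> i) = \<zero>" "?f (h [^]\<^bsub>C\<^esub> j) = \<one>"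
    using Suc by auto
  show ?case
  proof (intro conjI allI impI)
    fix i assume "i < C.ord h" "Suc j < i"
    then obtain i' where "i = Suc i'" "j < i'" "i' < C.ord h" by (cases i) auto
    then show "(?x [^]\<^bsub>ga C\<^esub> Suc j) (h [^]\<^bsub>C\<^esub> i) = \<zero>"
      using step[of i'] IH(1)[of i'] IH(1)[of i] \<open>i < C.ord h\<close> by (simp add: minus_eq)
  next
    show "(?x [^]\<^bsub>ga C\<^esub> Suc j) (h [^]\<^bsub>C\<^esub> Suc j) = \<one>"
      using step[of j] IH(1)[of "Suc j"] IH(2) Suc.prems by (simp add: minus_eq)
  qed
qed

text \<open>
  An element \<open>w\<close> of augmentation 1 is \<open>1 + (a - 1)s\<close>, and the augmentation of \<open>s\<close> is the linear
  coefficient of \<open>w\<close>, hence 1. So \<open>s\<close> is a unit with \<open>s\<^sup>q = 1\<close>, and \<open>(w - 1) ^ (q - 1)\<close> differs from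
  \<open>(a - 1) ^ (q - 1) \<noteq> 0\<close> by a unit.
\<close>

lemma augmentation_power_nonzero:
  assumes C: "comm_group C" "finite (carrier C)"
    and a: "carrier C = generate C {a}" "a \<in> carrier C" "group.ord C a = p ^ n"
    and \<tau>: "\<tau> \<in> hom C (add_monoid K)" "\<tau> a = \<one>"
    and w: "w \<in> carrier (ga C)" "lin C (\<lambda>_. \<one>) w = \<one>" "lin C \<tau> w = \<one>"
  shows "(w \<ominus>\<^bsub>ga C\<^esub> \<one>\<^bsub>ga C\<^esub>) [^]\<^bsub>ga C\<^esub> (p ^ n - 1) \<noteq> \<zero>\<^bsub>ga C\<^esub>"
proof -
  interpret C: comm_group C by fact
  have fC: "finite_group C" using C(2) by unfold_locales
  interpret A: cring "ga C" by (rule ga_cring[OF C])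
  note t = hom_KD[OF C.is_group \<tau>(1)]
  have \<tau>K: "\<tau> \<in> carrier C \<rightarrow> carrier K" and oneK: "(\<lambda>_. \<one>) \<in> carrier C \<rightarrow> carrier K"
    using t by auto
  note [simp] = basis_mem[OF fC]
  let ?x = "basis C a \<ominus>\<^bsub>ga C\<^esub> \<one>\<^bsub>ga C\<^esub>"
  let ?E = "push C C (\<lambda>_. \<one>\<^bsub>C\<^esub>)"
  let ?aug = "lin C (\<lambda>_. \<one>)"
  note aug = lin_additive[OF fC oneK] and lt = lin_additive[OF fC \<tau>K] and E = push_additive[OF fC fC, of "\<lambda>_. \<one>\<^bsub>C\<^esub>"]
  have x: "?x \<in> carrier (ga C)" by simp
  (* Division of f minus its augmentation by a - 1, together with the augmentation of the quotient. *)
  have "\<exists>s\<in>carrier (ga C). f = ?E f \<oplus>\<^bsub>ga C\<^esub> ?x \<otimes>\<^bsub>ga C\<^esub> s \<and> ?aug s = lin C \<tau> f"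
    if f: "f \<in> carrier (ga C)" for f
    using fC f
  proof (induction f rule: ga_induct)
    case zero
    show ?case
      by (rule bexI[of _ "\<zero>\<^bsub>ga C\<^esub>"]) (use x in \<open>auto simp: additive_zero[OF fC abelian_group_axioms aug]
        additive_zero[OF fC abelian_group_axioms lt] additive_zero[OF fC A.abelian_group_axioms E]\<close>)
  next
    case (add f h)
    then obtain s t where s: "s \<in> carrier (ga C)" "f = ?E f \<oplus>\<^bsub>ga C\<^esub> ?x \<otimes>\<^bsub>ga C\<^esub> s" "?aug s = lin C \<tau> f"
      and t: "t \<in> carrier (ga C)" "h = ?E h \<oplus>\<^bsub>ga C\<^esub> ?x \<otimes>\<^bsub>ga C\<^esub> t" "?aug t = lin C \<tau> h" by blast
    have Ec: "?E f \<in> carrier (ga C)" "?E h \<in> carrier (ga C)"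
      using add additive_closed[OF E] by auto
    have "f \<oplus>\<^bsub>ga C\<^esub> h = (?E f \<oplus>\<^bsub>ga C\<^esub> ?x \<otimes>\<^bsub>ga C\<^esub> s) \<oplus>\<^bsub>ga C\<^esub> (?E h \<oplus>\<^bsub>ga C\<^esub> ?x \<otimes>\<^bsub>ga C\<^esub> t)"
      using s(2) t(2) by simp
    also have "\<dots> = (?E f \<oplus>\<^bsub>ga C\<^esub> ?E h) \<oplus>\<^bsub>ga C\<^esub> (?x \<otimes>\<^bsub>ga C\<^esub> s \<oplus>\<^bsub>ga C\<^esub> ?x \<otimes>\<^bsub>ga C\<^esub> t)"
      using Ec s(1) t(1) A.m_closed[OF x] by (simp add: A.a_ac del: A.minus_closed)
    also have "\<dots> = ?E (f \<oplus>\<^bsub>ga C\<^esub> h) \<oplus>\<^bsub>ga C\<^esub> ?x \<otimes>\<^bsub>ga C\<^esub> (s \<oplus>\<^bsub>ga C\<^esub> t)"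
      using A.r_distr[OF s(1) t(1) x] additive_add[OF E add(1,2)] by simp
    finally show ?case
      using s t add by (intro bexI[of _ "s \<oplus>\<^bsub>ga C\<^esub> t"]) (auto simp: additive_add[OF aug] additive_add[OF lt])
  next
    case (single c)
    then obtain i :: nat where i: "c = a [^]\<^bsub>C\<^esub> i"
      unfolding a(1) C.generate_pow_on_finite_carrier[OF C(2) a(2)] by blast
    have "\<exists>s\<in>carrier (ga C). basis C (a [^]\<^bsub>C\<^esub> i) = \<one>\<^bsub>ga C\<^esub> \<oplus>\<^bsub>ga C\<^esub> ?x \<otimes>\<^bsub>ga C\<^esub> s \<and> ?aug s = \<tau> (a [^]\<^bsub>C\<^esub> i)"
    proof (induction i)
      case 0
      show ?case
        by (rule bexI[of _ "\<zero>\<^bsub>ga C\<^esub>"]) (use x t(3) in \<open>auto simp: additive_zero[OF fC abelian_group_axioms aug]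
          ga_one[OF fC]\<close>)
    next
      case (Suc i)
      then obtain s where s: "s \<in> carrier (ga C)" "basis C (a [^]\<^bsub>C\<^esub> i) = \<one>\<^bsub>ga C\<^esub> \<oplus>\<^bsub>ga C\<^esub> ?x \<otimes>\<^bsub>ga C\<^esub> s"
        "?aug s = \<tau> (a [^]\<^bsub>C\<^esub> i)" by blast
      have ai: "a [^]\<^bsub>C\<^esub> i \<in> carrier C" using a(2) by simp
      have e1: "basis C a = \<one>\<^bsub>ga C\<^esub> \<oplus>\<^bsub>ga C\<^esub> ?x"
        by (simp add: A.minus_eq A.a_lcomm[of "\<one>\<^bsub>ga C\<^esub>"] A.r_neg)
      have "basis C (a [^]\<^bsub>C\<^esub> Suc i) = basis C (a [^]\<^bsub>C\<^esub> i) \<otimes>\<^bsub>ga C\<^esub> basis C a"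
        using a(2) by (simp add: basis_mult[OF fC])
      also have "\<dots> = basis C (a [^]\<^bsub>C\<^esub> i) \<otimes>\<^bsub>ga C\<^esub> \<one>\<^bsub>ga C\<^esub> \<oplus>\<^bsub>ga C\<^esub> basis C (a [^]\<^bsub>C\<^esub> i) \<otimes>\<^bsub>ga C\<^esub> ?x"
        by (subst e1) (simp only: A.r_distr A.one_closed x basis_mem[OF fC])
      also have "\<dots> = \<one>\<^bsub>ga C\<^esub> \<oplus>\<^bsub>ga C\<^esub> ?x \<otimes>\<^bsub>ga C\<^esub> s \<oplus>\<^bsub>ga C\<^esub> ?x \<otimes>\<^bsub>ga C\<^esub> basis C (a [^]\<^bsub>C\<^esub> i)"
        using A.m_comm[OF basis_mem[OF fC] x] s(2) A.r_one[OF basis_mem[OF fC]] by metis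
      also have "\<dots> = \<one>\<^bsub>ga C\<^esub> \<oplus>\<^bsub>ga C\<^esub> ?x \<otimes>\<^bsub>ga C\<^esub> (s \<oplus>\<^bsub>ga C\<^esub> basis C (a [^]\<^bsub>C\<^esub> i))"
        using A.r_distr[OF s(1) basis_mem[OF fC] x] A.m_closed[OF x s(1)] A.m_closed[OF x basis_mem[OF fC]]
        by (simp add: A.a_assoc del: A.minus_closed)
      finally show ?case
        using s(1,3) t(2)[OF ai a(2)] \<tau>(2)
        by (intro bexI[of _ "s \<oplus>\<^bsub>ga C\<^esub> basis C (a [^]\<^bsub>C\<^esub> i)"])
          (auto simp: additive_add[OF aug] lin_basis[OF fC oneK ai])
    qed
    then show ?case using i single
      by (simp add: push_basis[OF fC fC] ga_one[OF fC] lin_basis[OF fC \<tau>K])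
  qed
  then obtain s where s: "s \<in> carrier (ga C)" "w = ?E w \<oplus>\<^bsub>ga C\<^esub> ?x \<otimes>\<^bsub>ga C\<^esub> s" "?aug s = \<one>"
    using w by metis
  have "?E w = \<one>\<^bsub>ga C\<^esub>" using push_trivial[OF fC fC _ w(1,2)] by simp
  then have w1: "w \<ominus>\<^bsub>ga C\<^esub> \<one>\<^bsub>ga C\<^esub> = ?x \<otimes>\<^bsub>ga C\<^esub> s"
    using s A.m_closed[OF x s(1)] A.a_comm[of "\<one>\<^bsub>ga C\<^esub>"]
    by (metis A.add.inv_solve_right' A.minus_eq A.one_closed A.add.m_closed)
  have ord: "c [^]\<^bsub>C\<^esub> (p ^ n) = \<one>\<^bsub>C\<^esub>" if c: "c \<in> carrier C" for c
  proof -
    obtain i :: nat where "c = a [^]\<^bsub>C\<^esub> i"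
      using c unfolding a(1) C.generate_pow_on_finite_carrier[OF C(2) a(2)] by blast
    then show ?thesis using a(2,3) C.pow_eq_id[OF a(2)] by (simp add: C.nat_pow_pow)
  qed
  have sq: "s [^]\<^bsub>ga C\<^esub> (p ^ n) = \<one>\<^bsub>ga C\<^esub>"
    unfolding ga_frobenius[OF C s(1)] by (rule push_trivial[OF fC fC ord s(1,3)])
  show ?thesis
  proof
    assume z: "(w \<ominus>\<^bsub>ga C\<^esub> \<one>\<^bsub>ga C\<^esub>) [^]\<^bsub>ga C\<^esub> (p ^ n - 1) = \<zero>\<^bsub>ga C\<^esub>"
    let ?xq = "?x [^]\<^bsub>ga C\<^esub> (p ^ n - 1)"
    have xq: "?xq \<in> carrier (ga C)" using x by (rule A.nat_pow_closed)
    have pn: "p ^ n > 0" using prime prime_gt_0_nat by simp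
    have "?xq = ?xq \<otimes>\<^bsub>ga C\<^esub> s [^]\<^bsub>ga C\<^esub> (p ^ n)" using sq xq by simp
    also have "s [^]\<^bsub>ga C\<^esub> (p ^ n) = s [^]\<^bsub>ga C\<^esub> (p ^ n - 1) \<otimes>\<^bsub>ga C\<^esub> s"
      using pn by (metis A.nat_pow_Suc Suc_diff_1)
    also have "?xq \<otimes>\<^bsub>ga C\<^esub> (s [^]\<^bsub>ga C\<^esub> (p ^ n - 1) \<otimes>\<^bsub>ga C\<^esub> s) = (?x \<otimes>\<^bsub>ga C\<^esub> s) [^]\<^bsub>ga C\<^esub> (p ^ n - 1) \<otimes>\<^bsub>ga C\<^esub> s"
      using x s(1) xq by (simp add: A.m_assoc A.nat_pow_distrib del: A.minus_closed)
    also have "\<dots> = \<zero>\<^bsub>ga C\<^esub>" using z s(1) unfolding w1 by simp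
    finally have "?xq = \<zero>\<^bsub>ga C\<^esub>" .
    moreover have "?xq (a [^]\<^bsub>C\<^esub> (p ^ n - 1)) = \<one>"
      using augmentation_power_coeffs[OF fC a(2), of "p ^ n - 1"] a(3) pn by simp
    ultimately show False using a(2) by (simp add: ga_zero[OF fC])
  qed
qed

end

section \<open>Tensor products and fixed vectors\<close>

lemma cyclic_groups_iso:
  assumes G: "finite_group G" and a: "a \<in> carrier G" and H: "finite_group H" and h: "h \<in> carrier H"
    and ord: "group.ord G a = group.ord H h"
  shows "G \<restriction> generate G {a} \<cong> H \<restriction> generate H {h}"
proof -
  interpret G: finite_group G by fact
  interpret H: finite_group H by fact
  have CG: "generate G {a} = {a [^]\<^bsub>G\<^esub> k | k. k \<in> (UNIV::nat set)}"
    by (rule G.generate_pow_on_finite_carrier[OF G.finite_carrier a])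
  have CH: "generate H {h} = {h [^]\<^bsub>H\<^esub> k | k. k \<in> (UNIV::nat set)}"
    by (rule H.generate_pow_on_finite_carrier[OF H.finite_carrier h])
  have eq: "a [^]\<^bsub>G\<^esub> i = a [^]\<^bsub>G\<^esub> j \<longleftrightarrow> h [^]\<^bsub>H\<^esub> i = h [^]\<^bsub>H\<^esub> j" for i j :: nat
    using G.int_pow_eq[OF a, of "int i" "int j"] H.int_pow_eq[OF h, of "int i" "int j"]
    unfolding int_pow_int ord by blast
  define f where "f c = h [^]\<^bsub>H\<^esub> (SOME k::nat. c = a [^]\<^bsub>G\<^esub> k)" for c
  have f: "f (a [^]\<^bsub>G\<^esub> i) = h [^]\<^bsub>H\<^esub> i" for i :: nat
    unfolding f_def by (rule someI2[of _ i]) (simp_all add: eq)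
  have "f \<in> iso (G \<restriction> generate G {a}) (H \<restriction> generate H {h})"
    unfolding iso_def
  proof (intro CollectI conjI homI)
    fix c d assume "c \<in> carrier (G \<restriction> generate G {a})"
      "d \<in> carrier (G \<restriction> generate G {a})"
    then obtain i j :: nat where ij: "c = a [^]\<^bsub>G\<^esub> i" "d = a [^]\<^bsub>G\<^esub> j" using CG by auto
    show "f c \<in> carrier (H \<restriction> generate H {h})" using f ij CH by auto
    show "f (c \<otimes>\<^bsub>G \<restriction> generate G {a}\<^esub> d) = f c \<otimes>\<^bsub>H \<restriction> generate H {h}\<^esub> f d"
      using f[of "i + j"] f[of i] f[of j] a h by (simp add: ij G.nat_pow_mult H.nat_pow_mult)
  next
    show "bij_betw f (carrier (G \<restriction> generate G {a})) (carrier (H \<restriction> generate H {h}))"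
      unfolding bij_betw_def
    proof
      show "inj_on f (carrier (G \<restriction> generate G {a}))"
        by (rule inj_onI) (auto simp: CG f eq)
      show "f ` carrier (G \<restriction> generate G {a}) = carrier (H \<restriction> generate H {h})"
        by (simp add: CG CH full_SetCompr_eq image_image f)
    qed
  qed
  then show ?thesis by (rule is_isoI)
qed

lemma internal_direct_product_iso:
  assumes G: "group G" and H: "group H"
    and A: "internal_direct_product G A N" and B: "internal_direct_product H B M"
    and \<psi>: "G \<restriction> A \<cong> H \<restriction> B" and \<chi>: "G \<restriction> N \<cong> H \<restriction> M"
  shows "G \<cong> H"
proof -
  interpret G: group G by fact
  interpret H: group H by fact
  have gA: "group (G \<restriction> A)" and gN: "group (G \<restriction> N)"
    using A G.subgroup_imp_group unfolding G.internal_direct_product_iff by auto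
  have "G \<restriction> A \<times>\<times> G \<restriction> N \<cong> G"
    using G.internal_direct_product_DirProd_iso[OF A] by (rule is_isoI)
  then have "G \<cong> G \<restriction> A \<times>\<times> G \<restriction> N"
    using group.iso_sym[OF DirProd_group[OF gA gN]] by blast
  also have "\<dots> \<cong> H \<restriction> B \<times>\<times> H \<restriction> M"
    using group.DirProd_iso_trans[OF gA \<psi> \<chi>] .
  also have "\<dots> \<cong> H"
    using H.internal_direct_product_DirProd_iso[OF B] by (rule is_isoI)
  finally show ?thesis .
qed

context prime_field
begin

text \<open>
  On products \<open>an\<close> the functional \<open>F\<close> is \<open>F1(a) F2(n)\<close>: the tensor product of two functionals.
\<close>

lemma lin_tensor:
  assumes G: "finite_group G" and idp: "internal_direct_product G A N"
    and W: "W \<in> carrier (ga (G \<restriction> A))" and f: "f \<in> carrier (ga (G \<restriction> N))"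
    and F1: "F1 \<in> A \<rightarrow> carrier K" and F2: "F2 \<in> N \<rightarrow> carrier K"
  shows "\<exists>F. F \<in> carrier G \<rightarrow> carrier K \<and>
    lin G F (incl A G W \<otimes>\<^bsub>ga G\<^esub> incl N G f) =
      lin (G \<restriction> A) F1 W \<otimes> lin (G \<restriction> N) F2 f"
proof -
  interpret G: finite_group G by fact
  interpret R: ring "ga G" by (rule ga_ring[OF G])
  obtain \<alpha> \<nu> where h: "\<alpha> \<in> hom G (G \<restriction> A)" "\<nu> \<in> hom G (G \<restriction> N)"
    and s: "\<And>g. g \<in> carrier G \<Longrightarrow> g = \<alpha> g \<otimes>\<^bsub>G\<^esub> \<nu> g"
    and v: "\<And>a. a \<in> A \<Longrightarrow> \<alpha> a = a" "\<And>a. a \<in> A \<Longrightarrow> \<nu> a = \<one>\<^bsub>G\<^esub>"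
      "\<And>n. n \<in> N \<Longrightarrow> \<alpha> n = \<one>\<^bsub>G\<^esub>" "\<And>n. n \<in> N \<Longrightarrow> \<nu> n = n"
    by (rule G.internal_direct_product_projections[OF idp], rule that)
  have sub: "subgroup A G" "subgroup N G" using idp unfolding G.internal_direct_product_iff by auto
  have fin: "finite_group (G \<restriction> A)" "finite_group (G \<restriction> N)"
    using finite_group_subgroup[OF G] sub by auto
  note iA = ring_hom_additive[OF incl_ring_hom[OF G sub(1)]]
  note iN = ring_hom_additive[OF incl_ring_hom[OF G sub(2)]]
  let ?F = "\<lambda>g. F1 (\<alpha> g) \<otimes> F2 (\<nu> g)"
  have F: "?F \<in> carrier G \<rightarrow> carrier K"
    using F1 F2 hom_in_carrier[OF h(1)] hom_in_carrier[OF h(2)] by (auto simp: Pi_iff)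
  have F1': "F1 \<in> carrier (G \<restriction> A) \<rightarrow> carrier K" and F2': "F2 \<in> carrier (G \<restriction> N) \<rightarrow> carrier K"
    using F1 F2 by auto
  note L = lin_additive[OF G F] and LA = lin_additive[OF fin(1) F1'] and LN = lin_additive[OF fin(2) F2']
  note zeros = additive_zero[OF G abelian_group_axioms L]
    additive_zero[OF fin(1) abelian_group_axioms LA] additive_zero[OF fin(2) abelian_group_axioms LN]
    additive_zero[OF fin(1) R.abelian_group_axioms iA] additive_zero[OF fin(2) R.abelian_group_axioms iN]
  note closed = additive_closed[OF L] additive_closed[OF LA] additive_closed[OF LN] additive_closed[OF iA] additive_closed[OF iN]
  note adds = additive_add[OF L] additive_add[OF LA] additive_add[OF LN] additive_add[OF iA] additive_add[OF iN]
  have "lin G ?F (incl A G W \<otimes>\<^bsub>ga G\<^esub> incl N G f) =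
      lin (G \<restriction> A) F1 W \<otimes> lin (G \<restriction> N) F2 f"
    using fin(1) W
  proof (induction W rule: ga_induct)
    case zero
    then show ?case using f by (simp add: zeros closed)
  next
    case (add W W')
    then show ?case using f by (simp add: closed adds R.l_distr l_distr)
  next
    case (single a)
    then have a: "a \<in> A" by simp
    show ?case using fin(2) f
    proof (induction f rule: ga_induct)
      case zero
      then show ?case by (simp add: zeros closed basis_mem[OF fin(1)])
    next
      case (add f f')
      then show ?case by (simp add: closed adds R.r_distr r_distr basis_mem[OF fin(1)])
    next
      case (single n)
      then have n: "n \<in> N" by simp
      have aG: "a \<in> carrier G" "n \<in> carrier G" using a n subgroup.mem_carrier sub by metis+
      have c: "F1 a \<in> carrier K" "F2 n \<in> carrier K" using F1 F2 a n by auto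
      have "\<alpha> (a \<otimes>\<^bsub>G\<^esub> n) = a" "\<nu> (a \<otimes>\<^bsub>G\<^esub> n) = n"
        using hom_mult[OF h(1) aG] hom_mult[OF h(2) aG] v a n aG by auto
      then show ?case using a n aG
        by (simp add: incl_basis[OF G sub(1)] incl_basis[OF G sub(2)] basis_mult[OF G]
            lin_basis[OF G F] lin_basis[OF fin(1) F1'] lin_basis[OF fin(2) F2'])
    qed
  qed
  then show ?thesis using F by blast
qed

text \<open>
  A pure tensor of non-zero vectors is not zero, since a tensor product of functionals detects it.
\<close>

lemma tensor_nonzero:
  assumes G: "finite_group G" and idp: "internal_direct_product G A N"
    and W: "W \<in> carrier (ga (G \<restriction> A))" and f: "f \<in> carrier (ga (G \<restriction> N))"
    and eq: "incl A G W \<otimes>\<^bsub>ga G\<^esub> incl N G f = \<zero>\<^bsub>ga G\<^esub>" and f0: "f \<noteq> \<zero>\<^bsub>ga (G \<restriction> N)\<^esub>"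
  shows "W = \<zero>\<^bsub>ga (G \<restriction> A)\<^esub>"
proof (rule ccontr)
  assume W0: "W \<noteq> \<zero>\<^bsub>ga (G \<restriction> A)\<^esub>"
  interpret G: finite_group G by fact
  have sub: "subgroup A G" "subgroup N G" using idp unfolding G.internal_direct_product_iff by auto
  have detect: "\<exists>F\<in>S \<rightarrow> carrier K. lin (G \<restriction> S) F g \<noteq> \<zero>"
    if S: "subgroup S G" and g: "g \<in> carrier (ga (G \<restriction> S))" and g0: "g \<noteq> \<zero>\<^bsub>ga (G \<restriction> S)\<^esub>" for S g
  proof (rule ccontr)
    assume *: "\<not> ?thesis"
    have fS: "finite_group (G \<restriction> S)" by (rule finite_group_subgroup[OF G S])
    interpret A: ring "ga (G \<restriction> S)" by (rule ga_ring[OF fS])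
    have "g = \<zero>\<^bsub>ga (G \<restriction> S)\<^esub>"
    proof (rule ga_eq_linI[OF fS g A.zero_closed])
      fix F assume F: "F \<in> carrier (G \<restriction> S) \<rightarrow> carrier K"
      then have "lin (G \<restriction> S) F g = \<zero>" using * by auto
      then show "lin (G \<restriction> S) F g = lin (G \<restriction> S) F \<zero>\<^bsub>ga (G \<restriction> S)\<^esub>"
        using additive_zero[OF fS abelian_group_axioms lin_additive[OF fS F]] by simp
    qed
    then show False using g0 by blast
  qed
  obtain F1 F2 where F1: "F1 \<in> A \<rightarrow> carrier K" "lin (G \<restriction> A) F1 W \<noteq> \<zero>"
    and F2: "F2 \<in> N \<rightarrow> carrier K" "lin (G \<restriction> N) F2 f \<noteq> \<zero>"
    using detect[OF sub(1) W W0] detect[OF sub(2) f f0] by blast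
  obtain F where F: "F \<in> carrier G \<rightarrow> carrier K" and
    "lin G F \<zero>\<^bsub>ga G\<^esub> = lin (G \<restriction> A) F1 W \<otimes> lin (G \<restriction> N) F2 f"
    using lin_tensor[OF G idp W f F1(1) F2(1)] unfolding eq by blast
  moreover have "lin G F \<zero>\<^bsub>ga G\<^esub> = \<zero>"
    by (rule additive_zero[OF G abelian_group_axioms lin_additive[OF G F]])
  moreover have "lin (G \<restriction> A) F1 W \<in> carrier K" "lin (G \<restriction> N) F2 f \<in> carrier K"
    using additive_closed[OF lin_additive[OF finite_group_subgroup[OF G sub(1)], of F1] W]
      additive_closed[OF lin_additive[OF finite_group_subgroup[OF G sub(2)], of F2] f] F1 F2 by auto
  ultimately show False using F1(2) F2(2) integral by metis
qed

lemma additive_factor_push: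
  assumes G: "finite_group G" and A: "subgroup A G"
    and \<alpha>: "\<alpha> \<in> hom G (G \<restriction> A)" and T: "additive G (ga G) T"
    and eq: "\<And>g. g \<in> carrier G \<Longrightarrow> T (basis G g) = T (basis G (\<alpha> g))"
    and x: "x \<in> carrier (ga G)"
  shows "T x = T (incl A G (push G (G \<restriction> A) \<alpha> x))"
proof (rule additive_eqI[OF G ga_abelian_group[OF G] T _ _ x])
  have fA: "finite_group (G \<restriction> A)" by (rule finite_group_subgroup[OF G A])
  show "additive G (ga G) (\<lambda>x. T (incl A G (push G (G \<restriction> A) \<alpha> x)))"
    by (rule additive_comp[OF additive_comp[OF push_additive[OF G fA] push_additive[OF fA G]] T])
  show "T (basis G g) = T (incl A G (push G (G \<restriction> A) \<alpha> (basis G g)))"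
    if "g \<in> carrier G" for g
    using eq[OF that] hom_in_carrier[OF \<alpha> that]
    by (simp add: push_basis[OF G fA that] incl_basis[OF G A])
qed

text \<open>
  The kernel is a finite vector space over \<open>k\<close> on which the \<open>p\<close>-group acts by left multiplication.
  It has the fixed point 0, and if it is not zero its number of elements is divisible by \<open>p\<close>.
\<close>

lemma kernel_fixed_vector:
  assumes Q: "finite_p_group p Q" and R: "ring R" and \<Psi>: "\<Psi> \<in> ring_hom (ga Q) R"
    and f: "f \<in> carrier (ga Q)" "\<Psi> f = \<zero>\<^bsub>R\<^esub>" "f \<noteq> \<zero>\<^bsub>ga Q\<^esub>"
  shows "\<exists>g\<in>carrier (ga Q). g \<noteq> \<zero>\<^bsub>ga Q\<^esub> \<and> \<Psi> g = \<zero>\<^bsub>R\<^esub> \<and>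
    (\<forall>m\<in>carrier Q. basis Q m \<otimes>\<^bsub>ga Q\<^esub> g = g)"
proof -
  have fQ: "finite_group Q" by (rule finite_p_groupD[OF Q])
  interpret Q: finite_group Q by (rule fQ)
  interpret A: ring "ga Q" by (rule ga_ring[OF fQ])
  interpret R: ring R by fact
  interpret h: group_hom "add_monoid (ga Q)" "add_monoid R" \<Psi>
    using ring_hom_additive[OF \<Psi>] A.a_group R.a_group by (simp add: group_hom_def group_hom_axioms_def)
  let ?L = "{g \<in> carrier (ga Q). \<Psi> g = \<zero>\<^bsub>R\<^esub>}"
  have L: "?L = kernel (add_monoid (ga Q)) (add_monoid R) \<Psi>" by (simp add: kernel_def)
  have "card ?L dvd order (add_monoid (ga Q))"
    using group.lagrange[OF A.a_group h.subgroup_kernel] unfolding L by (metis dvd_triv_right)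
  then have "card ?L dvd p ^ order Q" using ga_card[OF fQ] by (simp add: order_def)
  then obtain j where j: "card ?L = p ^ j" using prime divides_primepow_nat by blast
  have finL: "finite ?L" using ga_finite[OF fQ] by simp
  have z: "\<Psi> \<zero>\<^bsub>ga Q\<^esub> = \<zero>\<^bsub>R\<^esub>" using h.hom_one by simp
  have "card ?L \<noteq> 1"
  proof
    assume "card ?L = 1"
    then obtain l where "?L = {l}" by (rule card_1_singletonE)
    then show False using f z by (metis (mono_tags, lifting) A.zero_closed mem_Collect_eq singletonD)
  qed
  then have pL: "p dvd card ?L" using j by (cases j) auto
  obtain n where n: "order Q = p ^ n" using finite_p_groupD[OF Q] by blast
  let ?act = "\<lambda>m. \<lambda>g\<in>?L. basis Q m \<otimes>\<^bsub>ga Q\<^esub> g"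
  have act: "group_action Q ?L ?act"
  proof (rule group_actionI[OF Q.is_group])
    fix m k g assume m: "m \<in> carrier Q" and k: "k \<in> carrier Q" and g: "g \<in> ?L"
    show "basis Q m \<otimes>\<^bsub>ga Q\<^esub> g \<in> ?L"
      using g ring_hom_mult[OF \<Psi> basis_mem[OF fQ]] ring_hom_closed[OF \<Psi> basis_mem[OF fQ]] basis_mem[OF fQ]
      by simp
    show "basis Q (m \<otimes>\<^bsub>Q\<^esub> k) \<otimes>\<^bsub>ga Q\<^esub> g = basis Q m \<otimes>\<^bsub>ga Q\<^esub> (basis Q k \<otimes>\<^bsub>ga Q\<^esub> g)"
      using g m k by (simp add: basis_mult[OF fQ, symmetric] A.m_assoc basis_mem[OF fQ])
  qed (use A.l_one in \<open>simp add: ga_one[OF fQ]\<close>)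
  have "\<exists>y\<in>?L. y \<noteq> \<zero>\<^bsub>ga Q\<^esub> \<and> (\<forall>g\<in>carrier Q. ?act g y = y)"
    by (rule second_fixed_point[OF act n finL pL]) (use z basis_mem[OF fQ] in auto)
  then show ?thesis by auto
qed

end

section \<open>Cancelling a cyclic direct factor\<close>

lemma cyclic_comm_group:
  assumes G: "finite_group G" and a: "a \<in> carrier G"
  shows "comm_group (G \<restriction> generate G {a})"
proof -
  interpret G: finite_group G by fact
  have sub: "subgroup (generate G {a}) G" using a by (intro G.generate_is_subgroup) simp
  show ?thesis
  proof (rule group.group_comm_groupI[OF G.subgroup_imp_group[OF sub]]; simp)
    fix x y assume "x \<in> generate G {a}" "y \<in> generate G {a}"
    then obtain i j :: nat where "x = a [^]\<^bsub>G\<^esub> i" "y = a [^]\<^bsub>G\<^esub> j"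
      unfolding G.generate_pow_on_finite_carrier[OF G.finite_carrier a] by blast
    then show "x \<otimes>\<^bsub>G\<^esub> y = y \<otimes>\<^bsub>G\<^esub> x" using a by (simp add: G.nat_pow_mult add.commute)
  qed
qed

lemma (in group) ord_subgroup:
  assumes S: "subgroup S G" and x: "x \<in> S"
  shows "group.ord (G \<restriction> S) x = ord x"
proof -
  have xG: "x \<in> carrier G" using subgroup.mem_carrier[OF S x] .
  have "(x [^]\<^bsub>G \<restriction> S\<^esub> n = \<one>\<^bsub>G \<restriction> S\<^esub>) = (ord x dvd n)" for n :: nat
    using pow_eq_id[OF xG, of n] by (simp add: nat_pow_consistent[symmetric])
  then show ?thesis using group.ord_unique[OF subgroup_imp_group[OF S], of x "ord x"] x by simp
qed

text \<open>
  A direct factor \<open>C\<close> of \<open>A\<close> splits off from \<open>G\<close>. The complement is written with \<open>N\<close> on the left,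
  since \<open>N\<close> is normal and thus \<open>N <#> D\<close> is a subgroup.
\<close>

lemma (in group) internal_direct_product_assoc:
  assumes AN: "internal_direct_product G A N" and CD: "internal_direct_product (G \<restriction> A) C D"
  shows "internal_direct_product G C (N <#> D)"
    and "internal_direct_product (G \<restriction> (N <#> D)) D N"
    and "subgroup (N <#> D) G"
proof -
  note r = AN[unfolded internal_direct_product_iff]
  have sA: "subgroup A G" and sN: "subgroup N G" using r by auto
  interpret A: subgroup A G by (rule sA)
  interpret N: subgroup N G by (rule sN)
  interpret GA: group "G \<restriction> A" by (rule subgroup_imp_group[OF sA])
  note s = CD[unfolded GA.internal_direct_product_iff, simplified]
  have sC: "subgroup C G" and sD: "subgroup D G"
    using incl_subgroup[OF sA] s by auto
  interpret C: subgroup C G by (rule sC)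
  interpret D: subgroup D G by (rule sD)
  have CA: "C \<subseteq> A" and DA: "D \<subseteq> A" using s subgroup.subset by force+
  have com: "a \<otimes> n = n \<otimes> a" if "a \<in> A" "n \<in> N" for a n using r that by blast
  have comCD: "c \<otimes> d = d \<otimes> c" if "c \<in> C" "d \<in> D" for c d using s that by blast
  have nN: "N \<lhd> G" using AN by (simp add: internal_direct_product_def)
  show sND: "subgroup (N <#> D) G" by (rule mult_norm_subgroup[OF nN sD])
  show "internal_direct_product G C (N <#> D)"
    unfolding internal_direct_product_iff
  proof (intro conjI sC sND ballI)
    fix c x assume c: "c \<in> C" and "x \<in> N <#> D"
    then obtain n d where nd: "n \<in> N" "d \<in> D" "x = n \<otimes> d" unfolding set_mult_def by blast
    have "c \<otimes> (n \<otimes> d) = (c \<otimes> n) \<otimes> d" using c nd by (simp add: m_assoc)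
    also have "c \<otimes> n = n \<otimes> c" using com c nd CA by blast
    also have "n \<otimes> c \<otimes> d = n \<otimes> (c \<otimes> d)" using c nd by (simp add: m_assoc)
    also have "\<dots> = n \<otimes> d \<otimes> c" using comCD[OF c nd(2)] c nd by (simp add: m_assoc)
    finally show "c \<otimes> x = x \<otimes> c" using nd by simp
  next
    have "c = \<one>" if c: "c \<in> C" "c \<in> N <#> D" for c
    proof -
      obtain n d where nd: "n \<in> N" "d \<in> D" "c = n \<otimes> d" using c unfolding set_mult_def by blast
      have "n = c \<otimes> inv d" using nd by (simp add: m_assoc)
      moreover have "c \<otimes> inv d \<in> A" using c nd CA DA by auto
      ultimately have "n \<in> A \<inter> N" using nd by simp
      then have "n = \<one>" using r by blast
      then have "c \<in> C \<inter> D" using nd c by simp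
      then show ?thesis using s by blast
    qed
    then show "C \<inter> (N <#> D) = {\<one>}" using subgroup.one_closed[OF sND] C.one_closed by blast
  next
    fix g assume "g \<in> carrier G"
    then obtain a n where an: "a \<in> A" "n \<in> N" "g = a \<otimes> n" using r by blast
    then obtain c d where cd: "c \<in> C" "d \<in> D" "a = c \<otimes> d" using s by blast
    have "g = c \<otimes> (d \<otimes> n)" using an cd by (simp add: m_assoc)
    also have "d \<otimes> n = n \<otimes> d" using com cd an DA by blast
    finally show "\<exists>a\<in>C. \<exists>n\<in>N <#> D. g = a \<otimes> n" using cd an unfolding set_mult_def by blast
  qed
  interpret ND: group "G \<restriction> (N <#> D)" by (rule subgroup_imp_group[OF sND])
  have sub: "N \<subseteq> N <#> D" "D \<subseteq> N <#> D" using subset_set_mult[OF sN sD] by auto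
  show "internal_direct_product (G \<restriction> (N <#> D)) D N"
    unfolding ND.internal_direct_product_iff
  proof (intro conjI ballI; simp?)
    show "subgroup D (G \<restriction> (N <#> D))" by (rule subgroup_incl[OF sD sND sub(2)])
    show "subgroup N (G \<restriction> (N <#> D))" by (rule subgroup_incl[OF sN sND sub(1)])
    show "a \<otimes> n = n \<otimes> a" if "a \<in> D" "n \<in> N" for a n using com that DA by blast
    have "D \<inter> N \<subseteq> A \<inter> N" using DA by blast
    then show "D \<inter> N = {\<one>}" using r D.one_closed N.one_closed by blast
    fix g assume "g \<in> N <#> D"
    then obtain n d where nd: "n \<in> N" "d \<in> D" "g = n \<otimes> d" unfolding set_mult_def by blast
    then have "g = d \<otimes> n" using com[of d n] DA by auto
    then show "\<exists>a\<in>D. \<exists>n\<in>N. g = a \<otimes> n" using nd by blast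
  qed
qed

definition no_abelian_factor :: "('g, 'n) monoid_scheme \<Rightarrow> bool" where
  "no_abelian_factor G \<longleftrightarrow> (\<forall>C D. abelian_decomposition G C D \<longrightarrow> C = {\<one>\<^bsub>G\<^esub>})"

text \<open>
  An abelian factor \<open>C\<close> of \<open>N\<close> could be moved to \<open>A\<close>, and maximality of \<open>A\<close> gives \<open>C \<subseteq> A \<inter> N\<close>.
\<close>

lemma NAb_no_abelian_factor:
  assumes G: "group G" and dec: "Ab_NAb_decomposition G A N"
  shows "no_abelian_factor (G \<restriction> N)"
  unfolding no_abelian_factor_def
proof (intro allI impI)
  interpret G: group G by fact
  fix C D assume CD: "abelian_decomposition (G \<restriction> N) C D"
  have AN: "internal_direct_product G A N" and cA: "comm_group (G \<restriction> A)"
    and max: "\<And>A' N'. abelian_decomposition G A' N' \<Longrightarrow> A \<subseteq> A' \<Longrightarrow> A' = A"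
    using dec by (auto simp: Ab_NAb_decomposition_def abelian_decomposition_def)
  note r = AN[unfolded G.internal_direct_product_iff]
  have sA: "subgroup A G" and sN: "subgroup N G" using r by auto
  interpret GN: group "G \<restriction> N" by (rule G.subgroup_imp_group[OF sN])
  have idp: "internal_direct_product (G \<restriction> N) C D" and cC: "comm_group (G \<restriction> C)"
    using CD by (auto simp: abelian_decomposition_def)
  have C: "subgroup C G" "C \<subseteq> N"
    using idp G.incl_subgroup[OF sN] subgroup.subset unfolding GN.internal_direct_product_iff by force+
  have inG: "\<And>a. a \<in> A \<Longrightarrow> a \<in> carrier G" "\<And>c. c \<in> C \<Longrightarrow> c \<in> carrier G"
    using subgroup.mem_carrier[OF sA] subgroup.mem_carrier[OF C(1)] by auto
  note as = G.internal_direct_product_assoc[OF G.internal_direct_product_commute[OF AN]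
      GN.internal_direct_product_commute[OF idp]]
  have "comm_group (G \<restriction> (A <#>\<^bsub>G\<^esub> C))"
  proof (rule group.group_comm_groupI[OF G.subgroup_imp_group[OF as(3)]]; simp)
    fix x y assume "x \<in> A <#>\<^bsub>G\<^esub> C" "y \<in> A <#>\<^bsub>G\<^esub> C"
    then obtain a c b d where e: "a \<in> A" "c \<in> C" "x = a \<otimes>\<^bsub>G\<^esub> c" "b \<in> A" "d \<in> C" "y = b \<otimes>\<^bsub>G\<^esub> d"
      unfolding set_mult_def by blast
    have com: "g \<otimes>\<^bsub>G\<^esub> h = h \<otimes>\<^bsub>G\<^esub> g" if "g \<in> A" "h \<in> C" for g h using r that C by blast
    have "a \<otimes>\<^bsub>G\<^esub> b = b \<otimes>\<^bsub>G\<^esub> a" "c \<otimes>\<^bsub>G\<^esub> d = d \<otimes>\<^bsub>G\<^esub> c"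
      using comm_groupE(4)[OF cA, of a b] comm_groupE(4)[OF cC, of c d] e by auto
    have swap: "(a \<otimes>\<^bsub>G\<^esub> c) \<otimes>\<^bsub>G\<^esub> (b \<otimes>\<^bsub>G\<^esub> d) = (a \<otimes>\<^bsub>G\<^esub> b) \<otimes>\<^bsub>G\<^esub> (c \<otimes>\<^bsub>G\<^esub> d)"
      if "a \<in> A" "b \<in> A" "c \<in> C" "d \<in> C" for a b c d
    proof -
      have "(a \<otimes>\<^bsub>G\<^esub> c) \<otimes>\<^bsub>G\<^esub> (b \<otimes>\<^bsub>G\<^esub> d) = a \<otimes>\<^bsub>G\<^esub> (c \<otimes>\<^bsub>G\<^esub> b) \<otimes>\<^bsub>G\<^esub> d"
        using that inG by (simp add: G.m_assoc)
      also have "c \<otimes>\<^bsub>G\<^esub> b = b \<otimes>\<^bsub>G\<^esub> c" using com[OF that(2,3)] by simp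
      finally show ?thesis using that inG by (simp add: G.m_assoc)
    qed
    show "x \<otimes>\<^bsub>G\<^esub> y = y \<otimes>\<^bsub>G\<^esub> x"
      unfolding e(3,6) swap[OF e(1,4,2,5)] swap[OF e(4,1,5,2)]
      using \<open>a \<otimes>\<^bsub>G\<^esub> b = b \<otimes>\<^bsub>G\<^esub> a\<close> \<open>c \<otimes>\<^bsub>G\<^esub> d = d \<otimes>\<^bsub>G\<^esub> c\<close> by simp
  qed
  then have "abelian_decomposition G (A <#>\<^bsub>G\<^esub> C) D"
    using G.internal_direct_product_commute[OF as(1)] by (simp add: abelian_decomposition_def)
  then have "A <#>\<^bsub>G\<^esub> C = A" using max G.subset_set_mult[OF sA C(1)] by blast
  then have "C \<subseteq> A \<inter> N" using G.subset_set_mult[OF sA C(1)] C by blast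
  then show "C = {\<one>\<^bsub>G \<restriction> N\<^esub>}" using r subgroup.one_closed[OF C(1)] by auto
qed

context prime_field
begin

text \<open>
  Both sides have the same finite number of elements.
\<close>

lemma ring_hom_trivial_kernel_iso:
  assumes Q: "finite_group Q" and R: "finite_group R" and ord: "order Q = order R"
    and \<Psi>: "\<Psi> \<in> ring_hom (ga Q) (ga R)"
    and ker: "\<And>f. f \<in> carrier (ga Q) \<Longrightarrow> \<Psi> f = \<zero>\<^bsub>ga R\<^esub> \<Longrightarrow> f = \<zero>\<^bsub>ga Q\<^esub>"
  shows "\<Psi> \<in> ring_iso (ga Q) (ga R)"
proof -
  interpret A: ring "ga Q" by (rule ga_ring[OF Q])
  interpret B: ring "ga R" by (rule ga_ring[OF R])
  have inj: "inj_on \<Psi> (carrier (ga Q))"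
  proof (rule inj_onI)
    fix f g assume fg: "f \<in> carrier (ga Q)" "g \<in> carrier (ga Q)" "\<Psi> f = \<Psi> g"
    have "\<Psi> (f \<ominus>\<^bsub>ga Q\<^esub> g) = \<zero>\<^bsub>ga R\<^esub>"
      using ring_hom_diff[OF A.ring_axioms B.ring_axioms \<Psi> fg(1,2)] fg(3) ring_hom_closed[OF \<Psi> fg(2)]
      by (simp add: B.minus_eq B.r_neg)
    then show "f = g" using ker[of "f \<ominus>\<^bsub>ga Q\<^esub> g"] fg by (simp add: A.r_right_minus_eq)
  qed
  have "\<Psi> ` carrier (ga Q) = carrier (ga R)"
  proof (rule card_subset_eq[OF ga_finite[OF R]])
    show "\<Psi> ` carrier (ga Q) \<subseteq> carrier (ga R)" using ring_hom_closed[OF \<Psi>] by blast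
    show "card (\<Psi> ` carrier (ga Q)) = card (carrier (ga R))"
      using card_image[OF inj] ga_card[OF Q] ga_card[OF R] ord by simp
  qed
  then show ?thesis using \<Psi> inj by (simp add: ring_iso_def bij_betw_def)
qed

lemma ring_iso_order_eq:
  assumes G: "finite_group G" and H: "finite_group H" and \<phi>: "\<phi> \<in> ring_iso (ga G) (ga H)"
  shows "order G = order H"
proof -
  have "p ^ order G = p ^ order H"
    using bij_betw_same_card[of \<phi> "carrier (ga G)" "carrier (ga H)"] \<phi> ga_card[OF G] ga_card[OF H]
    by (simp add: ring_iso_def)
  then show ?thesis using prime prime_gt_1_nat power_inject_exp by metis
qed

lemma ring_iso_inverse:
  assumes A: "ring A" and B: "ring B" and \<phi>: "\<phi> \<in> ring_iso A B"
  obtains \<psi> where "\<psi> \<in> ring_iso B A" "\<And>x. x \<in> carrier A \<Longrightarrow> \<psi> (\<phi> x) = x"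
    "\<And>y. y \<in> carrier B \<Longrightarrow> \<phi> (\<psi> y) = y"
proof -
  interpret A: ring A by fact
  have bij: "bij_betw \<phi> (carrier A) (carrier B)" and h: "\<phi> \<in> ring_hom A B"
    using \<phi> by (auto simp: ring_iso_def)
  let ?\<psi> = "inv_into (carrier A) \<phi>"
  have l: "?\<psi> (\<phi> x) = x" if "x \<in> carrier A" for x using bij_betw_inv_into_left[OF bij that] .
  have r: "\<phi> (?\<psi> y) = y" if "y \<in> carrier B" for y using bij_betw_inv_into_right[OF bij that] .
  have c: "?\<psi> y \<in> carrier A" if "y \<in> carrier B" for y
    using bij_betw_inv_into[OF bij] that by (auto dest: bij_betwE)
  have "?\<psi> \<in> ring_hom B A"
  proof (rule ring_hom_memI)
    fix x y assume xy: "x \<in> carrier B" "y \<in> carrier B"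
    show "?\<psi> x \<in> carrier A" using c xy by blast
    show "?\<psi> (x \<otimes>\<^bsub>B\<^esub> y) = ?\<psi> x \<otimes>\<^bsub>A\<^esub> ?\<psi> y"
      using l[of "?\<psi> x \<otimes>\<^bsub>A\<^esub> ?\<psi> y"] ring_hom_mult[OF h c[OF xy(1)] c[OF xy(2)]] c xy r by simp
    show "?\<psi> (x \<oplus>\<^bsub>B\<^esub> y) = ?\<psi> x \<oplus>\<^bsub>A\<^esub> ?\<psi> y"
      using l[of "?\<psi> x \<oplus>\<^bsub>A\<^esub> ?\<psi> y"] ring_hom_add[OF h c[OF xy(1)] c[OF xy(2)]] c xy r by simp
  next
    show "?\<psi> \<one>\<^bsub>B\<^esub> = \<one>\<^bsub>A\<^esub>" using l[of "\<one>\<^bsub>A\<^esub>"] ring_hom_one[OF h] by simp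
  qed
  then have "?\<psi> \<in> ring_iso B A" using bij_betw_inv_into[OF bij] by (simp add: ring_iso_def)
  then show ?thesis using that l r by blast
qed

text \<open>
  The isomorphism is \<open>kN \<rightarrow> kG \<rightarrow> kH \<rightarrow> kM\<close>, where the last map kills \<open>h\<close>. Suppose that its kernel is
  not zero; then it contains some \<open>g \<noteq> 0\<close> fixed by left multiplication with \<open>N\<close>. The
  element \<open>(h - 1) ^ (q - 1)\<close> with \<open>q = p ^ n\<close> is fixed by \<open>h\<close>, so a product with it on the left depends only
  on the image of the other factor in \<open>kM\<close>. Therefore it annihilates \<open>\<phi>(g)\<close>, that is,
  \<open>(u - 1) ^ (q - 1) g = 0\<close>. As \<open>g\<close> is fixed by \<open>N\<close>, this product depends only on the image of
  the left factor in the group algebra of \<open>\<langle>a\<rangle>\<close>, and that image is not zero because the image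
  of \<open>u\<close> has linear coefficient 1. So a tensor product of non-zero vectors would vanish.
\<close>

lemma cancel_cyclic_factor:
  assumes G: "finite_p_group p G" and H: "finite_p_group p H"
    and a: "a \<in> carrier G" "group.ord G a = p ^ n" and h: "h \<in> carrier H" "group.ord H h = p ^ n"
    and dG: "internal_direct_product G (generate G {a}) N"
    and dH: "internal_direct_product H (generate H {h}) M"
    and \<phi>: "\<phi> \<in> ring_iso (ga G) (ga H)"
    and u: "u \<in> carrier (ga G)" "\<phi> u = basis H h"
    and \<pi>: "\<pi> \<in> hom G (G \<restriction> generate G {a})" "\<nu> \<in> hom G (G \<restriction> N)"
      "\<And>g. g \<in> carrier G \<Longrightarrow> g = \<pi> g \<otimes>\<^bsub>G\<^esub> \<nu> g"
    and \<tau>: "\<tau> \<in> hom (G \<restriction> generate G {a}) (add_monoid K)" "\<tau> a = \<one>"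
    and aug: "lin (G \<restriction> generate G {a}) (\<lambda>_. \<one>) (push G (G \<restriction> generate G {a}) \<pi> u) = \<one>"
    and lin: "lin (G \<restriction> generate G {a}) \<tau> (push G (G \<restriction> generate G {a}) \<pi> u) = \<one>"
  shows "ring_iso (ga (G \<restriction> N)) (ga (H \<restriction> M)) \<noteq> {}"
proof -
  have fG: "finite_group G" and fH: "finite_group H" using finite_p_groupD G H by auto
  interpret G: finite_group G by (rule fG)
  interpret H: finite_group H by (rule fH)
  let ?Ca = "G \<restriction> generate G {a}" and ?Ch = "H \<restriction> generate H {h}"
  let ?N = "G \<restriction> N" and ?M = "H \<restriction> M"
  have sub: "subgroup (generate G {a}) G" "subgroup N G" "subgroup (generate H {h}) H" "subgroup M H"
    using dG dH unfolding G.internal_direct_product_iff H.internal_direct_product_iff by auto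
  have fin: "finite_group ?Ca" "finite_group ?N" "finite_group ?Ch" "finite_group ?M"
    using finite_group_subgroup[OF fG] finite_group_subgroup[OF fH] sub by auto
  have pN: "finite_p_group p ?N" by (rule finite_p_group_subgroup[OF prime G sub(2)])
  interpret RG: ring "ga G" by (rule ga_ring[OF fG])
  interpret RH: ring "ga H" by (rule ga_ring[OF fH])
  interpret RN: ring "ga ?N" by (rule ga_ring[OF fin(2)])
  interpret RM: ring "ga ?M" by (rule ga_ring[OF fin(4)])
  interpret RCa: ring "ga ?Ca" by (rule ga_ring[OF fin(1)])
  interpret RCh: ring "ga ?Ch" by (rule ga_ring[OF fin(3)])
  have cyc: "comm_group ?Ca" "comm_group ?Ch"
    using cyclic_comm_group[OF fG a(1)] cyclic_comm_group[OF fH h(1)] .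
  obtain \<eta> \<mu> where \<eta>: "\<eta> \<in> hom H ?Ch" "\<mu> \<in> hom H ?M"
    and sH: "\<And>g. g \<in> carrier H \<Longrightarrow> g = \<eta> g \<otimes>\<^bsub>H\<^esub> \<mu> g"
    and "\<And>g. g \<in> generate H {h} \<Longrightarrow> \<eta> g = g" "\<And>g. g \<in> generate H {h} \<Longrightarrow> \<mu> g = \<one>\<^bsub>H\<^esub>"
    "\<And>g. g \<in> M \<Longrightarrow> \<eta> g = \<one>\<^bsub>H\<^esub>" "\<And>g. g \<in> M \<Longrightarrow> \<mu> g = g"
    by (rule H.internal_direct_product_projections[OF dH], rule that)
  have \<phi>h: "\<phi> \<in> ring_hom (ga G) (ga H)" and \<phi>b: "bij_betw \<phi> (carrier (ga G)) (carrier (ga H))"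
    using \<phi> by (auto simp: ring_iso_def)
  have iN: "incl N G \<in> ring_hom (ga ?N) (ga G)" by (rule incl_ring_hom[OF fG sub(2)])
  have iCa: "incl (generate G {a}) G \<in> ring_hom (ga ?Ca) (ga G)" by (rule incl_ring_hom[OF fG sub(1)])
  have iCh: "incl (generate H {h}) H \<in> ring_hom (ga ?Ch) (ga H)" by (rule incl_ring_hom[OF fH sub(3)])
  have iM: "incl M H \<in> ring_hom (ga ?M) (ga H)" by (rule incl_ring_hom[OF fH sub(4)])
  have P: "push G ?Ca \<pi> \<in> ring_hom (ga G) (ga ?Ca)" by (rule push_ring_hom[OF fG fin(1) \<pi>(1)])
  have S: "push H ?M \<mu> \<in> ring_hom (ga H) (ga ?M)" by (rule push_ring_hom[OF fH fin(4) \<eta>(2)])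
  let ?\<Psi> = "\<lambda>f. push H ?M \<mu> (\<phi> (incl N G f))"
  have \<Psi>: "?\<Psi> \<in> ring_hom (ga ?N) (ga ?M)"
    by (rule ring_hom_comp[OF iN ring_hom_comp[OF \<phi>h S]])
  have "card (generate G {a}) = p ^ n" "card (generate H {h}) = p ^ n"
    using G.generate_pow_card[OF a(1)] H.generate_pow_card[OF h(1)] a h by simp_all
  then have ord: "order ?N = order ?M"
    using G.internal_direct_product_card[OF dG] H.internal_direct_product_card[OF dH]
      ring_iso_order_eq[OF fG fH \<phi>] prime prime_gt_0_nat by (simp add: order_def)
  have hC: "h \<in> carrier ?Ch" and aC: "a \<in> carrier ?Ca" by (auto intro: generate.incl)
  let ?q = "p ^ n - 1"
  let ?w = "basis ?Ch h \<ominus>\<^bsub>ga ?Ch\<^esub> \<one>\<^bsub>ga ?Ch\<^esub>"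
  let ?e = "?w [^]\<^bsub>ga ?Ch\<^esub> ?q"
  have wc: "?w \<in> carrier (ga ?Ch)" using basis_mem[OF fin(3)] by simp
  then have ec: "?e \<in> carrier (ga ?Ch)" by (rule RCh.nat_pow_closed)
  interpret RChc: cring "ga ?Ch" by (rule ga_cring[OF cyc(2) finite_group.finite_carrier[OF fin(3)]])
  have hq: "h [^]\<^bsub>?Ch\<^esub> (p ^ n) = \<one>\<^bsub>?Ch\<^esub>"
    using H.pow_eq_id[OF h(1)] h(2) by (simp add: H.nat_pow_consistent[symmetric])
  have eh: "?e \<otimes>\<^bsub>ga ?Ch\<^esub> basis ?Ch h = ?e"
    using augmentation_power_invariant[OF cyc(2) finite_group.finite_carrier[OF fin(3)] hC hq]
      RChc.m_comm[OF ec basis_mem[OF fin(3), of h]] by simp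
  have inv: "?e \<otimes>\<^bsub>ga ?Ch\<^esub> basis ?Ch c = ?e" if c: "c \<in> generate H {h}" for c
  proof -
    obtain i :: nat where i: "c = h [^]\<^bsub>H\<^esub> i"
      using c unfolding H.generate_pow_on_finite_carrier[OF H.finite_carrier h(1)] by blast
    have "?e \<otimes>\<^bsub>ga ?Ch\<^esub> basis ?Ch h [^]\<^bsub>ga ?Ch\<^esub> (i::nat) = ?e"
    proof (induction i)
      case (Suc i)
      have "?e \<otimes>\<^bsub>ga ?Ch\<^esub> basis ?Ch h [^]\<^bsub>ga ?Ch\<^esub> Suc i =
          (?e \<otimes>\<^bsub>ga ?Ch\<^esub> basis ?Ch h [^]\<^bsub>ga ?Ch\<^esub> i) \<otimes>\<^bsub>ga ?Ch\<^esub> basis ?Ch h"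
        using ec basis_mem[OF fin(3), of h] by (simp add: RCh.m_assoc)
      then show ?case using Suc eh by simp
    qed (use ec in simp)
    then show ?thesis using basis_pow[OF fin(3) hC] i by (simp add: H.nat_pow_consistent[symmetric])
  qed
  have ker: "f = \<zero>\<^bsub>ga ?N\<^esub>" if f: "f \<in> carrier (ga ?N)" "?\<Psi> f = \<zero>\<^bsub>ga ?M\<^esub>" for f
  proof (rule ccontr)
    assume f0: "f \<noteq> \<zero>\<^bsub>ga ?N\<^esub>"
    obtain g where g: "g \<in> carrier (ga ?N)" "g \<noteq> \<zero>\<^bsub>ga ?N\<^esub>" "?\<Psi> g = \<zero>\<^bsub>ga ?M\<^esub>"
      "\<And>m. m \<in> N \<Longrightarrow> basis ?N m \<otimes>\<^bsub>ga ?N\<^esub> g = g"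
      using kernel_fixed_vector[OF pN RM.ring_axioms \<Psi> f f0] by auto
    let ?g = "incl N G g"
    have gG: "?g \<in> carrier (ga G)" by (rule ring_hom_closed[OF iN g(1)])
    let ?E = "(u \<ominus>\<^bsub>ga G\<^esub> \<one>\<^bsub>ga G\<^esub>) [^]\<^bsub>ga G\<^esub> ?q"
    have Ec: "?E \<in> carrier (ga G)" using u(1) by simp
    have \<phi>E: "\<phi> ?E = incl (generate H {h}) H ?e"
      using ring_hom_pow[OF RG.ring_axioms RH.ring_axioms \<phi>h, of "u \<ominus>\<^bsub>ga G\<^esub> \<one>\<^bsub>ga G\<^esub>" ?q]
        ring_hom_diff[OF RG.ring_axioms RH.ring_axioms \<phi>h u(1) RG.one_closed]
        ring_hom_pow[OF RCh.ring_axioms RH.ring_axioms iCh wc, of ?q]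
        ring_hom_diff[OF RCh.ring_axioms RH.ring_axioms iCh basis_mem[OF fin(3)] RCh.one_closed]
        ring_hom_one[OF \<phi>h] ring_hom_one[OF iCh] u incl_basis[OF fH sub(3), of h] hC by simp
    let ?F = "incl (generate H {h}) H ?e"
    have Fc: "?F \<in> carrier (ga H)" by (rule ring_hom_closed[OF iCh ec])
    (* Left multiplication by a vector fixed by h factors through the projection of kH to kM. *)
    have Fabs: "?F \<otimes>\<^bsub>ga H\<^esub> basis H x = ?F \<otimes>\<^bsub>ga H\<^esub> basis H (\<mu> x)" if x: "x \<in> carrier H" for x
    proof -
      have c: "\<eta> x \<in> generate H {h}" "\<mu> x \<in> M"
        using hom_in_carrier[OF \<eta>(1) x] hom_in_carrier[OF \<eta>(2) x] by auto
      have cH: "\<eta> x \<in> carrier H" "\<mu> x \<in> carrier H"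
        using subgroup.mem_carrier[OF sub(3) c(1)] subgroup.mem_carrier[OF sub(4) c(2)] .
      have "?F \<otimes>\<^bsub>ga H\<^esub> basis H (\<eta> x) = ?F"
        using ring_hom_mult[OF iCh ec basis_mem[OF fin(3)], of "\<eta> x"] inv[OF c(1)]
        by (simp add: incl_basis[OF fH sub(3) c(1)])
      then show ?thesis
        using sH[OF x] basis_mult[OF fH cH] RH.m_assoc[OF Fc basis_mem[OF fH] basis_mem[OF fH]] by metis
    qed
    have "additive H (ga H) (\<lambda>x. ?F \<otimes>\<^bsub>ga H\<^esub> x)"
      using Fc by (intro additiveI) (auto simp: RH.r_distr)
    from additive_factor_push[OF fH sub(4) \<eta>(2) this Fabs ring_hom_closed[OF \<phi>h gG]]
    have "\<phi> ?E \<otimes>\<^bsub>ga H\<^esub> \<phi> ?g = \<phi> ?E \<otimes>\<^bsub>ga H\<^esub> incl M H (push H ?M \<mu> (\<phi> ?g))"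
      unfolding \<phi>E .
    also have "\<dots> = \<zero>\<^bsub>ga H\<^esub>"
      using g(3) additive_zero[OF fin(4) RH.abelian_group_axioms ring_hom_additive[OF iM]]
        ring_hom_closed[OF \<phi>h Ec] by simp
    finally have "\<phi> (?E \<otimes>\<^bsub>ga G\<^esub> ?g) = \<phi> \<zero>\<^bsub>ga G\<^esub>"
      using ring_hom_mult[OF \<phi>h Ec gG] additive_zero[OF fG RH.abelian_group_axioms ring_hom_additive[OF \<phi>h]]
      by simp
    then have "?E \<otimes>\<^bsub>ga G\<^esub> ?g = \<zero>\<^bsub>ga G\<^esub>"
      using bij_betw_imp_inj_on[OF \<phi>b] Ec gG by (auto dest: inj_onD)
    (* Right multiplication by a vector fixed by N factors through the group algebra of <a>. *)
    moreover have gabs: "basis G x \<otimes>\<^bsub>ga G\<^esub> ?g = basis G (\<pi> x) \<otimes>\<^bsub>ga G\<^esub> ?g" if x: "x \<in> carrier G" for x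
    proof -
      have c: "\<pi> x \<in> generate G {a}" "\<nu> x \<in> N"
        using hom_in_carrier[OF \<pi>(1) x] hom_in_carrier[OF \<pi>(2) x] by auto
      have cG: "\<pi> x \<in> carrier G" "\<nu> x \<in> carrier G"
        using subgroup.mem_carrier[OF sub(1) c(1)] subgroup.mem_carrier[OF sub(2) c(2)] .
      have "basis G (\<nu> x) \<otimes>\<^bsub>ga G\<^esub> ?g = ?g"
        using ring_hom_mult[OF iN basis_mem[OF fin(2)] g(1), of "\<nu> x"] g(4)[OF c(2)]
        by (simp add: incl_basis[OF fG sub(2) c(2)])
      then show ?thesis
        using \<pi>(3)[OF x] basis_mult[OF fG cG] RG.m_assoc[OF basis_mem[OF fG] basis_mem[OF fG] gG] by metis
    qed
    moreover have "additive G (ga G) (\<lambda>x. x \<otimes>\<^bsub>ga G\<^esub> ?g)"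
      using gG by (intro additiveI) (auto simp: RG.l_distr)
    ultimately have "incl (generate G {a}) G (push G ?Ca \<pi> ?E) \<otimes>\<^bsub>ga G\<^esub> ?g = \<zero>\<^bsub>ga G\<^esub>"
      using additive_factor_push[OF fG sub(1) \<pi>(1) _ _ Ec, of "\<lambda>x. x \<otimes>\<^bsub>ga G\<^esub> ?g"] by simp
    then have "push G ?Ca \<pi> ?E = \<zero>\<^bsub>ga ?Ca\<^esub>"
      using tensor_nonzero[OF fG dG ring_hom_closed[OF P Ec] g(1) _ g(2)] by blast
    then have "(push G ?Ca \<pi> u \<ominus>\<^bsub>ga ?Ca\<^esub> \<one>\<^bsub>ga ?Ca\<^esub>) [^]\<^bsub>ga ?Ca\<^esub> ?q = \<zero>\<^bsub>ga ?Ca\<^esub>"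
      using ring_hom_pow[OF RG.ring_axioms RCa.ring_axioms P, of "u \<ominus>\<^bsub>ga G\<^esub> \<one>\<^bsub>ga G\<^esub>" ?q]
        ring_hom_diff[OF RG.ring_axioms RCa.ring_axioms P u(1) RG.one_closed] ring_hom_one[OF P] u(1) by simp
    moreover have "group.ord ?Ca a = p ^ n"
      using G.ord_subgroup[OF sub(1), of a] aC a(2) by simp
    moreover have "carrier ?Ca = generate ?Ca {a}"
      using G.generate_consistent[OF _ sub(1), of "{a}"] aC by simp
    ultimately show False
      using augmentation_power_nonzero[OF cyc(1) finite_group.finite_carrier[OF fin(1)] _ aC _ \<tau>
          ring_hom_closed[OF P u(1)] aug lin] by blast
  qed
  show ?thesis
    using ring_hom_trivial_kernel_iso[OF fin(2,4) ord \<Psi> ker] by blast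
qed

end

section \<open>Combining isomorphisms of the factors\<close>

lemma (in comm_group) subgroup_comm_group:
  assumes "subgroup S G"
  shows "comm_group (G \<restriction> S)"
  by (rule group.group_comm_groupI[OF subgroup_imp_group[OF assms]])
    (simp add: m_comm subgroup.mem_carrier[OF assms])

context prime_field
begin

text \<open>
  The tensor product of the maps on the factors: it is the extension of the multiplicative map
  \<open>an \<mapsto> \<psi>(a) \<phi>(n)\<close> on the group.
\<close>

lemma factor_ring_hom:
  assumes G: "finite_group G" and H: "finite_group H"
    and dG: "internal_direct_product G A N" and dH: "internal_direct_product H B M"
    and \<psi>: "\<psi> \<in> hom (G \<restriction> A) (H \<restriction> B)"
    and \<phi>: "\<phi> \<in> ring_hom (ga (G \<restriction> N)) (ga (H \<restriction> M))"
  shows "\<exists>\<Phi>\<in>ring_hom (ga G) (ga H). (\<forall>a\<in>A. \<Phi> (basis G a) = basis H (\<psi> a)) \<and>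
    (\<forall>f\<in>carrier (ga (G \<restriction> N)). \<Phi> (incl N G f) = incl M H (\<phi> f))"
proof -
  interpret G: finite_group G by fact
  interpret H: finite_group H by fact
  let ?N = "G \<restriction> N" and ?M = "H \<restriction> M"
  obtain \<alpha> \<nu> where h: "\<alpha> \<in> hom G (G \<restriction> A)" "\<nu> \<in> hom G ?N"
    and s: "\<And>g. g \<in> carrier G \<Longrightarrow> g = \<alpha> g \<otimes>\<^bsub>G\<^esub> \<nu> g"
    and v: "\<And>a. a \<in> A \<Longrightarrow> \<alpha> a = a" "\<And>a. a \<in> A \<Longrightarrow> \<nu> a = \<one>\<^bsub>G\<^esub>"
      "\<And>n. n \<in> N \<Longrightarrow> \<alpha> n = \<one>\<^bsub>G\<^esub>" "\<And>n. n \<in> N \<Longrightarrow> \<nu> n = n"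
    by (rule G.internal_direct_product_projections[OF dG], rule that)
  note rG = dG[unfolded G.internal_direct_product_iff] and rH = dH[unfolded H.internal_direct_product_iff]
  have sub: "subgroup A G" "subgroup N G" "subgroup B H" "subgroup M H" using rG rH by auto
  have fin: "finite_group ?N" "finite_group ?M"
    using finite_group_subgroup[OF G] finite_group_subgroup[OF H] sub by auto
  interpret RH: ring "ga H" by (rule ga_ring[OF H])
  interpret RM: ring "ga ?M" by (rule ga_ring[OF fin(2)])
  have iN: "incl N G \<in> ring_hom (ga ?N) (ga G)" by (rule incl_ring_hom[OF G sub(2)])
  have iM: "incl M H \<in> ring_hom (ga ?M) (ga H)" by (rule incl_ring_hom[OF H sub(4)])
  note iM\<phi> = ring_hom_comp[OF \<phi> iM]
  note iMc = ring_hom_closed[OF iM]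
  have BH: "b \<in> carrier H" if "b \<in> B" for b using subgroup.mem_carrier[OF sub(3) that] .
  have \<psi>B: "\<psi> (\<alpha> g) \<in> B" if "g \<in> carrier G" for g
    using hom_in_carrier[OF \<psi>, of "\<alpha> g"] hom_in_carrier[OF h(1) that] by simp
  have \<nu>N: "\<nu> g \<in> N" if "g \<in> carrier G" for g using hom_in_carrier[OF h(2) that] by simp
  have \<psi>1: "\<psi> \<one>\<^bsub>G\<^esub> = \<one>\<^bsub>H\<^esub>"
    using hom_one[OF \<psi> G.subgroup_imp_group[OF sub(1)] H.subgroup_imp_group[OF sub(3)]] by simp
  have commute: "basis H b \<otimes>\<^bsub>ga H\<^esub> incl M H f = incl M H f \<otimes>\<^bsub>ga H\<^esub> basis H b"
    if b: "b \<in> B" and f: "f \<in> carrier (ga ?M)" for b f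
    using fin(2) f
  proof (induction f rule: ga_induct)
    case zero
    then show ?case
      using additive_zero[OF fin(2) RH.abelian_group_axioms ring_hom_additive[OF iM]] basis_mem[OF H] by simp
  next
    case (add f f')
    then show ?case
      using iMc basis_mem[OF H] by (simp add: ring_hom_add[OF iM] RH.l_distr RH.r_distr)
  next
    case (single m)
    then have m: "m \<in> M" by simp
    have "b \<otimes>\<^bsub>H\<^esub> m = m \<otimes>\<^bsub>H\<^esub> b" using rH b m by blast
    then show ?case
      using m BH[OF b] subgroup.mem_carrier[OF sub(4) m]
      by (simp add: incl_basis[OF H sub(4)] basis_mult[OF H])
  qed
  let ?u = "\<lambda>g. basis H (\<psi> (\<alpha> g)) \<otimes>\<^bsub>ga H\<^esub> incl M H (\<phi> (basis ?N (\<nu> g)))"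
  have y: "\<phi> (basis ?N n) \<in> carrier (ga ?M)" for n by (rule ring_hom_closed[OF \<phi> basis_mem[OF fin(1)]])
  have uc: "?u \<in> carrier G \<rightarrow> carrier (ga H)" using iMc[OF y] basis_mem[OF H] by simp
  have one: "?u \<one>\<^bsub>G\<^esub> = \<one>\<^bsub>ga H\<^esub>"
    using v(1)[of "\<one>\<^bsub>G\<^esub>"] v(4)[of "\<one>\<^bsub>G\<^esub>"] subgroup.one_closed[OF sub(1)] subgroup.one_closed[OF sub(2)] \<psi>1
      ring_hom_one[OF iM\<phi>] by (simp add: ga_one[OF H, symmetric] ga_one[OF fin(1), simplified, symmetric])
  have mult: "?u (x \<otimes>\<^bsub>G\<^esub> z) = ?u x \<otimes>\<^bsub>ga H\<^esub> ?u z" if xz: "x \<in> carrier G" "z \<in> carrier G" for x z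
  proof -
    let ?y = "\<lambda>g. incl M H (\<phi> (basis ?N (\<nu> g)))" and ?b = "\<lambda>g. basis H (\<psi> (\<alpha> g))"
    have yc: "?y g \<in> carrier (ga H)" for g using iMc[OF y] .
    have bc: "?b g \<in> carrier (ga H)" for g using basis_mem[OF H] .
    have "?b (x \<otimes>\<^bsub>G\<^esub> z) = ?b x \<otimes>\<^bsub>ga H\<^esub> ?b z"
      using hom_mult[OF h(1) xz] hom_mult[OF \<psi>, of "\<alpha> x" "\<alpha> z"] hom_in_carrier[OF h(1)] xz
        basis_mult[OF H BH[OF \<psi>B[OF xz(1)]] BH[OF \<psi>B[OF xz(2)]]] by simp
    moreover have "?y (x \<otimes>\<^bsub>G\<^esub> z) = ?y x \<otimes>\<^bsub>ga H\<^esub> ?y z"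
      using hom_mult[OF h(2) xz] basis_mult[OF fin(1), of "\<nu> x" "\<nu> z"] \<nu>N xz
        ring_hom_mult[OF iM\<phi> basis_mem[OF fin(1)] basis_mem[OF fin(1)], of "\<nu> x" "\<nu> z"] by simp
    moreover have "?b x \<otimes>\<^bsub>ga H\<^esub> ?b z \<otimes>\<^bsub>ga H\<^esub> (?y x \<otimes>\<^bsub>ga H\<^esub> ?y z) =
        ?b x \<otimes>\<^bsub>ga H\<^esub> (?b z \<otimes>\<^bsub>ga H\<^esub> ?y x) \<otimes>\<^bsub>ga H\<^esub> ?y z"
      using yc bc by (simp add: RH.m_assoc)
    moreover have "?b z \<otimes>\<^bsub>ga H\<^esub> ?y x = ?y x \<otimes>\<^bsub>ga H\<^esub> ?b z" by (rule commute[OF \<psi>B[OF xz(2)] y])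
    ultimately show ?thesis using yc bc by (simp add: RH.m_assoc)
  qed
  let ?\<Phi> = "ext G H ?u"
  have \<Phi>: "?\<Phi> \<in> ring_hom (ga G) (ga H)" by (rule ext_ring_hom[OF G H uc one mult])
  have "?\<Phi> (basis G a) = basis H (\<psi> a)" if a: "a \<in> A" for a
  proof -
    have "\<phi> (basis ?N \<one>\<^bsub>G\<^esub>) = \<one>\<^bsub>ga ?M\<^esub>" using ring_hom_one[OF \<phi>] ga_one[OF fin(1)] by simp
    then show ?thesis
      using ext_basis[OF G H uc, of a] v(1,2)[OF a] subgroup.mem_carrier[OF sub(1) a] ring_hom_one[OF iM] basis_mem[OF H]
      by simp
  qed
  moreover have "?\<Phi> (incl N G f) = incl M H (\<phi> f)" if f: "f \<in> carrier (ga ?N)" for f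
  proof (rule additive_eqI[OF fin(1) RH.abelian_group_axioms
        ring_hom_additive[OF ring_hom_comp[OF iN \<Phi>]] ring_hom_additive[OF iM\<phi>] _ f])
    fix n assume "n \<in> carrier ?N"
    then have n: "n \<in> N" by simp
    show "?\<Phi> (incl N G (basis ?N n)) = incl M H (\<phi> (basis ?N n))"
      using ext_basis[OF G H uc, of n] v(3,4)[OF n] subgroup.mem_carrier[OF sub(2) n] iMc[OF y]
      by (simp add: incl_basis[OF G sub(2) n] \<psi>1 ga_one[OF H, symmetric])
  qed
  ultimately show ?thesis using \<Phi> by blast
qed

text \<open>
  The maps on the tensor products that belong to inverse pairs of isomorphisms compose to the
  identity.
\<close>

lemma factor_ring_iso:
  assumes G: "finite_group G" and H: "finite_group H"
    and dG: "internal_direct_product G A N" and dH: "internal_direct_product H B M"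
    and \<psi>: "G \<restriction> A \<cong> H \<restriction> B"
    and \<phi>: "ring_iso (ga (G \<restriction> N)) (ga (H \<restriction> M)) \<noteq> {}"
  shows "ring_iso (ga G) (ga H) \<noteq> {}"
proof -
  interpret G: finite_group G by fact
  interpret H: finite_group H by fact
  let ?N = "G \<restriction> N" and ?M = "H \<restriction> M"
  note rG = dG[unfolded G.internal_direct_product_iff] and rH = dH[unfolded H.internal_direct_product_iff]
  have sub: "subgroup A G" "subgroup N G" "subgroup B H" "subgroup M H" using rG rH by auto
  have fin: "finite_group ?N" "finite_group ?M"
    using finite_group_subgroup[OF G] finite_group_subgroup[OF H] sub by auto
  interpret RG: ring "ga G" by (rule ga_ring[OF G])
  interpret RN: ring "ga ?N" by (rule ga_ring[OF fin(1)])
  interpret RM: ring "ga ?M" by (rule ga_ring[OF fin(2)])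
  obtain e where e: "e \<in> iso (G \<restriction> A) (H \<restriction> B)"
    using \<psi> unfolding is_iso_def by blast
  define e' where "e' = inv_into A e"
  have e': "e' \<in> iso (H \<restriction> B) (G \<restriction> A)"
    using group.iso_set_sym[OF G.subgroup_imp_group[OF sub(1)] e] by (simp add: e'_def)
  have bij: "bij_betw e A B" using e by (simp add: iso_def)
  have eB: "e a \<in> B" "e' (e a) = a" if "a \<in> A" for a
    using bij that by (auto simp: e'_def bij_betw_inv_into_left dest: bij_betwE)
  obtain \<phi> where \<phi>: "\<phi> \<in> ring_iso (ga ?N) (ga ?M)" using \<phi> by blast
  obtain \<phi>' where \<phi>': "\<phi>' \<in> ring_iso (ga ?M) (ga ?N)"
    and inv: "\<And>f. f \<in> carrier (ga ?N) \<Longrightarrow> \<phi>' (\<phi> f) = f"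
    by (rule ring_iso_inverse[OF RN.ring_axioms RM.ring_axioms \<phi>]) blast
  have \<phi>h: "\<phi> \<in> ring_hom (ga ?N) (ga ?M)" and \<phi>'h: "\<phi>' \<in> ring_hom (ga ?M) (ga ?N)"
    using \<phi> \<phi>' by (auto simp: ring_iso_def)
  obtain \<Phi> where \<Phi>: "\<Phi> \<in> ring_hom (ga G) (ga H)" "\<And>a. a \<in> A \<Longrightarrow> \<Phi> (basis G a) = basis H (e a)"
    "\<And>f. f \<in> carrier (ga ?N) \<Longrightarrow> \<Phi> (incl N G f) = incl M H (\<phi> f)"
    using factor_ring_hom[OF G H dG dH iso_imp_homomorphism[OF e] \<phi>h] by blast
  obtain \<Phi>' where \<Phi>': "\<Phi>' \<in> ring_hom (ga H) (ga G)" "\<And>b. b \<in> B \<Longrightarrow> \<Phi>' (basis H b) = basis G (e' b)"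
    "\<And>f. f \<in> carrier (ga ?M) \<Longrightarrow> \<Phi>' (incl M H f) = incl N G (\<phi>' f)"
    using factor_ring_hom[OF H G dH dG iso_imp_homomorphism[OF e'] \<phi>'h] by blast
  have id: "\<Phi>' (\<Phi> f) = f" if f: "f \<in> carrier (ga G)" for f
  proof (rule additive_eqI[OF G RG.abelian_group_axioms ring_hom_additive[OF ring_hom_comp[OF \<Phi>(1) \<Phi>'(1)]] _ _ f])
    show "additive G (ga G) (\<lambda>f. f)" by (simp add: hom_def)
    fix g assume "g \<in> carrier G"
    then obtain a n where an: "a \<in> A" "n \<in> N" "g = a \<otimes>\<^bsub>G\<^esub> n" using rG by blast
    have anG: "a \<in> carrier G" "n \<in> carrier G"
      using subgroup.mem_carrier[OF sub(1) an(1)] subgroup.mem_carrier[OF sub(2) an(2)] .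
    let ?en = "basis ?N n"
    have en: "?en \<in> carrier (ga ?N)" by (rule basis_mem[OF fin(1)])
    have g: "basis G g = basis G a \<otimes>\<^bsub>ga G\<^esub> incl N G ?en"
      using an anG by (simp add: basis_mult[OF G] incl_basis[OF G sub(2)])
    have inc: "incl N G ?en \<in> carrier (ga G)" "basis G a \<in> carrier (ga G)"
      using basis_mem[OF G] by (simp_all add: incl_basis[OF G sub(2) an(2)])
    have "\<Phi>' (\<Phi> (basis G g)) = \<Phi>' (\<Phi> (basis G a)) \<otimes>\<^bsub>ga G\<^esub> \<Phi>' (\<Phi> (incl N G ?en))"
      unfolding g using ring_hom_mult[OF ring_hom_comp[OF \<Phi>(1) \<Phi>'(1)] inc(2,1)] .
    also have "\<dots> = basis G g"
      unfolding g using an en eB ring_hom_closed[OF \<phi>h en] by (simp add: \<Phi>(2,3) \<Phi>'(2,3) inv)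
    finally show "\<Phi>' (\<Phi> (basis G g)) = basis G g" .
  qed
  have "card A = card B" using bij_betw_same_card[OF bij] .
  then have "order G = order H"
    using ring_iso_order_eq[OF fin \<phi>] G.internal_direct_product_card[OF dG]
      H.internal_direct_product_card[OF dH] by (simp add: order_def)
  moreover have "f = \<zero>\<^bsub>ga G\<^esub>" if "f \<in> carrier (ga G)" "\<Phi> f = \<zero>\<^bsub>ga H\<^esub>" for f
    using id[OF that(1)] that(2)
      additive_zero[OF H RG.abelian_group_axioms ring_hom_additive[OF \<Phi>'(1)]] by simp
  ultimately show ?thesis using ring_hom_trivial_kernel_iso[OF G H _ \<Phi>(1)] by blast
qed

section \<open>Matching cyclic direct factors\<close>

text \<open>
  The linear coefficient is a derivation with respect to the augmentation, because it is one on
  group elements.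
\<close>

lemma lin_leibniz:
  assumes G: "finite_group G" and \<tau>: "\<tau> \<in> hom G (add_monoid K)"
    and f: "f \<in> carrier (ga G)" and h: "h \<in> carrier (ga G)"
  shows "lin G \<tau> (f \<otimes>\<^bsub>ga G\<^esub> h) = lin G \<tau> f \<otimes> lin G (\<lambda>_. \<one>) h \<oplus> lin G (\<lambda>_. \<one>) f \<otimes> lin G \<tau> h"
proof -
  interpret G: finite_group G by fact
  interpret R: ring "ga G" by (rule ga_ring[OF G])
  note t = hom_KD[OF G.is_group \<tau>]
  have \<tau>K: "\<tau> \<in> carrier G \<rightarrow> carrier K" and oK: "(\<lambda>_. \<one>) \<in> carrier G \<rightarrow> carrier K" using t by auto
  note L = lin_additive[OF G \<tau>K] and A = lin_additive[OF G oK]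
  note z = additive_zero[OF G abelian_group_axioms L] additive_zero[OF G abelian_group_axioms A]
  note c = additive_closed[OF L] additive_closed[OF A]
  note ad = additive_add[OF L] additive_add[OF A]
  show ?thesis
    using G f
  proof (induction f rule: ga_induct)
    case zero
    then show ?case using h by (simp add: z c)
  next
    case (add f g)
    then show ?case using h by (simp add: c ad R.l_distr l_distr a_ac)
  next
    case (single x)
    note x = single
    show ?case using G h
    proof (induction h rule: ga_induct)
      case zero
      then show ?case using basis_mem[OF G] by (simp add: z c)
    next
      case (add f g)
      then show ?case using basis_mem[OF G] by (simp add: c ad R.r_distr r_distr a_ac)
    next
      case (single y)
      then show ?case using x t
        by (simp add: basis_mult[OF G] lin_basis[OF G \<tau>K] lin_basis[OF G oK])
    qed
  qed
qed

lemma basis_central: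
  assumes G: "finite_group G" and h: "h \<in> center G" and f: "f \<in> carrier (ga G)"
  shows "basis G h \<otimes>\<^bsub>ga G\<^esub> f = f \<otimes>\<^bsub>ga G\<^esub> basis G h"
proof -
  interpret R: ring "ga G" by (rule ga_ring[OF G])
  show ?thesis using G f
  proof (induction f rule: ga_induct)
    case (single x)
    then show ?case using center_commutes[OF h single] center_closed[OF h] by (simp add: basis_mult[OF G])
  qed (use basis_mem[OF G] in \<open>auto simp: R.l_distr R.r_distr\<close>)
qed

end

text \<open>
  An element of maximal order in an abelian \<open>p\<close>-group generates a direct factor.
\<close>

lemma abelian_p_group_cyclic_factor:
  fixes p :: nat
  assumes p: "Factorial_Ring.prime p" and B: "finite_p_group p B" and comm: "comm_group B"
    and nontriv: "carrier B \<noteq> {\<one>\<^bsub>B\<^esub>}"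
  shows "\<exists>h\<in>carrier B. \<exists>m D. group.ord B h = p ^ Suc m \<and> internal_direct_product B (generate B {h}) D"
proof -
  interpret B: comm_group B by (rule comm)
  let ?P = "\<lambda>n. \<forall>b\<in>carrier B. b [^]\<^bsub>B\<^esub> (p ^ n) = \<one>\<^bsub>B\<^esub>"
  obtain k where k: "order B = p ^ k" using finite_p_groupD[OF B] by blast
  have "?P k" using B.pow_order_eq_1 k by metis
  moreover have "\<not> ?P 0" using nontriv B.one_closed by auto
  ultimately obtain m where m: "\<not> ?P m" "?P (Suc m)"
    using ex_least_nat_less[of ?P k] by (metis lessI order_refl)
  then obtain h where h: "h \<in> carrier B" "h [^]\<^bsub>B\<^esub> (p ^ m) \<noteq> \<one>\<^bsub>B\<^esub>" by blast
  have hc: "h \<in> center B" using h(1) B.m_comm by (intro centerI) auto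
  have "\<exists>D. internal_direct_product B (generate B {h}) D"
    by (rule central_cyclic_complement[OF p B hc _ B.triv_subgroup, of m])
      (use m h B.m_comm in auto)
  moreover have "B.ord h = p ^ Suc m"
    by (rule B.ord_eq_prime_power[OF p h(1) _ h(2)]) (use m(2) h(1) in blast)
  ultimately show ?thesis using h by blast
qed

context prime_field
begin

text \<open>
  A cyclic factor \<open>\<langle>h\<rangle>\<close> of the abelian part of \<open>H\<close> has a counterpart \<open>\<langle>a\<rangle>\<close> of the same order
  in the abelian part of \<open>G\<close>, and both can be cancelled from the group algebras. The element \<open>a\<close> is
  the component in \<open>A\<close> of the central element \<open>y\<close> which replaces the central unit \<open>\<phi>\<inverse>(h)\<close>.
\<close>

lemma matching_cyclic_factors:
  assumes G: "finite_p_group p G" and H: "finite_p_group p H"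
    and dG: "internal_direct_product G A N" and cA: "comm_group (G \<restriction> A)"
    and nG: "no_abelian_factor (G \<restriction> N)"
    and dH: "internal_direct_product H B M" and cB: "comm_group (H \<restriction> B)"
    and iso: "ring_iso (ga G) (ga H) \<noteq> {}" and B: "B \<noteq> {\<one>\<^bsub>H\<^esub>}"
  shows "\<exists>a\<in>A. \<exists>h\<in>B. \<exists>A' B'. a \<noteq> \<one>\<^bsub>G\<^esub> \<and> group.ord G a = group.ord H h \<and>
    internal_direct_product (G \<restriction> A) (generate G {a}) A' \<and>
    internal_direct_product (H \<restriction> B) (generate H {h}) B' \<and>
    ring_iso (ga (G \<restriction> (N <#>\<^bsub>G\<^esub> A'))) (ga (H \<restriction> (M <#>\<^bsub>H\<^esub> B'))) \<noteq> {}"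
proof -
  have fG: "finite_group G" and fH: "finite_group H" using finite_p_groupD G H by auto
  interpret G: finite_group G by (rule fG)
  interpret H: finite_group H by (rule fH)
  note rG = dG[unfolded G.internal_direct_product_iff] and rH = dH[unfolded H.internal_direct_product_iff]
  let ?A = "G \<restriction> A" and ?N = "G \<restriction> N" and ?B = "H \<restriction> B"
  have sub: "subgroup A G" "subgroup N G" "subgroup B H" "subgroup M H" using rG rH by auto
  have pA: "finite_p_group p ?A" and pN: "finite_p_group p ?N" and pB: "finite_p_group p ?B"
    using finite_p_group_subgroup[OF prime] G H sub by auto
  interpret GA: comm_group ?A by (rule cA)
  interpret HB: comm_group ?B by (rule cB)
  interpret RG: ring "ga G" by (rule ga_ring[OF fG])
  interpret RH: ring "ga H" by (rule ga_ring[OF fH])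
  obtain h m B' where h: "h \<in> B" "H.ord h = p ^ Suc m"
    and dB: "internal_direct_product ?B (generate H {h}) B'"
  proof -
    obtain h m D where "h \<in> carrier ?B" "group.ord ?B h = p ^ Suc m"
      "internal_direct_product ?B (generate ?B {h}) D"
      using abelian_p_group_cyclic_factor[OF prime pB cB] B by auto
    then show ?thesis
      using that H.ord_subgroup[OF sub(3), of h] H.generate_consistent[OF _ sub(3), of "{h}"] by simp
  qed
  let ?q = "p ^ Suc m"
  have hH: "h \<in> carrier H" using subgroup.mem_carrier[OF sub(3) h(1)] .
  have hc: "h \<in> center H"
  proof (rule centerI[OF hH])
    fix g assume "g \<in> carrier H"
    then obtain b n where bn: "b \<in> B" "n \<in> M" "g = b \<otimes>\<^bsub>H\<^esub> n" using rH by blast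
    have c: "b \<in> carrier H" "n \<in> carrier H"
      using subgroup.mem_carrier[OF sub(3) bn(1)] subgroup.mem_carrier[OF sub(4) bn(2)] .
    have hb: "h \<otimes>\<^bsub>H\<^esub> b = b \<otimes>\<^bsub>H\<^esub> h" using HB.m_comm[of h b] h bn by simp
    have hn: "h \<otimes>\<^bsub>H\<^esub> n = n \<otimes>\<^bsub>H\<^esub> h" using rH h bn by blast
    have "h \<otimes>\<^bsub>H\<^esub> g = (h \<otimes>\<^bsub>H\<^esub> b) \<otimes>\<^bsub>H\<^esub> n" using bn c hH by (simp add: H.m_assoc)
    also have "\<dots> = b \<otimes>\<^bsub>H\<^esub> (h \<otimes>\<^bsub>H\<^esub> n)" unfolding hb using c hH by (simp add: H.m_assoc)
    also have "\<dots> = g \<otimes>\<^bsub>H\<^esub> h" unfolding hn using bn c hH by (simp add: H.m_assoc)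
    finally show "h \<otimes>\<^bsub>H\<^esub> g = g \<otimes>\<^bsub>H\<^esub> h" .
  qed
  note dH' = H.internal_direct_product_assoc[OF dH dB]
  let ?C = "H \<restriction> generate H {h}"
  have sC: "subgroup (generate H {h}) H" using hH by (intro H.generate_is_subgroup) simp
  have fC: "finite_group ?C" by (rule finite_group_subgroup[OF fH sC])
  have cC: "comm_group ?C" by (rule cyclic_comm_group[OF fH hH])
  interpret C: comm_group ?C by (rule cC)
  interpret RC: ring "ga ?C" by (rule ga_ring[OF fC])
  have hC: "h \<in> generate H {h}" by (auto intro: generate.incl)
  obtain \<rho> \<mu> where \<rho>: "\<rho> \<in> hom H ?C" and "\<mu> \<in> hom H (H \<restriction> (M <#>\<^bsub>H\<^esub> B'))"
    and "\<And>g. g \<in> carrier H \<Longrightarrow> g = \<rho> g \<otimes>\<^bsub>H\<^esub> \<mu> g"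
    and \<rho>id: "\<And>g. g \<in> generate H {h} \<Longrightarrow> \<rho> g = g"
    and "\<And>g. g \<in> generate H {h} \<Longrightarrow> \<mu> g = \<one>\<^bsub>H\<^esub>"
    "\<And>g. g \<in> M <#>\<^bsub>H\<^esub> B' \<Longrightarrow> \<rho> g = \<one>\<^bsub>H\<^esub>" "\<And>g. g \<in> M <#>\<^bsub>H\<^esub> B' \<Longrightarrow> \<mu> g = g"
    by (rule H.internal_direct_product_projections[OF dH'(1)], rule that)
  obtain \<tau> where \<tau>: "\<tau> \<in> hom ?C (add_monoid K)" "\<tau> h = \<one>"
    and \<tau>pow: "\<And>c c'. c \<in> generate H {h} \<Longrightarrow> c' \<in> generate H {h} \<Longrightarrow>
      c [^]\<^bsub>H\<^esub> (p ^ m) = c' [^]\<^bsub>H\<^esub> (p ^ m) \<Longrightarrow> \<tau> c = \<tau> c'"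
    using linear_functional_cyclic[OF fH hH h(2)] by blast
  note t = hom_KD[OF C.is_group \<tau>(1)]
  have \<tau>K: "\<tau> \<in> carrier ?C \<rightarrow> carrier K" using t(1) by auto
  obtain \<phi> where \<phi>: "\<phi> \<in> ring_iso (ga G) (ga H)" using iso by blast
  obtain \<phi>' where \<phi>': "\<phi>' \<in> ring_iso (ga H) (ga G)"
    and inv: "\<And>f. f \<in> carrier (ga G) \<Longrightarrow> \<phi>' (\<phi> f) = f" "\<And>f. f \<in> carrier (ga H) \<Longrightarrow> \<phi> (\<phi>' f) = f"
    by (rule ring_iso_inverse[OF RG.ring_axioms RH.ring_axioms \<phi>]) blast
  have \<phi>h: "\<phi> \<in> ring_hom (ga G) (ga H)" and \<phi>'h: "\<phi>' \<in> ring_hom (ga H) (ga G)"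
    using \<phi> \<phi>' by (auto simp: ring_iso_def)
  (* The central unit of kG that corresponds to h. *)
  define u where "u = \<phi>' (basis H h)"
  have eh: "basis H h \<in> carrier (ga H)" by (rule basis_mem[OF fH])
  have u: "u \<in> carrier (ga G)" "\<phi> u = basis H h"
    using ring_hom_closed[OF \<phi>'h eh] inv(2)[OF eh] by (simp_all add: u_def)
  have uq: "u [^]\<^bsub>ga G\<^esub> ?q = \<one>\<^bsub>ga G\<^esub>"
  proof -
    have "basis H h [^]\<^bsub>ga H\<^esub> ?q = \<one>\<^bsub>ga H\<^esub>"
      using basis_pow[OF fH hH, of ?q] H.pow_eq_id[OF hH, of ?q] h(2) by (simp add: ga_one[OF fH])
    then show ?thesis
      using ring_hom_pow[OF RH.ring_axioms RG.ring_axioms \<phi>'h eh, of ?q] ring_hom_one[OF \<phi>'h]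
      by (simp add: u_def)
  qed
  have ucen: "central G u"
    unfolding central_def
  proof (intro conjI u ballI)
    fix x assume "x \<in> carrier G"
    let ?x = "basis G x"
    have x: "?x \<in> carrier (ga G)" by (rule basis_mem[OF fG])
    have "\<phi>' (\<phi> ?x \<otimes>\<^bsub>ga H\<^esub> basis H h) = \<phi>' (basis H h \<otimes>\<^bsub>ga H\<^esub> \<phi> ?x)"
      using basis_central[OF fH hc ring_hom_closed[OF \<phi>h x]] by simp
    then show "?x \<otimes>\<^bsub>ga G\<^esub> u = u \<otimes>\<^bsub>ga G\<^esub> ?x"
      using ring_hom_mult[OF \<phi>'h] ring_hom_closed[OF \<phi>h x] eh inv(1)[OF x] by (simp add: u_def)
  qed
  obtain y where y: "y \<in> center G" "y [^]\<^bsub>G\<^esub> ?q = \<one>\<^bsub>G\<^esub>"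
    and lin_y: "\<And>\<delta>. \<delta> \<in> hom G (add_monoid K) \<Longrightarrow> lin G \<delta> u = \<delta> y"
    using central_unit_linear[OF G ucen uq] by blast
  have P: "push H ?C \<rho> \<in> ring_hom (ga H) (ga ?C)" by (rule push_ring_hom[OF fH fC \<rho>])
  note \<Theta> = ring_hom_comp[OF \<phi>h P]
  (* The units of the group algebra of <h> into which G is mapped, and their linear coefficients. *)
  define \<theta> where "\<theta> g = push H ?C \<rho> (\<phi> (basis G g))" for g
  have \<theta>c: "\<theta> g \<in> carrier (ga ?C)" for g
    unfolding \<theta>_def by (rule ring_hom_closed[OF \<Theta> basis_mem[OF fG]])
  have \<theta>1: "\<theta> \<one>\<^bsub>G\<^esub> = \<one>\<^bsub>ga ?C\<^esub>"
    unfolding \<theta>_def using ring_hom_one[OF \<Theta>] by (simp add: ga_one[OF fG])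
  have \<theta>m: "\<theta> (g \<otimes>\<^bsub>G\<^esub> k) = \<theta> g \<otimes>\<^bsub>ga ?C\<^esub> \<theta> k" if "g \<in> carrier G" "k \<in> carrier G" for g k
    unfolding \<theta>_def using ring_hom_mult[OF \<Theta> basis_mem[OF fG] basis_mem[OF fG], of g k] basis_mult[OF fG that]
    by simp
  define \<delta> where "\<delta> g = lin ?C \<tau> (\<theta> g)" for g
  have \<delta>: "\<delta> \<in> hom G (add_monoid K)"
  proof (rule homI)
    fix g k assume gk: "g \<in> carrier G" "k \<in> carrier G"
    have c: "\<delta> g \<in> carrier K" "\<delta> k \<in> carrier K"
      unfolding \<delta>_def by (rule additive_closed[OF lin_additive[OF fC \<tau>K] \<theta>c])+
    then show "\<delta> g \<in> carrier (add_monoid K)" by simp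
    have "lin ?C (\<lambda>_. \<one>) (\<theta> g) = \<one>" "lin ?C (\<lambda>_. \<one>) (\<theta> k) = \<one>"
      using aug_eq_one[OF G fC \<theta>c \<theta>1 \<theta>m] gk by auto
    then show "\<delta> (g \<otimes>\<^bsub>G\<^esub> k) = \<delta> g \<otimes>\<^bsub>add_monoid K\<^esub> \<delta> k"
      using lin_leibniz[OF fC \<tau>(1) \<theta>c \<theta>c, of g k] \<theta>m[OF gk] c by (simp add: \<delta>_def)
  qed
  note d = hom_KD[OF G.is_group \<delta>]
  have \<delta>K: "\<delta> \<in> carrier G \<rightarrow> carrier K" using d(1) by auto
  have "lin G \<delta> u = lin ?C \<tau> (push H ?C \<rho> (\<phi> u))"
    by (rule additive_eqI[OF fG abelian_group_axioms lin_additive[OF fG \<delta>K]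
          additive_comp[OF ring_hom_additive[OF \<Theta>] lin_additive[OF fC \<tau>K]] _ u(1)])
      (simp add: lin_basis[OF fG \<delta>K] \<delta>_def \<theta>_def)
  also have "\<dots> = \<one>"
    using u(2) push_basis[OF fH fC hH, of \<rho>] \<rho>id[OF hC] lin_basis[OF fC \<tau>K, of h] hC \<tau>(2) by simp
  finally have \<delta>y: "\<delta> y = \<one>" using lin_y[OF \<delta>] by simp
  obtain \<alpha> \<nu> where an: "\<alpha> \<in> hom G ?A" "\<nu> \<in> hom G ?N"
    and s: "\<And>g. g \<in> carrier G \<Longrightarrow> g = \<alpha> g \<otimes>\<^bsub>G\<^esub> \<nu> g"
    and v: "\<And>a. a \<in> A \<Longrightarrow> \<alpha> a = a" "\<And>a. a \<in> A \<Longrightarrow> \<nu> a = \<one>\<^bsub>G\<^esub>"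
      "\<And>n. n \<in> N \<Longrightarrow> \<alpha> n = \<one>\<^bsub>G\<^esub>" "\<And>n. n \<in> N \<Longrightarrow> \<nu> n = n"
    by (rule G.internal_direct_product_projections[OF dG], rule that)
  have yG: "y \<in> carrier G" using center_closed[OF y(1)] .
  define a where "a = \<alpha> y"
  define b where "b = \<nu> y"
  have aA: "a \<in> A" and bN: "b \<in> N" and yab: "y = a \<otimes>\<^bsub>G\<^esub> b"
    using hom_in_carrier[OF an(1) yG] hom_in_carrier[OF an(2) yG] s[OF yG] by (auto simp: a_def b_def)
  have aG: "a \<in> carrier G" and bG: "b \<in> carrier G"
    using subgroup.mem_carrier[OF sub(1) aA] subgroup.mem_carrier[OF sub(2) bN] .
  have pow: "\<alpha> (g [^]\<^bsub>G\<^esub> (i::nat)) = \<alpha> g [^]\<^bsub>G\<^esub> i" "\<nu> (g [^]\<^bsub>G\<^esub> i) = \<nu> g [^]\<^bsub>G\<^esub> i" if g: "g \<in> carrier G" for g i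
    using g v(1)[OF subgroup.one_closed[OF sub(1)]] v(4)[OF subgroup.one_closed[OF sub(2)]]
      hom_mult[OF an(1)] hom_mult[OF an(2)] by (induction i) auto
  have aq: "a [^]\<^bsub>G\<^esub> ?q = \<one>\<^bsub>G\<^esub>" and bq: "b [^]\<^bsub>G\<^esub> ?q = \<one>\<^bsub>G\<^esub>"
    using pow[OF yG, of ?q] y(2) v(1)[OF subgroup.one_closed[OF sub(1)]] v(4)[OF subgroup.one_closed[OF sub(2)]]
    by (simp_all add: a_def b_def del: power_Suc)
  have ac: "a \<in> center ?A" using GA.m_comm aA by (intro centerI) auto
  have bc: "b \<in> center ?N"
  proof (rule centerI)
    fix n assume "n \<in> carrier ?N"
    then have n: "n \<in> N" by simp
    have nG: "n \<in> carrier G" using subgroup.mem_carrier[OF sub(2) n] .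
    have "\<nu> (y \<otimes>\<^bsub>G\<^esub> n) = \<nu> (n \<otimes>\<^bsub>G\<^esub> y)" using center_commutes[OF y(1) nG] by simp
    then show "b \<otimes>\<^bsub>?N\<^esub> n = n \<otimes>\<^bsub>?N\<^esub> b"
      using hom_mult[OF an(2) yG nG] hom_mult[OF an(2) nG yG] v(4)[OF n] by (simp add: b_def)
  qed (use bN in simp)
  have Cq: "c [^]\<^bsub>?C\<^esub> ?q = \<one>\<^bsub>?C\<^esub>" if c: "c \<in> carrier ?C" for c
  proof -
    have "c \<in> generate H {h}" using c by simp
    then obtain i :: nat where i: "c = h [^]\<^bsub>H\<^esub> i"
      unfolding H.generate_pow_on_finite_carrier[OF H.finite_carrier hH] by blast
    have "(h [^]\<^bsub>H\<^esub> i) [^]\<^bsub>H\<^esub> ?q = \<one>\<^bsub>H\<^esub>"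
      using H.pow_eq_id[OF hH, of "i * ?q"] hH h(2) by (simp add: H.nat_pow_pow)
    then show ?thesis by (simp add: i H.nat_pow_consistent[symmetric])
  qed
  have \<tau>pow': "\<tau> c = \<tau> c'" if "c \<in> carrier ?C" "c' \<in> carrier ?C" "c [^]\<^bsub>?C\<^esub> (p ^ m) = c' [^]\<^bsub>?C\<^esub> (p ^ m)" for c c'
    by (rule \<tau>pow) (use that in \<open>simp_all add: H.nat_pow_consistent[symmetric]\<close>)
  have finC: "finite (carrier ?C)" using finite_group.finite_carrier[OF fC] .
  have criterion: "x [^]\<^bsub>G\<^esub> (p ^ m) \<noteq> \<one>\<^bsub>G\<^esub> \<and>
      (\<exists>D. internal_direct_product (G \<restriction> S) (generate G {x}) D)"
    if S: "subgroup S G" and x: "x \<in> center (G \<restriction> S)" "x [^]\<^bsub>G\<^esub> ?q = \<one>\<^bsub>G\<^esub>" "\<delta> x \<noteq> \<zero>" for S x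
  proof -
    let ?S = "G \<restriction> S"
    have pS: "finite_p_group p ?S" by (rule finite_p_group_subgroup[OF prime G S])
    have xS: "x \<in> S" using center_closed[OF x(1)] by simp
    have "x [^]\<^bsub>?S\<^esub> (p ^ m) \<noteq> \<one>\<^bsub>?S\<^esub> \<and> (\<exists>D. internal_direct_product ?S (generate ?S {x}) D)"
    proof (rule direct_factor_criterion[OF pS cC finC Cq \<tau>(1) \<tau>pow' \<theta>c _ _ x(1)])
      show "\<theta> \<one>\<^bsub>?S\<^esub> = \<one>\<^bsub>ga ?C\<^esub>" using \<theta>1 by simp
      show "\<theta> (k \<otimes>\<^bsub>?S\<^esub> l) = \<theta> k \<otimes>\<^bsub>ga ?C\<^esub> \<theta> l" if "k \<in> carrier ?S" "l \<in> carrier ?S" for k l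
        using \<theta>m[of k l] subgroup.mem_carrier[OF S] that by simp
      show "x [^]\<^bsub>?S\<^esub> ?q = \<one>\<^bsub>?S\<^esub>" using x(2) by (simp add: G.nat_pow_consistent[symmetric])
      show "lin ?C \<tau> (\<theta> x) \<noteq> \<zero>" using x(3) by (simp add: \<delta>_def)
    qed
    then show ?thesis
      using G.generate_consistent[OF _ S, of "{x}"] xS by (simp add: G.nat_pow_consistent[symmetric])
  qed
  (* Otherwise b would generate an abelian direct factor of N. *)
  have \<delta>b: "\<delta> b = \<zero>"
  proof (rule ccontr)
    assume "\<delta> b \<noteq> \<zero>"
    then obtain D where b1: "b [^]\<^bsub>G\<^esub> (p ^ m) \<noteq> \<one>\<^bsub>G\<^esub>"
      and D: "internal_direct_product ?N (generate G {b}) D"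
      using criterion[OF sub(2) bc bq] by blast
    have "abelian_decomposition ?N (generate G {b}) D"
      using D cyclic_comm_group[OF fG bG] by (simp add: abelian_decomposition_def)
    then have "generate G {b} = {\<one>\<^bsub>G\<^esub>}" using nG unfolding no_abelian_factor_def by force
    then have "b = \<one>\<^bsub>G\<^esub>" using generate.incl[of b "{b}" G] by auto
    then show False using b1 by simp
  qed
  have "\<delta> a \<noteq> \<zero>" using \<delta>y yab d(1,2) aG bG \<delta>b by simp
  then obtain A' where a1: "a [^]\<^bsub>G\<^esub> (p ^ m) \<noteq> \<one>\<^bsub>G\<^esub>"
    and dA: "internal_direct_product ?A (generate G {a}) A'"
    using criterion[OF sub(1) ac aq] by blast
  have aord: "G.ord a = ?q" by (rule G.ord_eq_prime_power[OF prime aG aq a1])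
  note dG' = G.internal_direct_product_assoc[OF dG dA]
  let ?Ca = "G \<restriction> generate G {a}" and ?L = "G \<restriction> (N <#>\<^bsub>G\<^esub> A')"
  have sCa: "subgroup (generate G {a}) G" using aG by (intro G.generate_is_subgroup) simp
  have fCa: "finite_group ?Ca" by (rule finite_group_subgroup[OF fG sCa])
  interpret Ca: comm_group ?Ca by (rule cyclic_comm_group[OF fG aG])
  interpret RCa: ring "ga ?Ca" by (rule ga_ring[OF fCa])
  obtain \<pi> \<kappa> where \<pi>: "\<pi> \<in> hom G ?Ca" "\<kappa> \<in> hom G ?L"
    and \<pi>s: "\<And>g. g \<in> carrier G \<Longrightarrow> g = \<pi> g \<otimes>\<^bsub>G\<^esub> \<kappa> g"
    and \<pi>a: "\<And>g. g \<in> generate G {a} \<Longrightarrow> \<pi> g = g" and "\<And>g. g \<in> generate G {a} \<Longrightarrow> \<kappa> g = \<one>\<^bsub>G\<^esub>"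
    and \<pi>N: "\<And>g. g \<in> N <#>\<^bsub>G\<^esub> A' \<Longrightarrow> \<pi> g = \<one>\<^bsub>G\<^esub>" and "\<And>g. g \<in> N <#>\<^bsub>G\<^esub> A' \<Longrightarrow> \<kappa> g = g"
    by (rule G.internal_direct_product_projections[OF dG'(1)], rule that)
  have aCa: "a \<in> generate G {a}" by (auto intro: generate.incl)
  have sA': "subgroup A' G"
    using dA G.incl_subgroup[OF sub(1)] unfolding GA.internal_direct_product_iff by blast
  have "b \<in> N <#>\<^bsub>G\<^esub> A'" using G.subset_set_mult[OF sub(2) sA'] bN by blast
  then have \<pi>y: "\<pi> y = a"
    using hom_mult[OF \<pi>(1) aG bG] \<pi>a[OF aCa] \<pi>N aG yab by simp
  obtain \<tau>' where \<tau>': "\<tau>' \<in> hom ?Ca (add_monoid K)" "\<tau>' a = \<one>"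
    using linear_functional_cyclic[OF fG aG aord] by blast
  note t' = hom_KD[OF Ca.is_group \<tau>'(1)]
  have \<tau>'K: "\<tau>' \<in> carrier ?Ca \<rightarrow> carrier K" using t'(1) by auto
  (* The unit u and the element y also have the same linear coefficient after projection to <a>. *)
  have "(\<lambda>g. \<tau>' (\<pi> g)) \<in> hom G (add_monoid K)"
    using hom_compose[OF \<pi>(1) \<tau>'(1)] by (simp add: comp_def)
  then have "lin G (\<lambda>g. \<tau>' (\<pi> g)) u = \<one>" using lin_y \<pi>y \<tau>'(2) by simp
  moreover have "lin ?Ca \<tau>' (push G ?Ca \<pi> u) = lin G (\<lambda>g. \<tau>' (\<pi> g)) u"
    by (rule lin_push[OF fG fCa _ \<tau>'K u(1)]) (use hom_in_carrier[OF \<pi>(1)] in auto)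
  ultimately have lin1: "lin ?Ca \<tau>' (push G ?Ca \<pi> u) = \<one>" by simp
  have P\<pi>: "push G ?Ca \<pi> \<in> ring_hom (ga G) (ga ?Ca)" by (rule push_ring_hom[OF fG fCa \<pi>(1)])
  have aug1: "lin ?Ca (\<lambda>_. \<one>) (push G ?Ca \<pi> u) = \<one>"
    by (rule aug_of_unit[OF fCa ring_hom_closed[OF P\<pi> u(1)], of "Suc m"])
      (use ring_hom_pow[OF RG.ring_axioms RCa.ring_axioms P\<pi> u(1), of ?q] uq ring_hom_one[OF P\<pi>] in simp)
  have "ring_iso (ga ?L) (ga (H \<restriction> (M <#>\<^bsub>H\<^esub> B'))) \<noteq> {}"
    by (rule cancel_cyclic_factor[OF G H aG aord hH h(2) dG'(1) dH'(1) \<phi> u \<pi> \<pi>s \<tau>' aug1 lin1])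
  moreover have "a \<noteq> \<one>\<^bsub>G\<^esub>" using a1 by auto
  ultimately show ?thesis using aA h aord dA dB by (metis)
qed

text \<open>
  Induction on the order of \<open>A\<close>: matching cyclic factors are removed from both groups as long as
  \<open>B\<close> is not trivial. If \<open>B\<close> is trivial then so is \<open>A\<close>, for otherwise the same argument with the roles of
  the groups exchanged would find an element other than 1 in \<open>B\<close>.
\<close>

lemma abelian_factor_determined:
  assumes "finite_p_group p G" and "finite_p_group p H"
    and "internal_direct_product G A N" and "comm_group (G \<restriction> A)"
    and "no_abelian_factor (G \<restriction> N)"
    and "internal_direct_product H B M" and "comm_group (H \<restriction> B)"
    and "no_abelian_factor (H \<restriction> M)"
    and "ring_iso (ga G) (ga H) \<noteq> {}"
  shows "ring_iso (ga (G \<restriction> N)) (ga (H \<restriction> M)) \<noteq> {} \<and>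
    G \<restriction> A \<cong> H \<restriction> B"
  using assms
proof (induction "card A" arbitrary: G H A B rule: less_induct)
  case less
  have fG: "finite_group G" and fH: "finite_group H" using finite_p_groupD less.prems by auto
  interpret G: finite_group G by (rule fG)
  interpret H: finite_group H by (rule fH)
  note rG = less.prems(3)[unfolded G.internal_direct_product_iff]
    and rH = less.prems(6)[unfolded H.internal_direct_product_iff]
  have sub: "subgroup A G" "subgroup N G" "subgroup B H" "subgroup M H" using rG rH by auto
  interpret GA: comm_group "G \<restriction> A" by (rule less.prems(4))
  interpret HB: comm_group "H \<restriction> B" by (rule less.prems(7))
  show ?case
  proof (cases "B = {\<one>\<^bsub>H\<^esub>}")
    case False
    obtain a h A' B' where a: "a \<in> A" "a \<noteq> \<one>\<^bsub>G\<^esub>" and h: "h \<in> B" and ord: "G.ord a = H.ord h"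
      and dA: "internal_direct_product (G \<restriction> A) (generate G {a}) A'"
      and dB: "internal_direct_product (H \<restriction> B) (generate H {h}) B'"
      and iso: "ring_iso (ga (G \<restriction> (N <#>\<^bsub>G\<^esub> A'))) (ga (H \<restriction> (M <#>\<^bsub>H\<^esub> B'))) \<noteq> {}"
      using matching_cyclic_factors[OF less.prems(1-7,9) False] by blast
    note dG' = G.internal_direct_product_assoc[OF less.prems(3) dA]
      and dH' = H.internal_direct_product_assoc[OF less.prems(6) dB]
    let ?L = "G \<restriction> (N <#>\<^bsub>G\<^esub> A')" and ?L' = "H \<restriction> (M <#>\<^bsub>H\<^esub> B')"
    have aG: "a \<in> carrier G" and hH: "h \<in> carrier H"
      using subgroup.mem_carrier[OF sub(1) a(1)] subgroup.mem_carrier[OF sub(3) h] .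
    have sA': "subgroup A' (G \<restriction> A)" and sB': "subgroup B' (H \<restriction> B)"
      using dA dB unfolding GA.internal_direct_product_iff HB.internal_direct_product_iff by auto
    have "comm_group (G \<restriction> A')" "comm_group (H \<restriction> B')"
      using GA.subgroup_comm_group[OF sA'] HB.subgroup_comm_group[OF sB'] by simp_all
    moreover have "card A' < card A"
    proof -
      have finA: "finite A" using subgroup.subset[OF sub(1)] G.finite_carrier by (rule finite_subset)
      have "card A = card (generate G {a}) * card A'"
        using GA.internal_direct_product_card[OF dA] by simp
      moreover have "card (generate G {a}) \<noteq> 1"
        using a aG G.generate_pow_card[OF aG] G.ord_eq_1[OF aG] by simp
      moreover have "card A > 0" using finA a(1) card_gt_0_iff by blast
      ultimately show ?thesis by (cases "card (generate G {a})") auto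
    qed
    moreover have "finite_p_group p ?L" "finite_p_group p ?L'"
      using finite_p_group_subgroup[OF prime less.prems(1) dG'(3)]
        finite_p_group_subgroup[OF prime less.prems(2) dH'(3)] .
    ultimately have IH: "ring_iso (ga (G \<restriction> N)) (ga (H \<restriction> M)) \<noteq> {}"
      "G \<restriction> A' \<cong> H \<restriction> B'"
      using less.hyps[of A' ?L ?L' B'] dG'(2) dH'(2) less.prems(5,8) iso by simp_all
    have "G \<restriction> generate G {a} \<cong> H \<restriction> generate H {h}"
      by (rule cyclic_groups_iso[OF fG aG fH hH ord])
    then have "G \<restriction> A \<cong> H \<restriction> B"
      using internal_direct_product_iso[OF GA.is_group HB.is_group dA dB] IH(2) by simp
    then show ?thesis using IH by blast
  next
    case B: True
    have iso': "ring_iso (ga H) (ga G) \<noteq> {}"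
      using less.prems(9) ring_iso_inverse[OF ga_ring[OF fG] ga_ring[OF fH]] by (metis all_not_in_conv)
    have A: "A = {\<one>\<^bsub>G\<^esub>}"
    proof (rule ccontr)
      assume "A \<noteq> {\<one>\<^bsub>G\<^esub>}"
      then have "\<exists>b\<in>B. b \<noteq> \<one>\<^bsub>H\<^esub>"
        using matching_cyclic_factors[OF less.prems(2,1,6,7,8,3,4) iso'] by blast
      then show False using B by blast
    qed
    have "N = carrier G" "M = carrier H"
      using A B rG rH subgroup.mem_carrier[OF sub(2)] subgroup.mem_carrier[OF sub(4)] by auto
    moreover have "G \<restriction> A \<cong> H \<restriction> B"
      by (rule is_isoI[of "\<lambda>_. \<one>\<^bsub>H\<^esub>"]) (simp add: A B iso_def hom_def bij_betw_def)
    ultimately show ?thesis using less.prems(9) by simp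
  qed
qed

end

theorem theorem1:
  fixes p :: nat
    and K :: "('k, 'm) ring_scheme"
    and G :: "('g, 'n) monoid_scheme"
    and H :: "('h, 'l) monoid_scheme"
  assumes "Factorial_Ring.prime p"
    and "field K" and "card (carrier K) = p"
    and "finite_p_group p G" and "finite_p_group p H"
    and "Ab_NAb_decomposition G AbG NAbG"
    and "Ab_NAb_decomposition H AbH NAbH"
  shows "algebra_isomorphic K (group_algebra K G) (group_algebra K H) \<longleftrightarrow>
    algebra_isomorphic K (group_algebra K (G\<lparr>carrier := NAbG\<rparr>)) (group_algebra K (H\<lparr>carrier := NAbH\<rparr>)) \<and>
    G\<lparr>carrier := AbG\<rparr> \<cong> H\<lparr>carrier := AbH\<rparr>"
proof -
  interpret prime_field K p
    using assms(1-3) by (simp add: prime_field_def prime_field_axioms_def)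
  have fG: "finite_group G" and fH: "finite_group H" using finite_p_groupD assms(4,5) by auto
  interpret G: finite_group G by (rule fG)
  interpret H: finite_group H by (rule fH)
  have dG: "internal_direct_product G AbG NAbG" "comm_group (G \<restriction> AbG)"
    and dH: "internal_direct_product H AbH NAbH" "comm_group (H \<restriction> AbH)"
    using assms(6,7) by (auto simp: Ab_NAb_decomposition_def abelian_decomposition_def)
  have "subgroup NAbG G" "subgroup NAbH H"
    using dG(1) dH(1) unfolding G.internal_direct_product_iff H.internal_direct_product_iff by auto
  then have fN: "finite_group (G \<restriction> NAbG)" "finite_group (H \<restriction> NAbH)"
    using finite_group_subgroup[OF fG] finite_group_subgroup[OF fH] by auto
  show ?thesis
    unfolding algebra_isomorphic_iff_ring_iso[OF fG fH] algebra_isomorphic_iff_ring_iso[OF fN]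
    using abelian_factor_determined[OF assms(4,5) dG NAb_no_abelian_factor[OF G.is_group assms(6)]
        dH NAb_no_abelian_factor[OF H.is_group assms(7)]]
      factor_ring_iso[OF fG fH dG(1) dH(1)] by blast
qed

end
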